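(* Let $\mathbb{K}$ be a field and $B$ a brace algebra over $\mathbb{K}$. Then the dendriform enveloping algebra $\widetilde{\mathcal U}(B)$ is a dendriform bialgebra, for the coproduct induced from $\widetilde D(B)$ by passing to the quotient.
   Context: Work over a field $\mathbb{K}$. **Dendriform algebras.** A dendriform algebra is a vector space $W$ with bilinear products $\prec,\succ$ such that $(x\prec y)\prec z=x\prec(y\prec z)+x\prec(y\succ z)$, $(x\succ y)\prec z=x\succ(y\prec z)$ (written $x\succ y\prec z$), $x\succ(y\succ z)=(x\succ y)\succ z+(x\prec y)\succ z$. The product $x*y:=x\prec y+x\succ y$ is associative. $D(V)$ denotes the free dendriform algebra on $V$. Define $\nearrow(x_1)=x_1$, $\nearrow(x_1,\dots,x_n)=x_1\prec\nearrow(x_2,\dots,x_n)$, and $\searrow(x_1)=x_1$, $\searrow(x_1,\dots,x_{n+1})=\searrow(x_1,\dots,x_n)\succ x_{n+1}$. **Brace algebras.** A brace algebra is a vector space $B$ with multilinear operations $\{x_1\mid x_2,\dots,x_{n+1}\}$, $n\ge1$, such that for all $n,m\ge 1$ $$\{\{z\mid x_1,\dots,x_n\}\mid y_1,\dots,y_m\}=\sum\{z\mid Y_0,\{x_1\mid Y_1\},Y_2,\{x_2\mid Y_3\},Y_4,\dots,Y_{2n-2},\{x_n\mid Y_{2n-1}\},Y_{2n}\},$$ the sum being over partitions of the ordered sequence $y_1,\dots,y_m$ into successive, possibly empty, intervals $Y_0\sqcup\dots\sqcup Y_{2n}$, with $\{x\mid\ \}=x$. A dendriform algebra $D$ has an underlying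 brace algebra $D_{\mathrm{Brace}}$ with $$\{x_1\mid x_2,\dots,x_{n+1}\}=\sum_{i=1}^{n+1}(-1)^{i-1}\nearrow(x_2,\dots,x_i)\succ x_1\prec\searrow(x_{i+1},\dots,x_{n+1}),$$ where the terms $i=1$ and $i=n+1$ are read as $x_1\prec\searrow(x_2,\dots,x_{n+1})$ and $(-1)^n\nearrow(x_2,\dots,x_{n+1})\succ x_1$. **Unital dendriform algebras.** A unital dendriform algebra is a vector space $W=\mathbb{K}\cdot1\oplus V$ with maps $\prec,\succ:V\otimes W+W\otimes V\to V$ such that $(V,\prec,\succ)$ is a dendriform algebra and $1\prec x=x\succ1=0$, $x\prec1=1\succ x=x$ for $x\in V$; put $1*1=1$. For a dendriform algebra $D$, $\widetilde D:=\mathbb{K}\cdot1\oplus D$. **Dendriform bialgebras.** A dendriform bialgebra is a unital dendriform algebra $W=\mathbb{K}\cdot1\oplus V$ with a coassociative coproduct $\Delta:W\to W\otimes W$ such that $\Delta(1)=1\otimes1$, the projection onto $\mathbb{K}\cdot 1$ along $V$ is a counit, and for all $x,y\in V$ (Sweedler notation) $$\Delta(x\succ y)=(x_{(1)}*y_{(1)})\otimes(x_{(2)}\succ y_{(2)})-(x*y)\otimes(1\succ1)+(x\succ y)\otimes1,$$ $$\Delta(x\prec y)=(x_{(1)}*y_{(1)})\otimes(x_{(2)}\prec y_{(2)})-(x*y)\otimes(1\prec1)+(x\prec y)\otimes1,$$ where subtracting the undefined terms $1\succ1$, $1\prec1$ means that in the Sweedler sum the single term with $x_{(2)}=y_{(2)}=1$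 is omitted. **Coproduct on $\widetilde D(V)$.** For $x,y\in\widetilde D(V)$, $v\in V$, put $x\stackrel{v}{\vee}y=x\succ v\prec y$. Then $\widetilde D(V)$ is a dendriform bialgebra for the unique coproduct with $\Delta(1)=1\otimes1$ and $\Delta(x\stackrel{v}{\vee}y)=(x\stackrel{v}{\vee}y)\otimes1+(x_{(1)}*y_{(1)})\otimes(x_{(2)}\stackrel{v}{\vee}y_{(2)})$; elements of $V$ are primitive. **Enveloping algebra.** For a brace algebra $B$, $\mathcal U(B)$ is the quotient of $D(B)$ by the dendriform ideal generated by the differences between the brace operation $\{x_1\mid x_2,\dots,x_{n+1}\}$ computed in $D(B)_{\mathrm{Brace}}$ and the one computed in $B$, for $n\ge1$, $x_i\in B$. The dendriform enveloping algebra is the unital dendriform algebra $\widetilde{\mathcal U}(B)=\mathbb{K}\cdot1\oplus\mathcal U(B)$. *)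

theory Defs
  imports "HOL-Algebra.Module" "HOL-Algebra.AbelCoset"
begin

text \<open>
  Vector spaces over a field \<open>K\<close> are modules \<open>M\<close> with \<open>field K\<close> and \<open>module K M\<close>. The record type
  \<open>module\<close> extends \<open>ring\<close>, so it has components \<open>mult\<close> and \<open>one\<close> which are irrelevant to a module;
  in constructions of mere modules they are set to \<open>undefined\<close>.
\<close>

section \<open>Linear algebra on carriers\<close>

definition linear_map ::
  "('k, 'r) ring_scheme \<Rightarrow> ('k, 'a, 'm) module_scheme \<Rightarrow> ('k, 'b, 'n) module_scheme \<Rightarrow> ('a \<Rightarrow> 'b) \<Rightarrow> bool"
  where "linear_map K M N f \<longleftrightarrow>
    f \<in> carrier M \<rightarrow> carrier N \<and>
    (\<forall>x\<in>carrier M. \<forall>y\<in>carrier M. f (x \<oplus>\<^bsub>M\<^esub> y) = f x \<oplus>\<^bsub>N\<^esub> f y) \<and>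
    (\<forall>a\<in>carrier K. \<forall>x\<in>carrier M. f (a \<odot>\<^bsub>M\<^esub> x) = a \<odot>\<^bsub>N\<^esub> f x)"

definition bilinear_map ::
  "('k, 'r) ring_scheme \<Rightarrow> ('k, 'a, 'm) module_scheme \<Rightarrow> ('k, 'b, 'n) module_scheme \<Rightarrow>
    ('k, 'c, 'p) module_scheme \<Rightarrow> ('a \<Rightarrow> 'b \<Rightarrow> 'c) \<Rightarrow> bool"
  where "bilinear_map K M N P f \<longleftrightarrow>
    (\<forall>x\<in>carrier M. linear_map K N P (f x)) \<and>
    (\<forall>y\<in>carrier N. linear_map K M P (\<lambda>x. f x y))"

definition submodule_generated ::
  "('k, 'r) ring_scheme \<Rightarrow> ('k, 'a, 'm) module_scheme \<Rightarrow> 'a set \<Rightarrow> 'a set"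
  where "submodule_generated K M S = \<Inter>{N. submodule N K M \<and> S \<subseteq> N}"

definition module_quot :: "('k, 'a, 'm) module_scheme \<Rightarrow> 'a set \<Rightarrow> ('k, 'a set) module"
  where "module_quot M N =
    \<lparr>carrier = a_rcosets\<^bsub>M\<^esub> N, mult = undefined, one = undefined, zero = N, add = set_add M,
     smult = (\<lambda>a X. \<Union>x\<in>X. N +>\<^bsub>M\<^esub> (a \<odot>\<^bsub>M\<^esub> x))\<rparr>"

text \<open>The free vector space on a set \<open>X\<close>: finitely supported functions vanishing outside \<open>X\<close>.\<close>

definition free_module :: "('k, 'r) ring_scheme \<Rightarrow> 'x set \<Rightarrow> ('k, 'x \<Rightarrow> 'k) module"
  where "free_module K X =
    \<lparr>carrier = {f. range f \<subseteq> carrier K \<and> finite {x. f x \<noteq> \<zero>\<^bsub>K\<^esub>} \<and> {x. f x \<noteq> \<zero>\<^bsub>K\<^esub>} \<subseteq> X},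
     mult = undefined, one = undefined,
     zero = (\<lambda>x. \<zero>\<^bsub>K\<^esub>), add = (\<lambda>f g x. f x \<oplus>\<^bsub>K\<^esub> g x), smult = (\<lambda>a f x. a \<otimes>\<^bsub>K\<^esub> f x)\<rparr>"

definition basis_elem :: "('k, 'r) ring_scheme \<Rightarrow> 'x \<Rightarrow> 'x \<Rightarrow> 'k"
  where "basis_elem K x = (\<lambda>y. if y = x then \<one>\<^bsub>K\<^esub> else \<zero>\<^bsub>K\<^esub>)"

section \<open>Tensor products\<close>

definition tensor_relations ::
  "('k, 'r) ring_scheme \<Rightarrow> ('k, 'a, 'm) module_scheme \<Rightarrow> ('k, 'b, 'n) module_scheme \<Rightarrow>
    ('a \<times> 'b \<Rightarrow> 'k) set"
  where "tensor_relations K M N = (let F = free_module K (carrier M \<times> carrier N); e = basis_elem K in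
      {e (x \<oplus>\<^bsub>M\<^esub> x', y) \<ominus>\<^bsub>F\<^esub> (e (x, y) \<oplus>\<^bsub>F\<^esub> e (x', y)) | x x' y.
         x \<in> carrier M \<and> x' \<in> carrier M \<and> y \<in> carrier N}
    \<union> {e (x, y \<oplus>\<^bsub>N\<^esub> y') \<ominus>\<^bsub>F\<^esub> (e (x, y) \<oplus>\<^bsub>F\<^esub> e (x, y')) | x y y'.
         x \<in> carrier M \<and> y \<in> carrier N \<and> y' \<in> carrier N}
    \<union> {e (a \<odot>\<^bsub>M\<^esub> x, y) \<ominus>\<^bsub>F\<^esub> (a \<odot>\<^bsub>F\<^esub> e (x, y)) | a x y.
         a \<in> carrier K \<and> x \<in> carrier M \<and> y \<in> carrier N}
    \<union> {e (x, a \<odot>\<^bsub>N\<^esub> y) \<ominus>\<^bsub>F\<^esub> (a \<odot>\<^bsub>F\<^esub> e (x, y)) | a x y.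
         a \<in> carrier K \<and> x \<in> carrier M \<and> y \<in> carrier N})"

definition tensor_kernel ::
  "('k, 'r) ring_scheme \<Rightarrow> ('k, 'a, 'm) module_scheme \<Rightarrow> ('k, 'b, 'n) module_scheme \<Rightarrow>
    ('a \<times> 'b \<Rightarrow> 'k) set"
  where "tensor_kernel K M N =
    submodule_generated K (free_module K (carrier M \<times> carrier N)) (tensor_relations K M N)"

definition tensor ::
  "('k, 'r) ring_scheme \<Rightarrow> ('k, 'a, 'm) module_scheme \<Rightarrow> ('k, 'b, 'n) module_scheme \<Rightarrow>
    ('k, ('a \<times> 'b \<Rightarrow> 'k) set) module"
  where "tensor K M N =
    module_quot (free_module K (carrier M \<times> carrier N)) (tensor_kernel K M N)"

definition pure_tensor ::
  "('k, 'r) ring_scheme \<Rightarrow> ('k, 'a, 'm) module_scheme \<Rightarrow> ('k, 'b, 'n) module_scheme \<Rightarrow>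
    'a \<Rightarrow> 'b \<Rightarrow> ('a \<times> 'b \<Rightarrow> 'k) set"
  where "pure_tensor K M N x y =
    tensor_kernel K M N +>\<^bsub>free_module K (carrier M \<times> carrier N)\<^esub> basis_elem K (x, y)"

text \<open>
  The linear map \<open>M \<otimes> N \<rightarrow> P\<close> induced by a bilinear \<open>b\<close>. For bilinear \<open>b\<close> the sum
  takes the same value on every representative of a coset, so the image below is a singleton.
\<close>

definition tensor_lift ::
  "('k, 'r) ring_scheme \<Rightarrow> ('k, 'c, 'p) module_scheme \<Rightarrow> ('a \<Rightarrow> 'b \<Rightarrow> 'c) \<Rightarrow>
    ('a \<times> 'b \<Rightarrow> 'k) set \<Rightarrow> 'c"
  where "tensor_lift K P b T =
    the_elem ((\<lambda>t. \<Oplus>\<^bsub>P\<^esub>p\<in>{p. t p \<noteq> \<zero>\<^bsub>K\<^esub>}. t p \<odot>\<^bsub>P\<^esub> b (fst p) (snd p)) ` T)"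

text \<open>\<open>f \<otimes> g : M \<otimes> N \<rightarrow> M' \<otimes> N'\<close>; only the target spaces are needed as arguments.\<close>

definition tensor_map ::
  "('k, 'r) ring_scheme \<Rightarrow> ('k, 'c, 'p) module_scheme \<Rightarrow> ('k, 'd, 'q) module_scheme \<Rightarrow>
    ('a \<Rightarrow> 'c) \<Rightarrow> ('b \<Rightarrow> 'd) \<Rightarrow> ('a \<times> 'b \<Rightarrow> 'k) set \<Rightarrow> ('c \<times> 'd \<Rightarrow> 'k) set"
  where "tensor_map K M' N' f g =
    tensor_lift K (tensor K M' N') (\<lambda>x y. pure_tensor K M' N' (f x) (g y))"

text \<open>
  For bilinear \<open>f\<close>, \<open>g\<close> on \<open>W\<close>, the bilinear operation on \<open>W \<otimes> W\<close> sending
  \<open>(x \<otimes> x', y \<otimes> y')\<close> to \<open>f x y \<otimes> g x' y'\<close>.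
\<close>

definition tensor_op ::
  "('k, 'r) ring_scheme \<Rightarrow> ('k, 'a, 'm) module_scheme \<Rightarrow> ('a \<Rightarrow> 'a \<Rightarrow> 'a) \<Rightarrow> ('a \<Rightarrow> 'a \<Rightarrow> 'a) \<Rightarrow>
    ('a \<times> 'a \<Rightarrow> 'k) set \<Rightarrow> ('a \<times> 'a \<Rightarrow> 'k) set \<Rightarrow> ('a \<times> 'a \<Rightarrow> 'k) set"
  where "tensor_op K W f g S T =
    tensor_lift K (tensor K W W)
      (\<lambda>x x'. tensor_lift K (tensor K W W) (\<lambda>y y'. pure_tensor K W W (f x y) (g x' y')) T) S"

text \<open>The canonical map \<open>(W \<otimes> W) \<otimes> W \<rightarrow> W \<otimes> (W \<otimes> W)\<close>.\<close>

definition tensor_assoc ::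
  "('k, 'r) ring_scheme \<Rightarrow> ('k, 'a, 'm) module_scheme \<Rightarrow>
    (('a \<times> 'a \<Rightarrow> 'k) set \<times> 'a \<Rightarrow> 'k) set \<Rightarrow> ('a \<times> ('a \<times> 'a \<Rightarrow> 'k) set \<Rightarrow> 'k) set"
  where "tensor_assoc K W = (let P = tensor K W (tensor K W W) in
    tensor_lift K P (\<lambda>t z. tensor_lift K P
      (\<lambda>x y. pure_tensor K W (tensor K W W) x (pure_tensor K W W y z)) t))"

section \<open>Dendriform algebras\<close>

record ('k, 'a) dendriform = "('k, 'a) module" +
  dprec :: "'a \<Rightarrow> 'a \<Rightarrow> 'a" (infixl \<open>\<prec>\<index>\<close> 70)
  dsucc :: "'a \<Rightarrow> 'a \<Rightarrow> 'a" (infixl \<open>\<succ>\<index>\<close> 70)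

locale dendriform_algebra = field K + module K D
  for K :: "('k, 'r) ring_scheme" and D :: "('k, 'a, 'm) dendriform_scheme" +
  assumes dprec_bilinear: "bilinear_map K D D D (dprec D)"
    and dsucc_bilinear: "bilinear_map K D D D (dsucc D)"
    and prec_prec: "\<lbrakk>x \<in> carrier D; y \<in> carrier D; z \<in> carrier D\<rbrakk> \<Longrightarrow>
      (x \<prec>\<^bsub>D\<^esub> y) \<prec>\<^bsub>D\<^esub> z = x \<prec>\<^bsub>D\<^esub> (y \<prec>\<^bsub>D\<^esub> z) \<oplus>\<^bsub>D\<^esub> x \<prec>\<^bsub>D\<^esub> (y \<succ>\<^bsub>D\<^esub> z)"
    and succ_prec: "\<lbrakk>x \<in> carrier D; y \<in> carrier D; z \<in> carrier D\<rbrakk> \<Longrightarrow>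
      (x \<succ>\<^bsub>D\<^esub> y) \<prec>\<^bsub>D\<^esub> z = x \<succ>\<^bsub>D\<^esub> (y \<prec>\<^bsub>D\<^esub> z)"
    and succ_succ: "\<lbrakk>x \<in> carrier D; y \<in> carrier D; z \<in> carrier D\<rbrakk> \<Longrightarrow>
      x \<succ>\<^bsub>D\<^esub> (y \<succ>\<^bsub>D\<^esub> z) = (x \<succ>\<^bsub>D\<^esub> y) \<succ>\<^bsub>D\<^esub> z \<oplus>\<^bsub>D\<^esub> (x \<prec>\<^bsub>D\<^esub> y) \<succ>\<^bsub>D\<^esub> z"

definition dendriform_ideal ::
  "('k, 'r) ring_scheme \<Rightarrow> ('k, 'a, 'm) dendriform_scheme \<Rightarrow> 'a set \<Rightarrow> bool"
  where "dendriform_ideal K D I \<longleftrightarrow> submodule I K D \<and>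
    (\<forall>x\<in>carrier D. \<forall>i\<in>I. x \<prec>\<^bsub>D\<^esub> i \<in> I \<and> i \<prec>\<^bsub>D\<^esub> x \<in> I \<and> x \<succ>\<^bsub>D\<^esub> i \<in> I \<and> i \<succ>\<^bsub>D\<^esub> x \<in> I)"

definition dendriform_ideal_generated ::
  "('k, 'r) ring_scheme \<Rightarrow> ('k, 'a, 'm) dendriform_scheme \<Rightarrow> 'a set \<Rightarrow> 'a set"
  where "dendriform_ideal_generated K D S = \<Inter>{I. dendriform_ideal K D I \<and> S \<subseteq> I}"

definition dendriform_quot ::
  "('k, 'a, 'm) dendriform_scheme \<Rightarrow> 'a set \<Rightarrow> ('k, 'a set) dendriform"
  where "dendriform_quot D I =
    \<lparr>carrier = a_rcosets\<^bsub>D\<^esub> I, mult = undefined, one = undefined, zero = I, add = set_add D,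
     smult = (\<lambda>a X. \<Union>x\<in>X. I +>\<^bsub>D\<^esub> (a \<odot>\<^bsub>D\<^esub> x)),
     dprec = (\<lambda>X Y. \<Union>x\<in>X. \<Union>y\<in>Y. I +>\<^bsub>D\<^esub> (x \<prec>\<^bsub>D\<^esub> y)),
     dsucc = (\<lambda>X Y. \<Union>x\<in>X. \<Union>y\<in>Y. I +>\<^bsub>D\<^esub> (x \<succ>\<^bsub>D\<^esub> y))\<rparr>"

subsection \<open>The free dendriform algebra\<close>

text \<open>
  The free dendriform algebra on a vector space \<open>V\<close> by generators and relations: start from the
  free vector space on all formal words in two binary operations and generators from the set
  \<open>carrier V\<close>, with the operations extended bilinearly, and divide by the ideal that
  makes the inclusion of generators linear and enforces the dendriform axioms.
\<close>

datatype 'v dterm = Gen 'v | Prec "'v dterm" "'v dterm" | Succ "'v dterm" "'v dterm"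

definition free_two_ops ::
  "('k, 'r) ring_scheme \<Rightarrow> ('k, 'v, 'm) module_scheme \<Rightarrow> ('k, 'v dterm \<Rightarrow> 'k) dendriform"
  where "free_two_ops K V = (let F = free_module K {t. set_dterm t \<subseteq> carrier V} in
    \<lparr>carrier = carrier F, mult = undefined, one = undefined, zero = zero F, add = add F,
     smult = smult F,
     dprec = (\<lambda>f g t. case t of Prec t1 t2 \<Rightarrow> f t1 \<otimes>\<^bsub>K\<^esub> g t2 | _ \<Rightarrow> \<zero>\<^bsub>K\<^esub>),
     dsucc = (\<lambda>f g t. case t of Succ t1 t2 \<Rightarrow> f t1 \<otimes>\<^bsub>K\<^esub> g t2 | _ \<Rightarrow> \<zero>\<^bsub>K\<^esub>)\<rparr>)"

definition free_dendriform_relations ::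
  "('k, 'r) ring_scheme \<Rightarrow> ('k, 'v, 'm) module_scheme \<Rightarrow> ('v dterm \<Rightarrow> 'k) set"
  where "free_dendriform_relations K V = (let F = free_two_ops K V; g = (\<lambda>v. basis_elem K (Gen v)) in
      {g (v \<oplus>\<^bsub>V\<^esub> w) \<ominus>\<^bsub>F\<^esub> (g v \<oplus>\<^bsub>F\<^esub> g w) | v w. v \<in> carrier V \<and> w \<in> carrier V}
    \<union> {g (a \<odot>\<^bsub>V\<^esub> v) \<ominus>\<^bsub>F\<^esub> (a \<odot>\<^bsub>F\<^esub> g v) | a v. a \<in> carrier K \<and> v \<in> carrier V}
    \<union> {((x \<prec>\<^bsub>F\<^esub> y) \<prec>\<^bsub>F\<^esub> z) \<ominus>\<^bsub>F\<^esub> (x \<prec>\<^bsub>F\<^esub> (y \<prec>\<^bsub>F\<^esub> z) \<oplus>\<^bsub>F\<^esub> x \<prec>\<^bsub>F\<^esub> (y \<succ>\<^bsub>F\<^esub> z)) | x y z.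
         x \<in> carrier F \<and> y \<in> carrier F \<and> z \<in> carrier F}
    \<union> {((x \<succ>\<^bsub>F\<^esub> y) \<prec>\<^bsub>F\<^esub> z) \<ominus>\<^bsub>F\<^esub> (x \<succ>\<^bsub>F\<^esub> (y \<prec>\<^bsub>F\<^esub> z)) | x y z.
         x \<in> carrier F \<and> y \<in> carrier F \<and> z \<in> carrier F}
    \<union> {(x \<succ>\<^bsub>F\<^esub> (y \<succ>\<^bsub>F\<^esub> z)) \<ominus>\<^bsub>F\<^esub> ((x \<succ>\<^bsub>F\<^esub> y) \<succ>\<^bsub>F\<^esub> z \<oplus>\<^bsub>F\<^esub> (x \<prec>\<^bsub>F\<^esub> y) \<succ>\<^bsub>F\<^esub> z) | x y z.
         x \<in> carrier F \<and> y \<in> carrier F \<and> z \<in> carrier F})"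

definition free_dendriform_kernel ::
  "('k, 'r) ring_scheme \<Rightarrow> ('k, 'v, 'm) module_scheme \<Rightarrow> ('v dterm \<Rightarrow> 'k) set"
  where "free_dendriform_kernel K V =
    dendriform_ideal_generated K (free_two_ops K V) (free_dendriform_relations K V)"

definition free_dendriform ::
  "('k, 'r) ring_scheme \<Rightarrow> ('k, 'v, 'm) module_scheme \<Rightarrow> ('k, ('v dterm \<Rightarrow> 'k) set) dendriform"
  where "free_dendriform K V = dendriform_quot (free_two_ops K V) (free_dendriform_kernel K V)"

definition free_gen ::
  "('k, 'r) ring_scheme \<Rightarrow> ('k, 'v, 'm) module_scheme \<Rightarrow> 'v \<Rightarrow> ('v dterm \<Rightarrow> 'k) set"
  where "free_gen K V v =
    free_dendriform_kernel K V +>\<^bsub>free_two_ops K V\<^esub> basis_elem K (Gen v)"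

section \<open>Brace algebras\<close>

record ('k, 'a) brace_alg = "('k, 'a) module" +
  brace :: "'a \<Rightarrow> 'a list \<Rightarrow> 'a"

text \<open>
  For \<open>xs = [x\<^sub>1, \<dots>, x\<^sub>n]\<close> and \<open>Ys = [Y\<^sub>0, \<dots>, Y\<^sub>2\<^sub>n]\<close> the argument list
  \<open>Y\<^sub>0, {x\<^sub>1 | Y\<^sub>1}, Y\<^sub>2, \<dots>, {x\<^sub>n | Y\<^sub>2\<^sub>n\<^sub>-\<^sub>1}, Y\<^sub>2\<^sub>n\<close>.
\<close>

fun brace_args :: "('a \<Rightarrow> 'a list \<Rightarrow> 'a) \<Rightarrow> 'a list \<Rightarrow> 'a list list \<Rightarrow> 'a list"
  where
    "brace_args br [] [Y] = Y"
  | "brace_args br (x # xs) (Y # Y' # Ys) = Y @ br x Y' # brace_args br xs Ys"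

text \<open>
  The value of \<open>brace\<close> on an empty list is not an operation of a brace algebra; it is fixed by the
  convention \<open>{x | } = x\<close>.
  Partitions of \<open>ys\<close> into \<open>2n + 1\<close> successive, possibly empty, intervals are the lists \<open>Ys\<close> of
  length \<open>2n + 1\<close> with \<open>concat Ys = ys\<close>.
\<close>

locale brace_algebra = field K + module K B
  for K :: "('k, 'r) ring_scheme" and B :: "('k, 'a, 'm) brace_alg_scheme" +
  assumes brace_Nil: "x \<in> carrier B \<Longrightarrow> brace B x [] = x"
    and brace_linear_left: "\<lbrakk>ys \<noteq> []; set ys \<subseteq> carrier B\<rbrakk> \<Longrightarrow>
      linear_map K B B (\<lambda>x. brace B x ys)"
    and brace_linear_arg: "\<lbrakk>x \<in> carrier B; set us \<subseteq> carrier B; set vs \<subseteq> carrier B\<rbrakk> \<Longrightarrow>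
      linear_map K B B (\<lambda>y. brace B x (us @ y # vs))"
    and brace_brace: "\<lbrakk>z \<in> carrier B; xs \<noteq> []; ys \<noteq> []; set xs \<subseteq> carrier B; set ys \<subseteq> carrier B\<rbrakk> \<Longrightarrow>
      brace B (brace B z xs) ys =
        (\<Oplus>\<^bsub>B\<^esub>Ys\<in>{Ys. length Ys = 2 * length xs + 1 \<and> concat Ys = ys}.
          brace B z (brace_args (brace B) xs Ys))"

fun nearrow :: "('k, 'a, 'm) dendriform_scheme \<Rightarrow> 'a list \<Rightarrow> 'a"
  where
    "nearrow D [x] = x"
  | "nearrow D (x # y # ys) = x \<prec>\<^bsub>D\<^esub> nearrow D (y # ys)"

fun searrow :: "('k, 'a, 'm) dendriform_scheme \<Rightarrow> 'a list \<Rightarrow> 'a"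
  where "searrow D (x # xs) = foldl (dsucc D) x xs"

text \<open>\<open>\<nearrow>(us) \<succ> x \<prec> \<searrow>(vs)\<close>, where an empty \<open>us\<close> or \<open>vs\<close> means that the factor is absent.\<close>

definition arrow_term :: "('k, 'a, 'm) dendriform_scheme \<Rightarrow> 'a list \<Rightarrow> 'a \<Rightarrow> 'a list \<Rightarrow> 'a"
  where "arrow_term D us x vs =
    (let l = (if us = [] then x else nearrow D us \<succ>\<^bsub>D\<^esub> x)
     in if vs = [] then l else l \<prec>\<^bsub>D\<^esub> searrow D vs)"

text \<open>The brace operation of \<open>D\<^sub>B\<^sub>r\<^sub>a\<^sub>c\<^sub>e\<close>; the index \<open>i\<close> is the number of arguments left of \<open>x\<close>.\<close>

definition dendriform_brace ::
  "('k, 'r) ring_scheme \<Rightarrow> ('k, 'a, 'm) dendriform_scheme \<Rightarrow> 'a \<Rightarrow> 'a list \<Rightarrow> 'a"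
  where "dendriform_brace K D x ys =
    (\<Oplus>\<^bsub>D\<^esub>i\<in>{..length ys}. ((\<ominus>\<^bsub>K\<^esub> \<one>\<^bsub>K\<^esub>) [^]\<^bsub>K\<^esub> i) \<odot>\<^bsub>D\<^esub> arrow_term D (take i ys) x (drop i ys))"

section \<open>Unital dendriform algebras and dendriform bialgebras\<close>

text \<open>
  In a unital dendriform algebra \<open>W = K1 \<oplus> V\<close>, \<open>one W\<close> is the element \<open>1\<close>, \<open>mult W\<close> is the
  product \<open>*\<close>, and \<open>vpart W\<close> is \<open>V\<close>. The maps \<open>\<prec>\<close>, \<open>\<succ>\<close> are defined on
  \<open>V \<otimes> W + W \<otimes> V\<close>, a complement of \<open>K(1 \<otimes> 1)\<close> in \<open>W \<otimes> W\<close>; here they are extended to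
  all of \<open>W \<otimes> W\<close> by the value 0 at \<open>1 \<otimes> 1\<close>, which is exactly the rule that
  the terms \<open>1 \<prec> 1\<close> and \<open>1 \<succ> 1\<close> are to be omitted from Sweedler sums.
\<close>

record ('k, 'a) unital_dendriform = "('k, 'a) dendriform" +
  vpart :: "'a set"

locale unital_dendriform_algebra = field K + module K W
  for K :: "('k, 'r) ring_scheme" and W :: "('k, 'a, 'm) unital_dendriform_scheme" +
  assumes vpart_submodule: "submodule (vpart W) K W"
    and unit_closed: "\<one>\<^bsub>W\<^esub> \<in> carrier W"
    and direct_sum: "w \<in> carrier W \<Longrightarrow>
      \<exists>!p. p \<in> carrier K \<times> vpart W \<and> w = fst p \<odot>\<^bsub>W\<^esub> \<one>\<^bsub>W\<^esub> \<oplus>\<^bsub>W\<^esub> snd p"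
    and vpart_dendriform: "dendriform_algebra K (W\<lparr>carrier := vpart W\<rparr>)"
    and unital_prec_bilinear: "bilinear_map K W W (W\<lparr>carrier := vpart W\<rparr>) (dprec W)"
    and unital_succ_bilinear: "bilinear_map K W W (W\<lparr>carrier := vpart W\<rparr>) (dsucc W)"
    and unit_prec: "x \<in> vpart W \<Longrightarrow> \<one>\<^bsub>W\<^esub> \<prec>\<^bsub>W\<^esub> x = \<zero>\<^bsub>W\<^esub>"
    and succ_unit: "x \<in> vpart W \<Longrightarrow> x \<succ>\<^bsub>W\<^esub> \<one>\<^bsub>W\<^esub> = \<zero>\<^bsub>W\<^esub>"
    and prec_unit: "x \<in> vpart W \<Longrightarrow> x \<prec>\<^bsub>W\<^esub> \<one>\<^bsub>W\<^esub> = x"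
    and unit_succ: "x \<in> vpart W \<Longrightarrow> \<one>\<^bsub>W\<^esub> \<succ>\<^bsub>W\<^esub> x = x"
    and unit_prec_unit: "\<one>\<^bsub>W\<^esub> \<prec>\<^bsub>W\<^esub> \<one>\<^bsub>W\<^esub> = \<zero>\<^bsub>W\<^esub>"
    and unit_succ_unit: "\<one>\<^bsub>W\<^esub> \<succ>\<^bsub>W\<^esub> \<one>\<^bsub>W\<^esub> = \<zero>\<^bsub>W\<^esub>"
    and star_bilinear: "bilinear_map K W W W (mult W)"
    and star_unit: "\<one>\<^bsub>W\<^esub> \<otimes>\<^bsub>W\<^esub> \<one>\<^bsub>W\<^esub> = \<one>\<^bsub>W\<^esub>"
    and star_eq: "\<lbrakk>x \<in> carrier W; y \<in> carrier W; x \<in> vpart W \<or> y \<in> vpart W\<rbrakk> \<Longrightarrow>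
      x \<otimes>\<^bsub>W\<^esub> y = x \<prec>\<^bsub>W\<^esub> y \<oplus>\<^bsub>W\<^esub> x \<succ>\<^bsub>W\<^esub> y"

text \<open>The projection onto \<open>K1\<close> along \<open>V\<close>, as a linear form.\<close>

definition counit_proj :: "('k, 'r) ring_scheme \<Rightarrow> ('k, 'a, 'm) unital_dendriform_scheme \<Rightarrow> 'a \<Rightarrow> 'k"
  where "counit_proj K W w =
    (THE a. a \<in> carrier K \<and> (\<exists>v\<in>vpart W. w = a \<odot>\<^bsub>W\<^esub> \<one>\<^bsub>W\<^esub> \<oplus>\<^bsub>W\<^esub> v))"

locale dendriform_bialgebra = unital_dendriform_algebra K W
  for K :: "('k, 'r) ring_scheme" and W :: "('k, 'a, 'm) unital_dendriform_scheme"
    and \<Delta> :: "'a \<Rightarrow> ('a \<times> 'a \<Rightarrow> 'k) set" +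
  assumes coproduct_linear: "linear_map K W (tensor K W W) \<Delta>"
    and coassociative: "w \<in> carrier W \<Longrightarrow>
      tensor_assoc K W (tensor_map K (tensor K W W) W \<Delta> (\<lambda>x. x) (\<Delta> w)) =
      tensor_map K W (tensor K W W) (\<lambda>x. x) \<Delta> (\<Delta> w)"
    and coproduct_unit: "\<Delta> \<one>\<^bsub>W\<^esub> = pure_tensor K W W \<one>\<^bsub>W\<^esub> \<one>\<^bsub>W\<^esub>"
    and counit_left: "w \<in> carrier W \<Longrightarrow>
      tensor_lift K W (\<lambda>x y. counit_proj K W x \<odot>\<^bsub>W\<^esub> y) (\<Delta> w) = w"
    and counit_right: "w \<in> carrier W \<Longrightarrow>
      tensor_lift K W (\<lambda>x y. counit_proj K W y \<odot>\<^bsub>W\<^esub> x) (\<Delta> w) = w"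
    and coproduct_succ: "\<lbrakk>x \<in> vpart W; y \<in> vpart W\<rbrakk> \<Longrightarrow>
      \<Delta> (x \<succ>\<^bsub>W\<^esub> y) = tensor_op K W (mult W) (dsucc W) (\<Delta> x) (\<Delta> y)
        \<oplus>\<^bsub>tensor K W W\<^esub> pure_tensor K W W (x \<succ>\<^bsub>W\<^esub> y) \<one>\<^bsub>W\<^esub>"
    and coproduct_prec: "\<lbrakk>x \<in> vpart W; y \<in> vpart W\<rbrakk> \<Longrightarrow>
      \<Delta> (x \<prec>\<^bsub>W\<^esub> y) = tensor_op K W (mult W) (dprec W) (\<Delta> x) (\<Delta> y)
        \<oplus>\<^bsub>tensor K W W\<^esub> pure_tensor K W W (x \<prec>\<^bsub>W\<^esub> y) \<one>\<^bsub>W\<^esub>"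

text \<open>\<open>K1 \<oplus> D\<close>: the pair \<open>(a, x)\<close> stands for \<open>a1 + x\<close>.\<close>

definition unitization ::
  "('k, 'r) ring_scheme \<Rightarrow> ('k, 'a, 'm) dendriform_scheme \<Rightarrow> ('k, 'k \<times> 'a) unital_dendriform"
  where "unitization K D =
    \<lparr>carrier = carrier K \<times> carrier D,
     mult = (\<lambda>(a, x) (b, y).
       (a \<otimes>\<^bsub>K\<^esub> b, (a \<odot>\<^bsub>D\<^esub> y \<oplus>\<^bsub>D\<^esub> b \<odot>\<^bsub>D\<^esub> x) \<oplus>\<^bsub>D\<^esub> (x \<prec>\<^bsub>D\<^esub> y \<oplus>\<^bsub>D\<^esub> x \<succ>\<^bsub>D\<^esub> y))),
     one = (\<one>\<^bsub>K\<^esub>, \<zero>\<^bsub>D\<^esub>),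
     zero = (\<zero>\<^bsub>K\<^esub>, \<zero>\<^bsub>D\<^esub>),
     add = (\<lambda>(a, x) (b, y). (a \<oplus>\<^bsub>K\<^esub> b, x \<oplus>\<^bsub>D\<^esub> y)),
     smult = (\<lambda>c (a, x). (c \<otimes>\<^bsub>K\<^esub> a, c \<odot>\<^bsub>D\<^esub> x)),
     dprec = (\<lambda>(a, x) (b, y). (\<zero>\<^bsub>K\<^esub>, b \<odot>\<^bsub>D\<^esub> x \<oplus>\<^bsub>D\<^esub> x \<prec>\<^bsub>D\<^esub> y)),
     dsucc = (\<lambda>(a, x) (b, y). (\<zero>\<^bsub>K\<^esub>, a \<odot>\<^bsub>D\<^esub> y \<oplus>\<^bsub>D\<^esub> x \<succ>\<^bsub>D\<^esub> y)),
     vpart = {\<zero>\<^bsub>K\<^esub>} \<times> carrier D\<rparr>"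

section \<open>The coproduct on the unital free dendriform algebra\<close>

text \<open>\<open>x \<or>\<^sub>v y = x \<succ> v \<prec> y\<close>\<close>

definition vee ::
  "('k, 'r) ring_scheme \<Rightarrow> ('k, 'v, 'm) module_scheme \<Rightarrow> 'v \<Rightarrow>
    'k \<times> ('v dterm \<Rightarrow> 'k) set \<Rightarrow> 'k \<times> ('v dterm \<Rightarrow> 'k) set \<Rightarrow> 'k \<times> ('v dterm \<Rightarrow> 'k) set"
  where "vee K V v x y =
    (let W = unitization K (free_dendriform K V)
     in (x \<succ>\<^bsub>W\<^esub> (\<zero>\<^bsub>K\<^esub>, free_gen K V v)) \<prec>\<^bsub>W\<^esub> y)"

text \<open>
  The last two equations determine a linear map on the carrier; its values elsewhere are fixed
  to be \<open>undefined\<close> so that the description below is unique.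
\<close>

definition free_coproduct ::
  "('k, 'r) ring_scheme \<Rightarrow> ('k, 'v, 'm) module_scheme \<Rightarrow>
    'k \<times> ('v dterm \<Rightarrow> 'k) set \<Rightarrow>
    (('k \<times> ('v dterm \<Rightarrow> 'k) set) \<times> ('k \<times> ('v dterm \<Rightarrow> 'k) set) \<Rightarrow> 'k) set"
  where "free_coproduct K V =
    (let W = unitization K (free_dendriform K V) in
     THE \<Delta>. \<Delta> \<in> extensional (carrier W) \<and> linear_map K W (tensor K W W) \<Delta> \<and>
       \<Delta> \<one>\<^bsub>W\<^esub> = pure_tensor K W W \<one>\<^bsub>W\<^esub> \<one>\<^bsub>W\<^esub> \<and>
       (\<forall>v\<in>carrier V. \<forall>x\<in>carrier W. \<forall>y\<in>carrier W.
          \<Delta> (vee K V v x y) = pure_tensor K W W (vee K V v x y) \<one>\<^bsub>W\<^esub>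
            \<oplus>\<^bsub>tensor K W W\<^esub> tensor_op K W (mult W) (vee K V v) (\<Delta> x) (\<Delta> y)))"

section \<open>The enveloping algebra of a brace algebra\<close>

definition enveloping_ideal ::
  "('k, 'r) ring_scheme \<Rightarrow> ('k, 'a, 'm) brace_alg_scheme \<Rightarrow> ('a dterm \<Rightarrow> 'k) set set"
  where "enveloping_ideal K B = (let D = free_dendriform K B in
    dendriform_ideal_generated K D
      {dendriform_brace K D (free_gen K B x) (map (free_gen K B) ys)
          \<ominus>\<^bsub>D\<^esub> free_gen K B (brace B x ys) | x ys.
        x \<in> carrier B \<and> set ys \<subseteq> carrier B \<and> ys \<noteq> []})"

definition enveloping ::
  "('k, 'r) ring_scheme \<Rightarrow> ('k, 'a, 'm) brace_alg_scheme \<Rightarrow>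
    ('k, ('a dterm \<Rightarrow> 'k) set set) dendriform"
  where "enveloping K B = dendriform_quot (free_dendriform K B) (enveloping_ideal K B)"

definition unital_enveloping ::
  "('k, 'r) ring_scheme \<Rightarrow> ('k, 'a, 'm) brace_alg_scheme \<Rightarrow>
    ('k, 'k \<times> ('a dterm \<Rightarrow> 'k) set set) unital_dendriform"
  where "unital_enveloping K B = unitization K (enveloping K B)"

definition enveloping_proj ::
  "('k, 'r) ring_scheme \<Rightarrow> ('k, 'a, 'm) brace_alg_scheme \<Rightarrow>
    'k \<times> ('a dterm \<Rightarrow> 'k) set \<Rightarrow> 'k \<times> ('a dterm \<Rightarrow> 'k) set set"
  where "enveloping_proj K B =
    (\<lambda>(a, x). (a, enveloping_ideal K B +>\<^bsub>free_dendriform K B\<^esub> x))"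

end

theory Submission
  imports Defs
begin

text \<open>
  On \<open>W = K1 \<oplus> V\<close>, with \<open>\<epsilon>\<close> the projection to \<open>K1\<close>, put \<open>1 \<prec> 1 = 1 \<succ> 1 = 0\<close> and \<open>1 * 1 = 1\<close>. Then the
  dendriform axioms, written with \<open>*\<close>, hold on all of \<open>W\<close>. Such an augmented structure passes
  to \<open>W \<otimes> W\<close>, with the products
  \<open>(a \<otimes> b) \<prec> (c \<otimes> d) = (a * c) \<otimes> (b \<prec> d) + \<epsilon>(b) \<epsilon>(d) (a \<prec> c) \<otimes> 1\<close>, likewise for \<open>\<succ>\<close>. The axioms of a
  dendriform bialgebra say that the coproduct is a homomorphism of augmented structures with the
  counit and coassociativity laws, and by the universal property of the free dendriform algebra
  these laws need only be checked on generators, which are primitive. The brace of the elements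
  \<open>v \<otimes> 1 + 1 \<otimes> v\<close> is again of this form, by an antipode identity;
  hence the coproduct respects the relations of the enveloping algebra.
\<close>

section \<open>Linear maps, quotients and free modules\<close>

text \<open>Where the correction term in the products on W \<otimes> W comes from: a bialgebra
  demands the extra summand (x \<prec> y) \<otimes> 1 in \<Delta>(x \<prec> y). On \<Delta> x and
  \<Delta> y the correction becomes this summand by the right counit law, so the compatibility
  axioms turn into plain multiplicativity. Why the brace is primitive: expand the coproduct of the
  i-th brace term, in which the first i arguments stand left of x. One summand has everything on the
  left. In every other summand x goes to the right with the outer arguments, and an interval
  y_(j+1), ..., y_m around position i goes to the left as the product of the two combs into which i
  cuts it. For fixed j and m only this left factor depends on i, and its alternating sum is the
  antipode identity for the interval; only empty intervals survive. A separate obstacle is that the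
  coproduct on the free algebra is given by a definite description among merely linear maps, through
  a recursion on x \<succ> v \<prec> y. Identifying it with the homomorphism from the universal
  property requires that 1 and such graftings generate the whole space linearly.\<close>

lemma linear_mapI:
  assumes "\<And>x. x \<in> carrier M \<Longrightarrow> f x \<in> carrier N"
    and "\<And>x y. \<lbrakk>x \<in> carrier M; y \<in> carrier M\<rbrakk> \<Longrightarrow> f (x \<oplus>\<^bsub>M\<^esub> y) = f x \<oplus>\<^bsub>N\<^esub> f y"
    and "\<And>a x. \<lbrakk>a \<in> carrier K; x \<in> carrier M\<rbrakk> \<Longrightarrow> f (a \<odot>\<^bsub>M\<^esub> x) = a \<odot>\<^bsub>N\<^esub> f x"
  shows "linear_map K M N f"
  using assms by (simp add: linear_map_def)

lemma linear_mapD: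
  assumes "linear_map K M N f"
  shows "x \<in> carrier M \<Longrightarrow> f x \<in> carrier N"
    and "\<lbrakk>x \<in> carrier M; y \<in> carrier M\<rbrakk> \<Longrightarrow> f (x \<oplus>\<^bsub>M\<^esub> y) = f x \<oplus>\<^bsub>N\<^esub> f y"
    and "\<lbrakk>a \<in> carrier K; x \<in> carrier M\<rbrakk> \<Longrightarrow> f (a \<odot>\<^bsub>M\<^esub> x) = a \<odot>\<^bsub>N\<^esub> f x"
  using assms by (auto simp: linear_map_def)

lemma linear_map_zero:
  assumes "module K M" "module K N" "linear_map K M N f"
  shows "f \<zero>\<^bsub>M\<^esub> = \<zero>\<^bsub>N\<^esub>"
proof -
  interpret M: module K M by fact
  interpret N: module K N by fact
  have "f (\<zero>\<^bsub>K\<^esub> \<odot>\<^bsub>M\<^esub> \<zero>\<^bsub>M\<^esub>) = \<zero>\<^bsub>K\<^esub> \<odot>\<^bsub>N\<^esub> f \<zero>\<^bsub>M\<^esub>"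
    using assms(3) by (simp add: linear_mapD del: M.smult_l_null M.smult_r_null)
  then show ?thesis
    using linear_mapD(1)[OF assms(3)] by simp
qed

lemma linear_map_uminus:
  assumes "module K M" "module K N" "linear_map K M N f" "x \<in> carrier M"
  shows "f (\<ominus>\<^bsub>M\<^esub> x) = \<ominus>\<^bsub>N\<^esub> f x"
proof -
  interpret M: module K M by fact
  interpret N: module K N by fact
  have "f (\<ominus>\<^bsub>M\<^esub> x) \<oplus>\<^bsub>N\<^esub> f x = \<zero>\<^bsub>N\<^esub>"
    using assms linear_mapD(2)[OF assms(3), of "\<ominus>\<^bsub>M\<^esub> x" x]
    by (simp add: M.l_neg linear_map_zero[of K M N f])
  then show ?thesis
    using linear_mapD(1)[OF assms(3)] assms(4) by (simp add: N.minus_equality)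
qed

lemma linear_map_minus:
  assumes "module K M" "module K N" "linear_map K M N f" "x \<in> carrier M" "y \<in> carrier M"
  shows "f (x \<ominus>\<^bsub>M\<^esub> y) = f x \<ominus>\<^bsub>N\<^esub> f y"
proof -
  interpret M: module K M by fact
  interpret N: module K N by fact
  show ?thesis
    using assms by (simp add: a_minus_def linear_mapD linear_map_uminus[of K M N f])
qed

lemma linear_map_finsum:
  assumes "module K M" "module K N" "linear_map K M N f" "g \<in> A \<rightarrow> carrier M"
  shows "f (\<Oplus>\<^bsub>M\<^esub>i\<in>A. g i) = (\<Oplus>\<^bsub>N\<^esub>i\<in>A. f (g i))"
proof -
  interpret M: module K M by fact
  interpret N: module K N by fact
  note f = linear_mapD[OF assms(3)] linear_map_zero[OF assms(1-3)]
  show ?thesis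
    using assms(4)
  proof (induction A rule: infinite_finite_induct)
    case (insert x A)
    then have "g \<in> A \<rightarrow> carrier M" "g x \<in> carrier M" by auto
    with insert show ?case by (simp add: f Pi_def)
  qed (simp_all add: f)
qed

lemma linear_map_comp:
  assumes "linear_map K M N f" "linear_map K N P g"
  shows "linear_map K M P (\<lambda>x. g (f x))"
  using assms by (auto intro!: linear_mapI simp: linear_mapD)

lemma linear_map_id: "linear_map K M M (\<lambda>x. x)"
  by (rule linear_mapI) simp_all

lemma linear_map_plus:
  assumes "module K N" "linear_map K M N f" "linear_map K M N g"
  shows "linear_map K M N (\<lambda>x. f x \<oplus>\<^bsub>N\<^esub> g x)"
proof -
  interpret N: module K N by fact
  note f = linear_mapD[OF assms(2)] and g = linear_mapD[OF assms(3)]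
  show ?thesis
    by (rule linear_mapI) (simp_all add: f g N.smult_r_distr N.a_ac)
qed

lemma submodule_kernel:
  assumes "module K M" "module K N" "linear_map K M N f"
  shows "submodule {x \<in> carrier M. f x = \<zero>\<^bsub>N\<^esub>} K M"
proof -
  interpret M: module K M by fact
  interpret N: module K N by fact
  note f = linear_mapD[OF assms(3)] linear_map_zero[OF assms] linear_map_uminus[OF assms]
  show ?thesis
    by (rule M.submoduleI) (auto simp: f)
qed

lemma bilinear_mapI:
  assumes "\<And>x y. \<lbrakk>x \<in> carrier M; y \<in> carrier N\<rbrakk> \<Longrightarrow> f x y \<in> carrier P"
    and "\<And>x x' y. \<lbrakk>x \<in> carrier M; x' \<in> carrier M; y \<in> carrier N\<rbrakk> \<Longrightarrow>
      f (x \<oplus>\<^bsub>M\<^esub> x') y = f x y \<oplus>\<^bsub>P\<^esub> f x' y"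
    and "\<And>x y y'. \<lbrakk>x \<in> carrier M; y \<in> carrier N; y' \<in> carrier N\<rbrakk> \<Longrightarrow>
      f x (y \<oplus>\<^bsub>N\<^esub> y') = f x y \<oplus>\<^bsub>P\<^esub> f x y'"
    and "\<And>a x y. \<lbrakk>a \<in> carrier K; x \<in> carrier M; y \<in> carrier N\<rbrakk> \<Longrightarrow>
      f (a \<odot>\<^bsub>M\<^esub> x) y = a \<odot>\<^bsub>P\<^esub> f x y"
    and "\<And>a x y. \<lbrakk>a \<in> carrier K; x \<in> carrier M; y \<in> carrier N\<rbrakk> \<Longrightarrow>
      f x (a \<odot>\<^bsub>N\<^esub> y) = a \<odot>\<^bsub>P\<^esub> f x y"
  shows "bilinear_map K M N P f"
  unfolding bilinear_map_def using assms by (auto intro!: linear_mapI)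

lemma bilinear_mapD:
  assumes "bilinear_map K M N P f"
  shows "\<lbrakk>x \<in> carrier M; y \<in> carrier N\<rbrakk> \<Longrightarrow> f x y \<in> carrier P"
    and "\<lbrakk>x \<in> carrier M; x' \<in> carrier M; y \<in> carrier N\<rbrakk> \<Longrightarrow>
      f (x \<oplus>\<^bsub>M\<^esub> x') y = f x y \<oplus>\<^bsub>P\<^esub> f x' y"
    and "\<lbrakk>x \<in> carrier M; y \<in> carrier N; y' \<in> carrier N\<rbrakk> \<Longrightarrow>
      f x (y \<oplus>\<^bsub>N\<^esub> y') = f x y \<oplus>\<^bsub>P\<^esub> f x y'"
    and "\<lbrakk>a \<in> carrier K; x \<in> carrier M; y \<in> carrier N\<rbrakk> \<Longrightarrow> f (a \<odot>\<^bsub>M\<^esub> x) y = a \<odot>\<^bsub>P\<^esub> f x y"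
    and "\<lbrakk>a \<in> carrier K; x \<in> carrier M; y \<in> carrier N\<rbrakk> \<Longrightarrow> f x (a \<odot>\<^bsub>N\<^esub> y) = a \<odot>\<^bsub>P\<^esub> f x y"
  using assms unfolding bilinear_map_def by (auto simp: linear_map_def)

lemma bilinear_map_linear:
  assumes "bilinear_map K M N P f"
  shows "x \<in> carrier M \<Longrightarrow> linear_map K N P (f x)"
    and "y \<in> carrier N \<Longrightarrow> linear_map K M P (\<lambda>x. f x y)"
  using assms by (auto simp: bilinear_map_def)

lemma bilinear_map_zero:
  assumes "module K M" "module K N" "module K P" "bilinear_map K M N P f"
  shows "x \<in> carrier M \<Longrightarrow> f x \<zero>\<^bsub>N\<^esub> = \<zero>\<^bsub>P\<^esub>" and "y \<in> carrier N \<Longrightarrow> f \<zero>\<^bsub>M\<^esub> y = \<zero>\<^bsub>P\<^esub>"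
  using linear_map_zero[OF _ _ bilinear_map_linear(1)[OF assms(4)]]
    linear_map_zero[OF _ _ bilinear_map_linear(2)[OF assms(4)]] assms(1-3) by auto

text \<open>Both \<^const>\<open>module_quot\<close> and \<^const>\<open>dendriform_quot\<close> are instances.\<close>

locale quotient_module = module K M
  for K :: "('k, 'r) ring_scheme" and M :: "('k, 'a, 'm) module_scheme" and N :: "'a set"
    and Q :: "('k, 'a set, 'q) module_scheme" +
  assumes sub: "submodule N K M"
    and carrier_Q: "carrier Q = a_rcosets\<^bsub>M\<^esub> N"
    and zero_Q: "zero Q = N"
    and add_Q: "add Q = set_add M"
    and smult_Q: "smult Q = (\<lambda>a X. \<Union>x\<in>X. N +>\<^bsub>M\<^esub> (a \<odot>\<^bsub>M\<^esub> x))"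
begin

lemmas sub_closed = submoduleE[OF sub]

lemma subgroup_N: "subgroup N (add_monoid M)"
  using sub by (simp add: submodule_def)

lemma zero_in_N: "\<zero>\<^bsub>M\<^esub> \<in> N"
  using subgroup.one_closed[OF subgroup_N] by simp

lemma abelian_subgroup_N: "abelian_subgroup N M"
  using subgroup_N by (intro abelian_subgroupI3 additive_subgroup.intro M.abelian_group_axioms)

lemma coset_mem:
  assumes "x \<in> carrier M"
  shows "y \<in> N +>\<^bsub>M\<^esub> x \<longleftrightarrow> y \<in> carrier M \<and> y \<ominus>\<^bsub>M\<^esub> x \<in> N"
proof
  assume "y \<in> N +>\<^bsub>M\<^esub> x"
  then obtain n where n: "n \<in> N" "y = n \<oplus>\<^bsub>M\<^esub> x"
    by (auto simp: a_r_coset_def')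
  then have "n \<in> carrier M" using sub_closed(1) by auto
  then show "y \<in> carrier M \<and> y \<ominus>\<^bsub>M\<^esub> x \<in> N"
    using n assms by (simp add: a_minus_def M.a_assoc M.r_neg)
next
  assume y: "y \<in> carrier M \<and> y \<ominus>\<^bsub>M\<^esub> x \<in> N"
  then have "y = (y \<ominus>\<^bsub>M\<^esub> x) \<oplus>\<^bsub>M\<^esub> x"
    using assms by (simp add: a_minus_def M.a_assoc M.l_neg)
  with y show "y \<in> N +>\<^bsub>M\<^esub> x"
    unfolding a_r_coset_def' by blast
qed

lemma coset_self: "x \<in> carrier M \<Longrightarrow> x \<in> N +>\<^bsub>M\<^esub> x"
  by (simp add: coset_mem a_minus_def M.r_neg zero_in_N)

lemma coset_eq_iff:
  assumes "x \<in> carrier M" "y \<in> carrier M"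
  shows "N +>\<^bsub>M\<^esub> x = N +>\<^bsub>M\<^esub> y \<longleftrightarrow> x \<ominus>\<^bsub>M\<^esub> y \<in> N"
  using assms coset_mem[of y x] coset_self[of x] M.a_repr_independence[OF _ _ subgroup_N, of x y]
  by auto

lemma coset_eq_N: "x \<in> carrier M \<Longrightarrow> N +>\<^bsub>M\<^esub> x = N \<longleftrightarrow> x \<in> N"
  by (metis M.a_coset_join2 coset_self subgroup_N)

lemma coset_closed: "x \<in> carrier M \<Longrightarrow> N +>\<^bsub>M\<^esub> x \<in> carrier Q"
  by (simp add: carrier_Q M.a_rcosetsI sub_closed(1))

lemma coset_rep: "X \<in> carrier Q \<Longrightarrow> \<exists>x\<in>carrier M. X = N +>\<^bsub>M\<^esub> x"
  by (auto simp: carrier_Q A_RCOSETS_def')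

lemma coset_add:
  "\<lbrakk>x \<in> carrier M; y \<in> carrier M\<rbrakk> \<Longrightarrow>
    (N +>\<^bsub>M\<^esub> x) \<oplus>\<^bsub>Q\<^esub> (N +>\<^bsub>M\<^esub> y) = N +>\<^bsub>M\<^esub> (x \<oplus>\<^bsub>M\<^esub> y)"
  by (simp add: add_Q abelian_subgroup.a_rcos_sum[OF abelian_subgroup_N])

text \<open>Scalar multiplication on a quotient is a union over all representatives; independence of
  the representative collapses the union to a single coset.\<close>

lemma coset_UN:
  assumes "x \<in> carrier M" and "\<And>y. y \<in> N +>\<^bsub>M\<^esub> x \<Longrightarrow> f y = f x"
  shows "(\<Union>y\<in>N +>\<^bsub>M\<^esub> x. f y) = f x"
  using assms coset_self[of x] by blast

lemma coset_smult:
  assumes "a \<in> carrier K" "x \<in> carrier M"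
  shows "a \<odot>\<^bsub>Q\<^esub> (N +>\<^bsub>M\<^esub> x) = N +>\<^bsub>M\<^esub> (a \<odot>\<^bsub>M\<^esub> x)"
  unfolding smult_Q
proof (rule coset_UN)
  fix y assume "y \<in> N +>\<^bsub>M\<^esub> x"
  then have y: "y \<in> carrier M" "y \<ominus>\<^bsub>M\<^esub> x \<in> N" using coset_mem assms by auto
  then have "a \<odot>\<^bsub>M\<^esub> (y \<ominus>\<^bsub>M\<^esub> x) \<in> N" using sub_closed(4) assms by blast
  then have "a \<odot>\<^bsub>M\<^esub> y \<ominus>\<^bsub>M\<^esub> a \<odot>\<^bsub>M\<^esub> x \<in> N"
    using assms y by (simp add: a_minus_def smult_r_distr smult_r_minus)
  then show "N +>\<^bsub>M\<^esub> (a \<odot>\<^bsub>M\<^esub> y) = N +>\<^bsub>M\<^esub> (a \<odot>\<^bsub>M\<^esub> x)"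
    using coset_eq_iff assms y by simp
qed (use assms in simp)

lemma zero_coset: "\<zero>\<^bsub>Q\<^esub> = N +>\<^bsub>M\<^esub> \<zero>\<^bsub>M\<^esub>"
  using coset_eq_N[of "\<zero>\<^bsub>M\<^esub>"] by (simp add: zero_Q zero_in_N)

lemma module_Q: "module K Q"
proof (rule moduleI)
  show "cring K" by (rule R.is_cring)
  show "abelian_group Q"
  proof (rule abelian_groupI)
    fix X assume "X \<in> carrier Q"
    then obtain x where x: "x \<in> carrier M" "X = N +>\<^bsub>M\<^esub> x" using coset_rep by blast
    then have "(N +>\<^bsub>M\<^esub> (\<ominus>\<^bsub>M\<^esub> x)) \<oplus>\<^bsub>Q\<^esub> X = \<zero>\<^bsub>Q\<^esub>"
      by (simp add: coset_add zero_coset M.l_neg)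
    then show "\<exists>Y\<in>carrier Q. Y \<oplus>\<^bsub>Q\<^esub> X = \<zero>\<^bsub>Q\<^esub>"
      using coset_closed x by blast
  qed (auto dest!: coset_rep simp: coset_add coset_closed zero_coset M.a_ac)
qed (auto dest!: coset_rep simp: coset_add coset_closed coset_smult
      smult_l_distr smult_r_distr smult_assoc1)

lemma linear_coset: "linear_map K M Q (\<lambda>x. N +>\<^bsub>M\<^esub> x)"
  by (rule linear_mapI) (simp_all add: coset_closed coset_add coset_smult)

text \<open>A linear map vanishing on N is constant on each coset, so its image is a singleton. The
  form with \<open>the_elem\<close> matches the definition of \<open>tensor_lift\<close>.\<close>

lemma lift_coset:
  assumes "module K P" "linear_map K M P f" "\<And>x. x \<in> N \<Longrightarrow> f x = \<zero>\<^bsub>P\<^esub>" "x \<in> carrier M"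
  shows "the_elem (f ` (N +>\<^bsub>M\<^esub> x)) = f x"
proof -
  interpret P: module K P by fact
  have "f y = f x" if "y \<in> N +>\<^bsub>M\<^esub> x" for y
  proof -
    have y: "y \<in> carrier M" "y \<ominus>\<^bsub>M\<^esub> x \<in> N" using coset_mem assms(4) that by auto
    then have "f y \<ominus>\<^bsub>P\<^esub> f x = \<zero>\<^bsub>P\<^esub>"
      using assms linear_map_minus[OF module_axioms assms(1,2)] by fastforce
    then show ?thesis
      using y(1) assms(4) linear_mapD(1)[OF assms(2)]
      by (metis P.a_inv_closed P.minus_minus P.minus_unique P.r_neg a_minus_def)
  qed
  then have "f ` (N +>\<^bsub>M\<^esub> x) = {f x}" using coset_self assms(4) by blast
  then show ?thesis by simp
qed

lemma linear_lift:
  assumes "module K P" "linear_map K M P f" "\<And>x. x \<in> N \<Longrightarrow> f x = \<zero>\<^bsub>P\<^esub>"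
  shows "linear_map K Q P (\<lambda>X. the_elem (f ` X))"
proof -
  note l = lift_coset[OF assms]
  show ?thesis
    by (rule linear_mapI)
      (auto dest!: coset_rep simp: l coset_add coset_smult linear_mapD[OF assms(2)])
qed

end

lemma submodule_generated_submodule:
  assumes "module K M" "S \<subseteq> carrier M"
  shows "submodule (submodule_generated K M S) K M"
proof -
  interpret M: module K M by fact
  have c: "submodule (carrier M) K M" by (rule M.carrier_is_submodule)
  note E = M.submoduleE
  have z: "\<zero>\<^bsub>M\<^esub> \<in> N" if "submodule N K M" for N
    using that subgroup.one_closed[of N "add_monoid M"] by (simp add: submodule_def)
  show ?thesis
    unfolding submodule_generated_def
  proof (rule M.submoduleI)
    show "\<Inter>{N. submodule N K M \<and> S \<subseteq> N} \<subseteq> carrier M" using c assms(2) by blast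
  qed (blast intro: z E(3,4,5))+
qed

lemma submodule_generated_least:
  assumes "submodule N K M" "S \<subseteq> N"
  shows "submodule_generated K M S \<subseteq> N"
  using assms by (auto simp: submodule_generated_def)

lemma submodule_generated_base: "S \<subseteq> submodule_generated K M S"
  by (auto simp: submodule_generated_def)

subsection \<open>Free modules\<close>

lemma free_module_simps [simp]:
  "zero (free_module K X) = (\<lambda>x. \<zero>\<^bsub>K\<^esub>)"
  "add (free_module K X) = (\<lambda>f g x. f x \<oplus>\<^bsub>K\<^esub> g x)"
  "smult (free_module K X) = (\<lambda>a f x. a \<otimes>\<^bsub>K\<^esub> f x)"
  by (simp_all add: free_module_def)

lemma free_module_carrier:
  "f \<in> carrier (free_module K X) \<longleftrightarrow>
    (\<forall>x. f x \<in> carrier K) \<and> finite {x. f x \<noteq> \<zero>\<^bsub>K\<^esub>} \<and> (\<forall>x. x \<notin> X \<longrightarrow> f x = \<zero>\<^bsub>K\<^esub>)"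
  by (auto simp: free_module_def)

text \<open>The sum inside \<open>tensor_lift\<close>, for an arbitrary basis; this is the linear
  extension of \<open>b\<close> from basis elements.\<close>

definition free_lift ::
  "('k, 'r) ring_scheme \<Rightarrow> ('k, 'c, 'p) module_scheme \<Rightarrow> ('x \<Rightarrow> 'c) \<Rightarrow> ('x \<Rightarrow> 'k) \<Rightarrow> 'c"
  where "free_lift K P b f = (\<Oplus>\<^bsub>P\<^esub>p\<in>{p. f p \<noteq> \<zero>\<^bsub>K\<^esub>}. f p \<odot>\<^bsub>P\<^esub> b p)"

context cring
begin

lemma module_free: "module R (free_module R X)"
proof (rule moduleI)
  show "cring R" by (rule is_cring)
  have fin: "finite {x. h x \<noteq> \<zero>}"
    if "finite {x. f x \<noteq> \<zero>}" "finite {x. g x \<noteq> \<zero>}" "\<And>x. f x = \<zero> \<Longrightarrow> g x = \<zero> \<Longrightarrow> h x = \<zero>"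
    for f g h :: "'c \<Rightarrow> 'a"
    by (rule finite_subset[OF _ finite_UnI[OF that(1,2)]]) (use that(3) in auto)
  show "abelian_group (free_module R X)"
  proof (rule abelian_groupI)
    fix f g assume "f \<in> carrier (free_module R X)" "g \<in> carrier (free_module R X)"
    then show "f \<oplus>\<^bsub>free_module R X\<^esub> g \<in> carrier (free_module R X)"
      by (auto simp: free_module_carrier intro: fin[of f g])
  next
    fix f assume f: "f \<in> carrier (free_module R X)"
    show "\<exists>g\<in>carrier (free_module R X). g \<oplus>\<^bsub>free_module R X\<^esub> f = \<zero>\<^bsub>free_module R X\<^esub>"
      by (rule bexI[of _ "\<lambda>x. \<ominus> f x"])
        (use f in \<open>auto simp: free_module_carrier l_neg intro: fin[of f f]\<close>)
  qed (auto simp: free_module_carrier a_ac fun_eq_iff)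
  fix a f assume "a \<in> carrier R" "f \<in> carrier (free_module R X)"
  then show "a \<odot>\<^bsub>free_module R X\<^esub> f \<in> carrier (free_module R X)"
    by (auto simp: free_module_carrier intro: fin[of f f])
qed (auto simp: free_module_carrier fun_eq_iff l_distr r_distr m_assoc)

lemma basis_elem_closed: "x \<in> X \<Longrightarrow> basis_elem R x \<in> carrier (free_module R X)"
  by (auto simp: free_module_carrier basis_elem_def intro: finite_subset[of _ "{x}"])

lemma free_module_induct [consumes 1, case_names basis zero add smult]:
  assumes f: "f \<in> carrier (free_module R X)"
    and basis: "\<And>x. x \<in> X \<Longrightarrow> P (basis_elem R x)"
    and zero: "P (\<lambda>x. \<zero>)"
    and add: "\<And>f g. \<lbrakk>f \<in> carrier (free_module R X); g \<in> carrier (free_module R X); P f; P g\<rbrakk>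
      \<Longrightarrow> P (\<lambda>x. f x \<oplus> g x)"
    and smult: "\<And>a f. \<lbrakk>a \<in> carrier R; f \<in> carrier (free_module R X); P f\<rbrakk> \<Longrightarrow> P (\<lambda>x. a \<otimes> f x)"
  shows "P f"
proof -
  let ?F = "free_module R X"
  \<comment> \<open>The induction runs over a finite set containing the support, so an element of it
    may also lie outside the support or outside X.\<close>
  have "finite S \<Longrightarrow> f \<in> carrier (?F) \<Longrightarrow> {x. f x \<noteq> \<zero>} \<subseteq> S \<Longrightarrow> P f" for S f
  proof (induction S arbitrary: f rule: finite_induct)
    case empty
    then have "f = (\<lambda>x. \<zero>)" by auto
    then show ?case using zero by simp
  next
    case (insert y S)
    show ?case
    proof (cases "y \<in> X")
      case True
      define g where "g = (\<lambda>x. if x = y then \<zero> else f x)"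
      define h where "h = (\<lambda>x. f y \<otimes> basis_elem R y x)"
      have "finite {x. g x \<noteq> \<zero>}"
        by (rule finite_subset[of _ "{x. f x \<noteq> \<zero>}"])
          (use insert.prems(1) in \<open>auto simp: g_def free_module_carrier\<close>)
      then have g: "g \<in> carrier (?F)"
        using insert.prems(1) by (auto simp: free_module_carrier g_def)
      have fy: "f y \<in> carrier R" using insert.prems(1) by (simp add: free_module_carrier)
      have h: "h \<in> carrier (?F)"
        using module.smult_closed[OF module_free fy basis_elem_closed[OF True]] by (simp add: h_def)
      have "P h" unfolding h_def by (rule smult[OF fy basis_elem_closed[OF True] basis[OF True]])
      moreover have "{x. g x \<noteq> \<zero>} \<subseteq> S" using insert.prems(2) by (auto simp: g_def)
      then have "P g" by (rule insert.IH[OF g])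
      ultimately have "P (\<lambda>x. h x \<oplus> g x)" by (intro add g h)
      moreover have "(\<lambda>x. h x \<oplus> g x) = f"
        using insert.prems(1)
        by (auto simp: h_def g_def fun_eq_iff basis_elem_def free_module_carrier)
      ultimately show ?thesis by simp
    next
      case False
      then have "f y = \<zero>" using insert.prems(1) by (auto simp: free_module_carrier)
      then show ?thesis using insert by blast
    qed
  qed
  then show ?thesis using f by (auto simp: free_module_carrier)
qed

text \<open>Sums and scalar multiples can have different supports; enlarging the index set lets all
  of them be computed over one common set.\<close>

lemma free_lift_superset:
  assumes "module R P" "b \<in> X \<rightarrow> carrier P" "f \<in> carrier (free_module R X)"
    "finite S" "S \<subseteq> X" "{x. f x \<noteq> \<zero>} \<subseteq> S"
  shows "free_lift R P b f = (\<Oplus>\<^bsub>P\<^esub>p\<in>S. f p \<odot>\<^bsub>P\<^esub> b p)"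
proof -
  interpret P: module R P by fact
  show ?thesis
    unfolding free_lift_def
    by (rule P.add.finprod_mono_neutral_cong_left)
      (use assms in \<open>auto simp: free_module_carrier Pi_def subset_iff\<close>)
qed

lemma linear_free_lift:
  assumes "module R P" "b \<in> X \<rightarrow> carrier P"
  shows "linear_map R (free_module R X) P (free_lift R P b)"
proof -
  let ?F = "free_module R X"
  interpret P: module R P by fact
  interpret F: module R "free_module R X" by (rule module_free)
  have cl: "(\<lambda>p. f p \<odot>\<^bsub>P\<^esub> b p) \<in> S \<rightarrow> carrier P" if "f \<in> carrier (?F)" "S \<subseteq> X" for f S
    using that assms(2) by (auto simp: free_module_carrier Pi_def subset_iff)
  have supp: "{x. f x \<noteq> \<zero>} \<subseteq> X" "finite {x. f x \<noteq> \<zero>}" if "f \<in> carrier (?F)" for f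
    using that by (auto simp: free_module_carrier)
  note ls = free_lift_superset[OF assms]
  show ?thesis
  proof (rule linear_mapI)
    fix f assume f: "f \<in> carrier (?F)"
    show "free_lift R P b f \<in> carrier P"
      unfolding free_lift_def using cl[OF f supp(1)[OF f]] by simp
  next
    fix f g assume f: "f \<in> carrier (?F)" and g: "g \<in> carrier (?F)"
    let ?S = "{x. f x \<noteq> \<zero>} \<union> {x. g x \<noteq> \<zero>}"
    have S: "finite ?S" "?S \<subseteq> X" using supp f g by auto
    have fg: "f \<oplus>\<^bsub>?F\<^esub> g \<in> carrier (?F)"
      by (rule F.a_closed[OF f g])
    have K: "f x \<in> carrier R" "g x \<in> carrier R" for x using f g by (auto simp: free_module_carrier)
    have "free_lift R P b (f \<oplus>\<^bsub>?F\<^esub> g) =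
        (\<Oplus>\<^bsub>P\<^esub>p\<in>?S. (f p \<oplus> g p) \<odot>\<^bsub>P\<^esub> b p)"
      using ls[OF fg S] by force
    also have "\<dots> = (\<Oplus>\<^bsub>P\<^esub>p\<in>?S. f p \<odot>\<^bsub>P\<^esub> b p \<oplus>\<^bsub>P\<^esub> g p \<odot>\<^bsub>P\<^esub> b p)"
      by (rule P.finsum_cong')
        (use S assms(2) K in \<open>auto simp: P.smult_l_distr Pi_def subset_iff\<close>)
    also have "\<dots> = free_lift R P b f \<oplus>\<^bsub>P\<^esub> free_lift R P b g"
      using ls[OF f S] ls[OF g S] P.finsum_addf[OF cl[OF f S(2)] cl[OF g S(2)]] by auto
    finally show "free_lift R P b (f \<oplus>\<^bsub>?F\<^esub> g) = free_lift R P b f \<oplus>\<^bsub>P\<^esub> free_lift R P b g" .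
  next
    fix a f assume a: "a \<in> carrier R" and f: "f \<in> carrier (?F)"
    let ?S = "{x. f x \<noteq> \<zero>}"
    note S = supp(2,1)[OF f]
    have af: "a \<odot>\<^bsub>?F\<^esub> f \<in> carrier (?F)"
      by (rule F.smult_closed[OF a f])
    have K: "f x \<in> carrier R" for x using f by (auto simp: free_module_carrier)
    have "free_lift R P b (a \<odot>\<^bsub>?F\<^esub> f) = (\<Oplus>\<^bsub>P\<^esub>p\<in>?S. (a \<otimes> f p) \<odot>\<^bsub>P\<^esub> b p)"
      using ls[OF af S] a by fastforce
    also have "\<dots> = (\<Oplus>\<^bsub>P\<^esub>p\<in>?S. a \<odot>\<^bsub>P\<^esub> (f p \<odot>\<^bsub>P\<^esub> b p))"
      by (rule P.finsum_cong')
        (use S assms(2) K a in \<open>auto simp: P.smult_assoc1 Pi_def subset_iff\<close>)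
    also have "\<dots> = a \<odot>\<^bsub>P\<^esub> free_lift R P b f"
      unfolding free_lift_def by (simp add: P.finsum_smult_ldistr[OF S(1) a cl[OF f S(2)]])
    finally show "free_lift R P b (a \<odot>\<^bsub>?F\<^esub> f) = a \<odot>\<^bsub>P\<^esub> free_lift R P b f" .
  qed
qed

lemma free_lift_basis:
  assumes "module R P" "b \<in> X \<rightarrow> carrier P" "x \<in> X"
  shows "free_lift R P b (basis_elem R x) = b x"
proof -
  interpret P: module R P by fact
  have b: "b x \<in> carrier P" using assms by auto
  have "free_lift R P b (basis_elem R x) = (\<Oplus>\<^bsub>P\<^esub>p\<in>{x}. basis_elem R x p \<odot>\<^bsub>P\<^esub> b p)"
    by (rule free_lift_superset[OF assms(1,2) basis_elem_closed[OF assms(3)]])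
      (use assms(3) in \<open>auto simp: basis_elem_def\<close>)
  then show ?thesis using b by (simp add: basis_elem_def)
qed

end

declare free_module_simps [simp del]

section \<open>Tensor products\<close>

locale tensor_product = M: module K M + N: module K N
  for K :: "('k, 'r) ring_scheme" and M :: "('k, 'a, 'm) module_scheme"
    and N :: "('k, 'b, 'n) module_scheme"
begin

abbreviation "F \<equiv> free_module K (carrier M \<times> carrier N)"
abbreviation "e \<equiv> basis_elem K"
abbreviation "T \<equiv> tensor K M N"
abbreviation "pure \<equiv> pure_tensor K M N"

lemma module_F: "module K F"
  by (rule M.R.module_free)

lemma e_closed: "\<lbrakk>x \<in> carrier M; y \<in> carrier N\<rbrakk> \<Longrightarrow> e (x, y) \<in> carrier F"
  by (rule M.R.basis_elem_closed) simp

lemma relations_closed: "tensor_relations K M N \<subseteq> carrier F"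
proof -
  interpret F: module K F by (rule module_F)
  show ?thesis
    unfolding tensor_relations_def Let_def
    by (intro Un_least subsetI; elim CollectE exE conjE)
      (simp_all add: e_closed)
qed

sublocale Q: quotient_module K F "tensor_kernel K M N" T
proof -
  show "quotient_module K F (tensor_kernel K M N) T"
    by (intro quotient_module.intro quotient_module_axioms.intro module_F)
      (simp_all add: tensor_def module_quot_def tensor_kernel_def
        submodule_generated_submodule[OF module_F relations_closed])
qed

lemma module_tensor: "module K T"
  by (rule Q.module_Q)

lemma relation_coset_eq:
  assumes "x \<ominus>\<^bsub>F\<^esub> y \<in> tensor_relations K M N" "x \<in> carrier F" "y \<in> carrier F"
  shows "tensor_kernel K M N +>\<^bsub>F\<^esub> x = tensor_kernel K M N +>\<^bsub>F\<^esub> y"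
proof -
  have "x \<ominus>\<^bsub>F\<^esub> y \<in> tensor_kernel K M N"
    unfolding tensor_kernel_def using submodule_generated_base assms(1) by (rule subsetD)
  then show ?thesis using Q.coset_eq_iff assms by blast
qed

lemma pure_bilinear: "bilinear_map K M N T pure"
proof -
  let ?c = "\<lambda>f. tensor_kernel K M N +>\<^bsub>F\<^esub> f"
  note s = Q.M.a_closed[OF e_closed e_closed] Q.smult_closed[OF _ e_closed] e_closed
  note r = relation_coset_eq and d = tensor_relations_def Let_def
  have "?c (e (x \<oplus>\<^bsub>M\<^esub> x', y)) = ?c (e (x, y) \<oplus>\<^bsub>F\<^esub> e (x', y))"
    if "x \<in> carrier M" "x' \<in> carrier M" "y \<in> carrier N" for x x' y
    by (rule r) (use that in \<open>auto simp: d s\<close>)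
  moreover have "?c (e (x, y \<oplus>\<^bsub>N\<^esub> y')) = ?c (e (x, y) \<oplus>\<^bsub>F\<^esub> e (x, y'))"
    if "x \<in> carrier M" "y \<in> carrier N" "y' \<in> carrier N" for x y y'
    by (rule r) (use that in \<open>auto simp: d s\<close>)
  moreover have "?c (e (a \<odot>\<^bsub>M\<^esub> x, y)) = ?c (a \<odot>\<^bsub>F\<^esub> e (x, y))"
    if "a \<in> carrier K" "x \<in> carrier M" "y \<in> carrier N" for a x y
    by (rule r) (use that in \<open>auto simp: d s\<close>)
  moreover have "?c (e (x, a \<odot>\<^bsub>N\<^esub> y)) = ?c (a \<odot>\<^bsub>F\<^esub> e (x, y))"
    if "a \<in> carrier K" "x \<in> carrier M" "y \<in> carrier N" for a x y
    by (rule r) (use that in \<open>auto simp: d s\<close>)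
  ultimately show ?thesis
    by (intro bilinear_mapI)
      (simp_all add: pure_tensor_def Q.coset_closed Q.coset_add Q.coset_smult e_closed)
qed

lemmas pure_simps = bilinear_mapD[OF pure_bilinear]

text \<open>Scalars can be absorbed into a pure tensor, so tensors are sums of pure tensors.\<close>

lemma tensor_induct [consumes 1, case_names pure add]:
  assumes t: "t \<in> carrier T"
    and pure: "\<And>x y. \<lbrakk>x \<in> carrier M; y \<in> carrier N\<rbrakk> \<Longrightarrow> P (pure x y)"
    and add: "\<And>s t. \<lbrakk>s \<in> carrier T; t \<in> carrier T; P s; P t\<rbrakk> \<Longrightarrow> P (s \<oplus>\<^bsub>T\<^esub> t)"
  shows "P t"
proof -
  interpret T: module K T by (rule module_tensor)
  let ?c = "\<lambda>f. tensor_kernel K M N +>\<^bsub>F\<^esub> f"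
  note c = linear_mapD[OF Q.linear_coset]
  have pure_zero: "pure \<zero>\<^bsub>M\<^esub> \<zero>\<^bsub>N\<^esub> = \<zero>\<^bsub>T\<^esub>"
    using bilinear_map_zero[OF M.module_axioms N.module_axioms module_tensor pure_bilinear] by simp
  obtain f where f: "f \<in> carrier F" "t = ?c f" using Q.coset_rep t by blast
  \<comment> \<open>P is not assumed to be closed under scalars, so the claim is strengthened to all
    multiples; at a basis element the scalar moves into the first tensor factor.\<close>
  have "\<forall>a\<in>carrier K. P (a \<odot>\<^bsub>T\<^esub> ?c f)"
    using f(1)
  proof (induction rule: M.R.free_module_induct)
    case (basis p)
    then obtain x y where p: "p = (x, y)" "x \<in> carrier M" "y \<in> carrier N" by auto
    show ?case
    proof
      fix a assume a: "a \<in> carrier K"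
      then have "a \<odot>\<^bsub>T\<^esub> ?c (e p) = pure (a \<odot>\<^bsub>M\<^esub> x) y"
        using p by (simp add: pure_simps) (simp add: pure_tensor_def)
      then show "P (a \<odot>\<^bsub>T\<^esub> ?c (e p))" using pure p a by simp
    qed
  next
    case zero
    have "?c (\<lambda>x. \<zero>\<^bsub>K\<^esub>) = \<zero>\<^bsub>T\<^esub>"
      using Q.zero_coset by (simp add: free_module_simps)
    then show ?case using pure[of "\<zero>\<^bsub>M\<^esub>" "\<zero>\<^bsub>N\<^esub>"] pure_zero by simp
  next
    case (add f g)
    then show ?case
      using c(2)[of f g] c(1) assms(3) by (simp add: T.smult_r_distr free_module_simps)
  next
    case (smult a f)
    then show ?case
      using c(3)[of a f] c(1) by (simp add: T.smult_assoc1[symmetric] free_module_simps)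
  qed
  then have "P (\<one>\<^bsub>K\<^esub> \<odot>\<^bsub>T\<^esub> ?c f)" by blast
  then show ?thesis using f t by simp
qed

lemma linear_eqI:
  assumes "linear_map K T P f" "linear_map K T P g"
    and "\<And>x y. \<lbrakk>x \<in> carrier M; y \<in> carrier N\<rbrakk> \<Longrightarrow> f (pure x y) = g (pure x y)"
    and "t \<in> carrier T"
  shows "f t = g t"
  using assms(4)
  by (induction rule: tensor_induct)
    (simp_all add: assms(3) linear_mapD[OF assms(1)] linear_mapD[OF assms(2)])

context
  fixes P :: "('k, 'c, 'p) module_scheme" and b :: "'a \<Rightarrow> 'b \<Rightarrow> 'c"
  assumes P: "module K P" and b: "bilinear_map K M N P b"
begin

private abbreviation "\<phi> \<equiv> free_lift K P (\<lambda>p. b (fst p) (snd p))"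

private lemma phi_linear: "linear_map K F P \<phi>"
  by (rule M.R.linear_free_lift[OF P]) (use bilinear_mapD(1)[OF b] in auto)

private lemma phi_basis: "\<lbrakk>x \<in> carrier M; y \<in> carrier N\<rbrakk> \<Longrightarrow> \<phi> (e (x, y)) = b x y"
  using M.R.free_lift_basis[OF P, of "\<lambda>p. b (fst p) (snd p)" "carrier M \<times> carrier N" "(x, y)"]
    bilinear_mapD(1)[OF b] by (simp add: Pi_def)

private lemma phi_kernel:
  assumes "x \<in> tensor_kernel K M N"
  shows "\<phi> x = \<zero>\<^bsub>P\<^esub>"
proof -
  interpret P: module K P by (rule P)
  note s = Q.M.a_closed[OF e_closed e_closed] Q.smult_closed[OF _ e_closed] e_closed
  note l = linear_mapD[OF phi_linear] linear_map_minus[OF module_F P phi_linear]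
  have r: "z \<ominus>\<^bsub>P\<^esub> z = \<zero>\<^bsub>P\<^esub>" if "z \<in> carrier P" for z
    using that by (simp add: a_minus_def P.r_neg)
  have "\<phi> x = \<zero>\<^bsub>P\<^esub>" if "x \<in> tensor_relations K M N" for x
    using that unfolding tensor_relations_def Let_def
    by (elim UnE CollectE exE conjE) (simp_all add: l s r phi_basis bilinear_mapD[OF b])
  then have "tensor_relations K M N \<subseteq> {x \<in> carrier F. \<phi> x = \<zero>\<^bsub>P\<^esub>}"
    using relations_closed by blast
  from submodule_generated_least[OF submodule_kernel[OF module_F P phi_linear] this]
  show ?thesis using assms by (auto simp: tensor_kernel_def)
qed

lemma tensor_lift_linear: "linear_map K T P (tensor_lift K P b)"
  using Q.linear_lift[OF P phi_linear phi_kernel]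
  by (simp add: tensor_lift_def[abs_def] free_lift_def[abs_def])

lemma tensor_lift_pure:
  "\<lbrakk>x \<in> carrier M; y \<in> carrier N\<rbrakk> \<Longrightarrow> tensor_lift K P b (pure x y) = b x y"
  using Q.lift_coset[OF P phi_linear phi_kernel e_closed] phi_basis
  by (simp add: tensor_lift_def pure_tensor_def free_lift_def)

end

end

text \<open>A family of bilinear maps depending linearly on a parameter lifts to a map bilinear in
  the parameter and the tensor. This handles the nested lifts in \<open>tensor_op2\<close> and
  \<open>tensor_assoc\<close>.\<close>

lemma bilinear_tensor_lift:
  assumes "tensor_product K M N" and P: "module K P" and L: "module K L"
    and lin: "\<And>x. x \<in> carrier L \<Longrightarrow> bilinear_map K M N P (b x)"
    and add: "\<And>l l' x y. \<lbrakk>l \<in> carrier L; l' \<in> carrier L; x \<in> carrier M; y \<in> carrier N\<rbrakk> \<Longrightarrow>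
      b (l \<oplus>\<^bsub>L\<^esub> l') x y = b l x y \<oplus>\<^bsub>P\<^esub> b l' x y"
    and smult: "\<And>a l x y. \<lbrakk>a \<in> carrier K; l \<in> carrier L; x \<in> carrier M; y \<in> carrier N\<rbrakk> \<Longrightarrow>
      b (a \<odot>\<^bsub>L\<^esub> l) x y = a \<odot>\<^bsub>P\<^esub> b l x y"
  shows "bilinear_map K L (tensor K M N) P (\<lambda>l. tensor_lift K P (b l))"
proof -
  interpret tensor_product K M N by fact
  interpret P: module K P by fact
  interpret L: module K L by fact
  interpret T: module K T by (rule module_tensor)
  note l = linear_mapD[OF tensor_lift_linear[OF P lin]] and p = tensor_lift_pure[OF P lin]
  note bl = bilinear_mapD[OF lin]
  show ?thesis
  proof (rule bilinear_mapI)
    fix x x' y assume x: "x \<in> carrier L" "x' \<in> carrier L" and y: "y \<in> carrier T"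
    show "tensor_lift K P (b (x \<oplus>\<^bsub>L\<^esub> x')) y = tensor_lift K P (b x) y \<oplus>\<^bsub>P\<^esub> tensor_lift K P (b x') y"
      by (rule linear_eqI[OF _ _ _ y], rule tensor_lift_linear[OF P lin], simp add: x,
          rule linear_map_plus[OF P tensor_lift_linear[OF P lin] tensor_lift_linear[OF P lin]])
        (use x in \<open>simp_all add: p add bl\<close>)
  next
    fix a x y assume x: "a \<in> carrier K" "x \<in> carrier L" and y: "y \<in> carrier T"
    show "tensor_lift K P (b (a \<odot>\<^bsub>L\<^esub> x)) y = a \<odot>\<^bsub>P\<^esub> tensor_lift K P (b x) y"
      using y
    proof (induction rule: tensor_induct)
      case (pure u v)
      then show ?case using x by (simp add: p smult)
    next
      case (add s t)
      then show ?case using x by (simp add: l P.smult_r_distr)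
    qed
  qed (simp_all add: l)
qed

text \<open>The operation \<open>tensor_op\<close> with two different factors: coassociativity takes
  place on a tensor product of W with W \<otimes> W.\<close>

definition tensor_op2 ::
  "('k, 'r) ring_scheme \<Rightarrow> ('k, 'a, 'm) module_scheme \<Rightarrow> ('k, 'b, 'n) module_scheme \<Rightarrow>
    ('a \<Rightarrow> 'a \<Rightarrow> 'a) \<Rightarrow> ('b \<Rightarrow> 'b \<Rightarrow> 'b) \<Rightarrow>
    ('a \<times> 'b \<Rightarrow> 'k) set \<Rightarrow> ('a \<times> 'b \<Rightarrow> 'k) set \<Rightarrow> ('a \<times> 'b \<Rightarrow> 'k) set"
  where "tensor_op2 K M N f g S T =
    tensor_lift K (tensor K M N)
      (\<lambda>x x'. tensor_lift K (tensor K M N) (\<lambda>y y'. pure_tensor K M N (f x y) (g x' y')) T) S"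

lemma tensor_op_eq: "tensor_op K W = tensor_op2 K W W"
  by (simp add: fun_eq_iff tensor_op_def tensor_op2_def)

context tensor_product
begin

context
  fixes f g
  assumes f: "bilinear_map K M M M f" and g: "bilinear_map K N N N g"
begin

private abbreviation "c x x' \<equiv> \<lambda>y y'. pure (f x y) (g x' y')"

private lemma c_bilinear:
  "\<lbrakk>x \<in> carrier M; x' \<in> carrier N\<rbrakk> \<Longrightarrow> bilinear_map K M N T (c x x')"
  by (rule bilinear_mapI) (simp_all add: pure_simps bilinear_mapD[OF f] bilinear_mapD[OF g])

private abbreviation "h t \<equiv> \<lambda>x x'. tensor_lift K T (c x x') t"

private lemma h_simps:
  "\<lbrakk>x \<in> carrier M; x' \<in> carrier N; y \<in> carrier M; y' \<in> carrier N\<rbrakk> \<Longrightarrow>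
    h (pure y y') x x' = c x x' y y'"
  "\<lbrakk>x \<in> carrier M; x' \<in> carrier N; t \<in> carrier T\<rbrakk> \<Longrightarrow> h t x x' \<in> carrier T"
  "\<lbrakk>x \<in> carrier M; x' \<in> carrier N; t \<in> carrier T; t' \<in> carrier T\<rbrakk> \<Longrightarrow>
    h (t \<oplus>\<^bsub>T\<^esub> t') x x' = h t x x' \<oplus>\<^bsub>T\<^esub> h t' x x'"
  "\<lbrakk>a \<in> carrier K; x \<in> carrier M; x' \<in> carrier N; t \<in> carrier T\<rbrakk> \<Longrightarrow>
    h (a \<odot>\<^bsub>T\<^esub> t) x x' = a \<odot>\<^bsub>T\<^esub> h t x x'"
  using tensor_lift_pure[OF module_tensor c_bilinear]
    linear_mapD[OF tensor_lift_linear[OF module_tensor c_bilinear]] by auto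

private lemma h_bilinear:
  assumes t: "t \<in> carrier T"
  shows "bilinear_map K M N T (h t)"
proof -
  interpret T: module K T by (rule module_tensor)
  note s = h_simps pure_simps bilinear_mapD[OF f] bilinear_mapD[OF g]
  show ?thesis
  proof (rule bilinear_mapI)
    fix x x' y assume x: "x \<in> carrier M" "x' \<in> carrier M" "y \<in> carrier N"
    show "h t (x \<oplus>\<^bsub>M\<^esub> x') y = h t x y \<oplus>\<^bsub>T\<^esub> h t x' y"
      using t by (induction rule: tensor_induct) (use x in \<open>simp_all add: s T.a_ac\<close>)
  next
    fix x y y' assume x: "x \<in> carrier M" "y \<in> carrier N" "y' \<in> carrier N"
    show "h t x (y \<oplus>\<^bsub>N\<^esub> y') = h t x y \<oplus>\<^bsub>T\<^esub> h t x y'"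
      using t by (induction rule: tensor_induct) (use x in \<open>simp_all add: s T.a_ac\<close>)
  next
    fix a x y assume x: "a \<in> carrier K" "x \<in> carrier M" "y \<in> carrier N"
    show "h t (a \<odot>\<^bsub>M\<^esub> x) y = a \<odot>\<^bsub>T\<^esub> h t x y"
      using t by (induction rule: tensor_induct) (use x in \<open>simp_all add: s T.smult_r_distr\<close>)
    show "h t x (a \<odot>\<^bsub>N\<^esub> y) = a \<odot>\<^bsub>T\<^esub> h t x y"
      using t by (induction rule: tensor_induct) (use x in \<open>simp_all add: s T.smult_r_distr\<close>)
  qed (use t in \<open>simp add: s\<close>)
qed

lemma tensor_op2_pure:
  "\<lbrakk>x \<in> carrier M; x' \<in> carrier N; y \<in> carrier M; y' \<in> carrier N\<rbrakk> \<Longrightarrow>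
    tensor_op2 K M N f g (pure x x') (pure y y') = pure (f x y) (g x' y')"
  by (simp add: tensor_op2_def tensor_lift_pure[OF module_tensor h_bilinear] h_simps pure_simps)

lemma tensor_op2_bilinear: "bilinear_map K T T T (tensor_op2 K M N f g)"
proof -
  have "bilinear_map K T T T (\<lambda>t. tensor_lift K T (h t))"
    by (rule bilinear_tensor_lift[OF tensor_product_axioms module_tensor module_tensor h_bilinear])
      (simp_all add: h_simps)
  then show ?thesis
    by (simp add: bilinear_map_def tensor_op2_def[abs_def])
qed

end

end

section \<open>Augmented dendriform structures\<close>

text \<open>Kept apart from the module record, so that \<open>tensor K M N\<close>, which is a bare
  module, can carry such operations.\<close>

record ('k, 'a) aug_ops =
  aone :: 'a
  astar :: "'a \<Rightarrow> 'a \<Rightarrow> 'a" (infixl \<open>\<star>\<index>\<close> 70)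
  aprec :: "'a \<Rightarrow> 'a \<Rightarrow> 'a" (infixl \<open>\<lhd>\<index>\<close> 70)
  asucc :: "'a \<Rightarrow> 'a \<Rightarrow> 'a" (infixl \<open>\<rhd>\<index>\<close> 70)
  aeps :: "'a \<Rightarrow> 'k"

text \<open>
  The axioms of a unital dendriform algebra, with \<open>1 \<prec> 1 = 1 \<succ> 1 = 0\<close>, \<open>1 * 1 = 1\<close> and
  \<open>\<epsilon>\<close> the projection to \<open>K1\<close>, arranged so that they hold for all elements, including multiples
  of the unit.
\<close>

locale augmented = module K M
  for K :: "('k, 'r) ring_scheme" and M :: "('k, 'a, 'm) module_scheme" and A :: "('k, 'a) aug_ops" +
  assumes star_bilinear: "bilinear_map K M M M (astar A)"
    and prec_bilinear: "bilinear_map K M M M (aprec A)"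
    and succ_bilinear: "bilinear_map K M M M (asucc A)"
    and one_closed: "aone A \<in> carrier M"
    and eps_closed: "x \<in> carrier M \<Longrightarrow> aeps A x \<in> carrier K"
    and eps_add: "\<lbrakk>x \<in> carrier M; y \<in> carrier M\<rbrakk> \<Longrightarrow>
      aeps A (x \<oplus>\<^bsub>M\<^esub> y) = aeps A x \<oplus>\<^bsub>K\<^esub> aeps A y"
    and eps_smult: "\<lbrakk>a \<in> carrier K; x \<in> carrier M\<rbrakk> \<Longrightarrow>
      aeps A (a \<odot>\<^bsub>M\<^esub> x) = a \<otimes>\<^bsub>K\<^esub> aeps A x"
    and eps_one: "aeps A (aone A) = \<one>\<^bsub>K\<^esub>"
    and eps_prec: "\<lbrakk>x \<in> carrier M; y \<in> carrier M\<rbrakk> \<Longrightarrow> aeps A (x \<lhd>\<^bsub>A\<^esub> y) = \<zero>\<^bsub>K\<^esub>"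
    and eps_succ: "\<lbrakk>x \<in> carrier M; y \<in> carrier M\<rbrakk> \<Longrightarrow> aeps A (x \<rhd>\<^bsub>A\<^esub> y) = \<zero>\<^bsub>K\<^esub>"
    and one_prec: "x \<in> carrier M \<Longrightarrow> aone A \<lhd>\<^bsub>A\<^esub> x = \<zero>\<^bsub>M\<^esub>"
    and succ_one: "x \<in> carrier M \<Longrightarrow> x \<rhd>\<^bsub>A\<^esub> aone A = \<zero>\<^bsub>M\<^esub>"
    and prec_one: "x \<in> carrier M \<Longrightarrow> x \<lhd>\<^bsub>A\<^esub> aone A \<oplus>\<^bsub>M\<^esub> aeps A x \<odot>\<^bsub>M\<^esub> aone A = x"
    and one_succ: "x \<in> carrier M \<Longrightarrow> aone A \<rhd>\<^bsub>A\<^esub> x \<oplus>\<^bsub>M\<^esub> aeps A x \<odot>\<^bsub>M\<^esub> aone A = x"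
    and star_eq: "\<lbrakk>x \<in> carrier M; y \<in> carrier M\<rbrakk> \<Longrightarrow>
      x \<star>\<^bsub>A\<^esub> y = x \<lhd>\<^bsub>A\<^esub> y \<oplus>\<^bsub>M\<^esub> x \<rhd>\<^bsub>A\<^esub> y \<oplus>\<^bsub>M\<^esub> (aeps A x \<otimes>\<^bsub>K\<^esub> aeps A y) \<odot>\<^bsub>M\<^esub> aone A"
    and prec_prec: "\<lbrakk>x \<in> carrier M; y \<in> carrier M; z \<in> carrier M\<rbrakk> \<Longrightarrow>
      (x \<lhd>\<^bsub>A\<^esub> y) \<lhd>\<^bsub>A\<^esub> z = x \<lhd>\<^bsub>A\<^esub> (y \<star>\<^bsub>A\<^esub> z)"
    and succ_prec: "\<lbrakk>x \<in> carrier M; y \<in> carrier M; z \<in> carrier M\<rbrakk> \<Longrightarrow>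
      (x \<rhd>\<^bsub>A\<^esub> y) \<lhd>\<^bsub>A\<^esub> z = x \<rhd>\<^bsub>A\<^esub> (y \<lhd>\<^bsub>A\<^esub> z)"
    and succ_succ: "\<lbrakk>x \<in> carrier M; y \<in> carrier M; z \<in> carrier M\<rbrakk> \<Longrightarrow>
      x \<rhd>\<^bsub>A\<^esub> (y \<rhd>\<^bsub>A\<^esub> z) = (x \<star>\<^bsub>A\<^esub> y) \<rhd>\<^bsub>A\<^esub> z"
begin

lemmas prec_simps = bilinear_mapD[OF prec_bilinear]
  bilinear_map_zero[OF module_axioms module_axioms module_axioms prec_bilinear]
lemmas succ_simps = bilinear_mapD[OF succ_bilinear]
  bilinear_map_zero[OF module_axioms module_axioms module_axioms succ_bilinear]
lemmas star_simps = bilinear_mapD[OF star_bilinear]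
  bilinear_map_zero[OF module_axioms module_axioms module_axioms star_bilinear]

lemma eps_zero: "aeps A \<zero>\<^bsub>M\<^esub> = \<zero>\<^bsub>K\<^esub>"
proof -
  have "aeps A (\<zero>\<^bsub>K\<^esub> \<odot>\<^bsub>M\<^esub> \<zero>\<^bsub>M\<^esub>) = \<zero>\<^bsub>K\<^esub> \<otimes>\<^bsub>K\<^esub> aeps A \<zero>\<^bsub>M\<^esub>"
    by (rule eps_smult) simp_all
  then show ?thesis by (simp add: eps_closed)
qed

lemmas eps_simps = eps_closed eps_add eps_smult eps_one eps_prec eps_succ eps_zero

lemmas aug_simps = prec_simps succ_simps star_simps one_closed eps_simps one_prec succ_one

lemma one_star: "x \<in> carrier M \<Longrightarrow> aone A \<star>\<^bsub>A\<^esub> x = x"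
  by (simp add: star_eq aug_simps one_succ)

lemma star_one: "x \<in> carrier M \<Longrightarrow> x \<star>\<^bsub>A\<^esub> aone A = x"
  by (simp add: star_eq aug_simps prec_one)

lemma eps_star:
  "\<lbrakk>x \<in> carrier M; y \<in> carrier M\<rbrakk> \<Longrightarrow> aeps A (x \<star>\<^bsub>A\<^esub> y) = aeps A x \<otimes>\<^bsub>K\<^esub> aeps A y"
  by (simp add: star_eq aug_simps)

text \<open>The three dendriform axioms add up to associativity. The unit multiples from the inner
  uses of \<open>star_eq\<close> disappear because 1 \<prec> z = 0 and x \<succ> 1 = 0; the outer
  ones agree since \<epsilon> is multiplicative for the star product.\<close>

lemma star_assoc:
  assumes "x \<in> carrier M" "y \<in> carrier M" "z \<in> carrier M"
  shows "(x \<star>\<^bsub>A\<^esub> y) \<star>\<^bsub>A\<^esub> z = x \<star>\<^bsub>A\<^esub> (y \<star>\<^bsub>A\<^esub> z)"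
proof -
  have "(x \<star>\<^bsub>A\<^esub> y) \<star>\<^bsub>A\<^esub> z = (x \<star>\<^bsub>A\<^esub> y) \<lhd>\<^bsub>A\<^esub> z \<oplus>\<^bsub>M\<^esub> (x \<star>\<^bsub>A\<^esub> y) \<rhd>\<^bsub>A\<^esub> z
      \<oplus>\<^bsub>M\<^esub> (aeps A x \<otimes>\<^bsub>K\<^esub> aeps A y \<otimes>\<^bsub>K\<^esub> aeps A z) \<odot>\<^bsub>M\<^esub> aone A"
    using assms star_eq[of "x \<star>\<^bsub>A\<^esub> y" z] by (simp add: star_simps eps_star)
  also have "(x \<star>\<^bsub>A\<^esub> y) \<lhd>\<^bsub>A\<^esub> z = x \<lhd>\<^bsub>A\<^esub> (y \<star>\<^bsub>A\<^esub> z) \<oplus>\<^bsub>M\<^esub> x \<rhd>\<^bsub>A\<^esub> (y \<lhd>\<^bsub>A\<^esub> z)"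
    using assms star_eq[of x y] by (simp add: aug_simps prec_prec succ_prec)
  also have "(x \<star>\<^bsub>A\<^esub> y) \<rhd>\<^bsub>A\<^esub> z = x \<rhd>\<^bsub>A\<^esub> (y \<rhd>\<^bsub>A\<^esub> z)"
    using assms succ_succ by simp
  also have "x \<lhd>\<^bsub>A\<^esub> (y \<star>\<^bsub>A\<^esub> z) \<oplus>\<^bsub>M\<^esub> x \<rhd>\<^bsub>A\<^esub> (y \<lhd>\<^bsub>A\<^esub> z) \<oplus>\<^bsub>M\<^esub> x \<rhd>\<^bsub>A\<^esub> (y \<rhd>\<^bsub>A\<^esub> z)
      = x \<lhd>\<^bsub>A\<^esub> (y \<star>\<^bsub>A\<^esub> z) \<oplus>\<^bsub>M\<^esub> x \<rhd>\<^bsub>A\<^esub> (y \<star>\<^bsub>A\<^esub> z)"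
    using assms star_eq[of y z] by (simp add: aug_simps M.a_assoc)
  also have "\<dots> \<oplus>\<^bsub>M\<^esub> (aeps A x \<otimes>\<^bsub>K\<^esub> aeps A y \<otimes>\<^bsub>K\<^esub> aeps A z) \<odot>\<^bsub>M\<^esub> aone A = x \<star>\<^bsub>A\<^esub> (y \<star>\<^bsub>A\<^esub> z)"
    using assms star_eq[of x "y \<star>\<^bsub>A\<^esub> z"] by (simp add: aug_simps eps_star R.m_assoc)
  finally show ?thesis .
qed

lemma prec_one_ker: "\<lbrakk>x \<in> carrier M; aeps A x = \<zero>\<^bsub>K\<^esub>\<rbrakk> \<Longrightarrow> x \<lhd>\<^bsub>A\<^esub> aone A = x"
  using prec_one[of x] by (simp add: aug_simps)

lemma one_succ_ker: "\<lbrakk>x \<in> carrier M; aeps A x = \<zero>\<^bsub>K\<^esub>\<rbrakk> \<Longrightarrow> aone A \<rhd>\<^bsub>A\<^esub> x = x"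
  using one_succ[of x] by (simp add: aug_simps)

end

text \<open>Compatibility with the star product follows from these conditions through
  \<open>star_eq\<close>; see \<open>aug_hom_star\<close>.\<close>

definition aug_hom ::
  "('k, 'r) ring_scheme \<Rightarrow> ('k, 'a, 'm) module_scheme \<Rightarrow> ('k, 'a) aug_ops \<Rightarrow>
    ('k, 'b, 'n) module_scheme \<Rightarrow> ('k, 'b) aug_ops \<Rightarrow> ('a \<Rightarrow> 'b) \<Rightarrow> bool"
  where "aug_hom K M A N B f \<longleftrightarrow> linear_map K M N f \<and> f (aone A) = aone B \<and>
    (\<forall>x\<in>carrier M. aeps B (f x) = aeps A x) \<and>
    (\<forall>x\<in>carrier M. \<forall>y\<in>carrier M.
      f (x \<lhd>\<^bsub>A\<^esub> y) = f x \<lhd>\<^bsub>B\<^esub> f y \<and> f (x \<rhd>\<^bsub>A\<^esub> y) = f x \<rhd>\<^bsub>B\<^esub> f y)"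

lemma aug_homD:
  assumes "aug_hom K M A N B f"
  shows "linear_map K M N f" "f (aone A) = aone B"
    "x \<in> carrier M \<Longrightarrow> aeps B (f x) = aeps A x"
    "\<lbrakk>x \<in> carrier M; y \<in> carrier M\<rbrakk> \<Longrightarrow> f (x \<lhd>\<^bsub>A\<^esub> y) = f x \<lhd>\<^bsub>B\<^esub> f y"
    "\<lbrakk>x \<in> carrier M; y \<in> carrier M\<rbrakk> \<Longrightarrow> f (x \<rhd>\<^bsub>A\<^esub> y) = f x \<rhd>\<^bsub>B\<^esub> f y"
  using assms by (auto simp: aug_hom_def)

lemma aug_hom_star:
  assumes "augmented K M A" "augmented K N B" "aug_hom K M A N B f"
    and "x \<in> carrier M" "y \<in> carrier M"
  shows "f (x \<star>\<^bsub>A\<^esub> y) = f x \<star>\<^bsub>B\<^esub> f y"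
proof -
  interpret A: augmented K M A by fact
  interpret B: augmented K N B by fact
  note f = aug_homD[OF assms(3)] linear_mapD[OF aug_homD(1)[OF assms(3)]]
  show ?thesis using assms(4,5) by (simp add: A.star_eq B.star_eq A.aug_simps f)
qed

lemma aug_hom_comp:
  assumes "aug_hom K M A N B f" "aug_hom K N B P C g"
  shows "aug_hom K M A P C (\<lambda>x. g (f x))"
  unfolding aug_hom_def
  using aug_homD[OF assms(1)] aug_homD[OF assms(2)] linear_mapD(1)[OF aug_homD(1)[OF assms(1)]]
    linear_map_comp[of K M N f P g]
  by auto

lemma aug_hom_id: "aug_hom K M A M A (\<lambda>x. x)"
  by (simp add: aug_hom_def linear_map_id)

subsection \<open>Tensor products of augmented structures\<close>

context tensor_product
begin

lemma tensor_induct2 [consumes 2, case_names pure addl addr]: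
  assumes s: "s \<in> carrier T" and t: "t \<in> carrier T"
    and pure: "\<And>x y x' y'. \<lbrakk>x \<in> carrier M; y \<in> carrier N; x' \<in> carrier M; y' \<in> carrier N\<rbrakk> \<Longrightarrow>
      P (pure x y) (pure x' y')"
    and addl: "\<And>s s' t. \<lbrakk>s \<in> carrier T; s' \<in> carrier T; t \<in> carrier T; P s t; P s' t\<rbrakk> \<Longrightarrow>
      P (s \<oplus>\<^bsub>T\<^esub> s') t"
    and addr: "\<And>s t t'. \<lbrakk>s \<in> carrier T; t \<in> carrier T; t' \<in> carrier T; P s t; P s t'\<rbrakk> \<Longrightarrow>
      P s (t \<oplus>\<^bsub>T\<^esub> t')"
  shows "P s t"
  using s
proof (induction rule: tensor_induct)
  case (pure x y)
  show ?case
    using t by (induction rule: tensor_induct) (use pure in \<open>simp_all add: assms(3) addr pure_simps\<close>)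
qed (simp add: addl t)

lemma tensor_induct3 [consumes 3, case_names pure add1 add2 add3]:
  assumes r: "r \<in> carrier T" and s: "s \<in> carrier T" and t: "t \<in> carrier T"
    and pure: "\<And>x y x' y' x'' y''. \<lbrakk>x \<in> carrier M; y \<in> carrier N; x' \<in> carrier M; y' \<in> carrier N;
      x'' \<in> carrier M; y'' \<in> carrier N\<rbrakk> \<Longrightarrow> P (pure x y) (pure x' y') (pure x'' y'')"
    and add1: "\<And>r r' s t. \<lbrakk>r \<in> carrier T; r' \<in> carrier T; s \<in> carrier T; t \<in> carrier T;
      P r s t; P r' s t\<rbrakk> \<Longrightarrow> P (r \<oplus>\<^bsub>T\<^esub> r') s t"
    and add2: "\<And>r s s' t. \<lbrakk>r \<in> carrier T; s \<in> carrier T; s' \<in> carrier T; t \<in> carrier T;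
      P r s t; P r s' t\<rbrakk> \<Longrightarrow> P r (s \<oplus>\<^bsub>T\<^esub> s') t"
    and add3: "\<And>r s t t'. \<lbrakk>r \<in> carrier T; s \<in> carrier T; t \<in> carrier T; t' \<in> carrier T;
      P r s t; P r s t'\<rbrakk> \<Longrightarrow> P r s (t \<oplus>\<^bsub>T\<^esub> t')"
  shows "P r s t"
  using r
proof (induction rule: tensor_induct)
  case (pure x y)
  show ?case
    using s t by (induction rule: tensor_induct2)
      (use pure in \<open>simp_all add: assms(4) add2 add3 pure_simps\<close>)
qed (simp add: add1 s t)

end

definition eps_right ::
  "('k, 'r) ring_scheme \<Rightarrow> ('k, 'a, 'm) module_scheme \<Rightarrow> ('k, 'b) aug_ops \<Rightarrow>
    ('a \<times> 'b \<Rightarrow> 'k) set \<Rightarrow> 'a"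
  where "eps_right K M B = tensor_lift K M (\<lambda>x y. aeps B y \<odot>\<^bsub>M\<^esub> x)"

definition eps_left ::
  "('k, 'r) ring_scheme \<Rightarrow> ('k, 'a) aug_ops \<Rightarrow> ('k, 'b, 'n) module_scheme \<Rightarrow>
    ('a \<times> 'b \<Rightarrow> 'k) set \<Rightarrow> 'b"
  where "eps_left K A N = tensor_lift K N (\<lambda>x y. aeps A x \<odot>\<^bsub>N\<^esub> y)"

text \<open>The correction applies id \<otimes> \<epsilon> to both arguments, which makes it
  bilinear on arbitrary tensors. If both arguments are coproducts satisfying the right counit law,
  it is (x \<prec> y) \<otimes> 1 or (x \<succ> y) \<otimes> 1.\<close>

definition tensor_aug ::
  "('k, 'r) ring_scheme \<Rightarrow> ('k, 'a, 'm) module_scheme \<Rightarrow> ('k, 'a) aug_ops \<Rightarrow>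
    ('k, 'b, 'n) module_scheme \<Rightarrow> ('k, 'b) aug_ops \<Rightarrow> ('k, ('a \<times> 'b \<Rightarrow> 'k) set) aug_ops"
  where "tensor_aug K M A N B =
    \<lparr>aone = pure_tensor K M N (aone A) (aone B),
     astar = tensor_op2 K M N (astar A) (astar B),
     aprec = (\<lambda>s t. tensor_op2 K M N (astar A) (aprec B) s t \<oplus>\<^bsub>tensor K M N\<^esub>
       pure_tensor K M N (eps_right K M B s \<lhd>\<^bsub>A\<^esub> eps_right K M B t) (aone B)),
     asucc = (\<lambda>s t. tensor_op2 K M N (astar A) (asucc B) s t \<oplus>\<^bsub>tensor K M N\<^esub>
       pure_tensor K M N (eps_right K M B s \<rhd>\<^bsub>A\<^esub> eps_right K M B t) (aone B)),
     aeps = (\<lambda>t. aeps A (eps_right K M B t))\<rparr>"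

locale augmented_pair = A: augmented K M A + B: augmented K N B
  for K :: "('k, 'r) ring_scheme" and M :: "('k, 'a, 'm) module_scheme" and A
    and N :: "('k, 'b, 'n) module_scheme" and B
begin

sublocale tensor_product K M N
  by (rule tensor_product.intro) (rule A.module_axioms B.module_axioms)+

abbreviation "AB \<equiv> tensor_aug K M A N B"
abbreviation "\<rho> \<equiv> eps_right K M B"
abbreviation "lam \<equiv> eps_left K A N"

lemma rho_bilinear: "bilinear_map K M N M (\<lambda>x y. aeps B y \<odot>\<^bsub>M\<^esub> x)"
  by (rule bilinear_mapI)
    (simp_all add: B.aug_simps A.smult_l_distr A.smult_r_distr A.smult_assoc1[symmetric] A.R.m_comm)

lemma lam_bilinear: "bilinear_map K M N N (\<lambda>x y. aeps A x \<odot>\<^bsub>N\<^esub> y)"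
  by (rule bilinear_mapI)
    (simp_all add: A.aug_simps B.smult_l_distr B.smult_r_distr B.smult_assoc1[symmetric] A.R.m_comm)

lemma rho_linear: "linear_map K T M \<rho>"
  unfolding eps_right_def by (rule tensor_lift_linear[OF A.module_axioms rho_bilinear])

lemma lam_linear: "linear_map K T N lam"
  unfolding eps_left_def by (rule tensor_lift_linear[OF B.module_axioms lam_bilinear])

lemma rho_pure: "\<lbrakk>x \<in> carrier M; y \<in> carrier N\<rbrakk> \<Longrightarrow> \<rho> (pure x y) = aeps B y \<odot>\<^bsub>M\<^esub> x"
  unfolding eps_right_def by (rule tensor_lift_pure[OF A.module_axioms rho_bilinear])

lemma lam_pure: "\<lbrakk>x \<in> carrier M; y \<in> carrier N\<rbrakk> \<Longrightarrow> lam (pure x y) = aeps A x \<odot>\<^bsub>N\<^esub> y"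
  unfolding eps_left_def by (rule tensor_lift_pure[OF B.module_axioms lam_bilinear])

lemmas rho_simps = linear_mapD[OF rho_linear] rho_pure
lemmas lam_simps = linear_mapD[OF lam_linear] lam_pure

lemmas pure_zero = bilinear_map_zero[OF A.module_axioms B.module_axioms module_tensor pure_bilinear]

lemmas op_simps =
  bilinear_mapD[OF tensor_op2_bilinear[OF A.star_bilinear B.star_bilinear]]
  bilinear_mapD[OF tensor_op2_bilinear[OF A.star_bilinear B.prec_bilinear]]
  bilinear_mapD[OF tensor_op2_bilinear[OF A.star_bilinear B.succ_bilinear]]
  tensor_op2_pure[OF A.star_bilinear B.star_bilinear]
  tensor_op2_pure[OF A.star_bilinear B.prec_bilinear]
  tensor_op2_pure[OF A.star_bilinear B.succ_bilinear]

lemma star_pure: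
  "\<lbrakk>x \<in> carrier M; y \<in> carrier N; x' \<in> carrier M; y' \<in> carrier N\<rbrakk> \<Longrightarrow>
    pure x y \<star>\<^bsub>AB\<^esub> pure x' y' = pure (x \<star>\<^bsub>A\<^esub> x') (y \<star>\<^bsub>B\<^esub> y')"
  by (simp add: tensor_aug_def op_simps)

lemma prec_pure:
  "\<lbrakk>x \<in> carrier M; y \<in> carrier N; x' \<in> carrier M; y' \<in> carrier N\<rbrakk> \<Longrightarrow>
    pure x y \<lhd>\<^bsub>AB\<^esub> pure x' y' = pure (x \<star>\<^bsub>A\<^esub> x') (y \<lhd>\<^bsub>B\<^esub> y') \<oplus>\<^bsub>T\<^esub>
      (aeps B y \<otimes>\<^bsub>K\<^esub> aeps B y') \<odot>\<^bsub>T\<^esub> pure (x \<lhd>\<^bsub>A\<^esub> x') (aone B)"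
  by (simp add: tensor_aug_def op_simps rho_simps A.aug_simps B.aug_simps pure_simps
      module.smult_assoc1[OF module_tensor, symmetric] A.R.m_comm)

lemma succ_pure:
  "\<lbrakk>x \<in> carrier M; y \<in> carrier N; x' \<in> carrier M; y' \<in> carrier N\<rbrakk> \<Longrightarrow>
    pure x y \<rhd>\<^bsub>AB\<^esub> pure x' y' = pure (x \<star>\<^bsub>A\<^esub> x') (y \<rhd>\<^bsub>B\<^esub> y') \<oplus>\<^bsub>T\<^esub>
      (aeps B y \<otimes>\<^bsub>K\<^esub> aeps B y') \<odot>\<^bsub>T\<^esub> pure (x \<rhd>\<^bsub>A\<^esub> x') (aone B)"
  by (simp add: tensor_aug_def op_simps rho_simps A.aug_simps B.aug_simps pure_simps
      module.smult_assoc1[OF module_tensor, symmetric] A.R.m_comm)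

lemma eps_pure:
  "\<lbrakk>x \<in> carrier M; y \<in> carrier N\<rbrakk> \<Longrightarrow> aeps AB (pure x y) = aeps A x \<otimes>\<^bsub>K\<^esub> aeps B y"
  by (simp add: tensor_aug_def rho_simps A.aug_simps B.aug_simps A.R.m_comm)

lemma one_AB: "aone AB = pure (aone A) (aone B)"
  by (simp add: tensor_aug_def)

lemma tensor_star_bilinear: "bilinear_map K T T T (astar AB)"
  using tensor_op2_bilinear[OF A.star_bilinear B.star_bilinear]
  by (simp add: tensor_aug_def)

lemma tensor_prec_bilinear: "bilinear_map K T T T (aprec AB)"
  and tensor_succ_bilinear: "bilinear_map K T T T (asucc AB)"
proof -
  interpret T: module K T by (rule module_tensor)
  show "bilinear_map K T T T (aprec AB)" "bilinear_map K T T T (asucc AB)"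
    unfolding tensor_aug_def
    by (rule bilinear_mapI;
        simp add: op_simps rho_simps A.aug_simps B.aug_simps pure_simps T.smult_r_distr T.a_ac)+
qed

lemmas tensor_bilinears =
  bilinear_mapD[OF tensor_prec_bilinear] bilinear_mapD[OF tensor_succ_bilinear]
  bilinear_mapD[OF tensor_star_bilinear]
  bilinear_map_zero[OF module_tensor module_tensor module_tensor tensor_prec_bilinear]
  bilinear_map_zero[OF module_tensor module_tensor module_tensor tensor_succ_bilinear]
  bilinear_map_zero[OF module_tensor module_tensor module_tensor tensor_star_bilinear]

lemma tensor_eps:
  "t \<in> carrier T \<Longrightarrow> aeps AB t \<in> carrier K"
  "\<lbrakk>s \<in> carrier T; t \<in> carrier T\<rbrakk> \<Longrightarrow> aeps AB (s \<oplus>\<^bsub>T\<^esub> t) = aeps AB s \<oplus>\<^bsub>K\<^esub> aeps AB t"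
  "\<lbrakk>a \<in> carrier K; t \<in> carrier T\<rbrakk> \<Longrightarrow> aeps AB (a \<odot>\<^bsub>T\<^esub> t) = a \<otimes>\<^bsub>K\<^esub> aeps AB t"
  by (simp_all add: tensor_aug_def rho_simps A.aug_simps)

lemmas pure_AB = prec_pure succ_pure star_pure eps_pure pure_simps pure_zero
  A.aug_simps B.aug_simps

text \<open>On pure tensors each dendriform axiom splits in two. The main terms satisfy it by
  associativity on the left and the axiom on the right; the corrections satisfy it by the axiom on
  the left. Mixed terms vanish: \<epsilon> kills b \<prec> d and b \<succ> d, and 1 \<prec> f = b
  \<succ> 1 = 0.\<close>

theorem augmented_tensor: "augmented K T AB"
proof -
  interpret T: module K T by (rule module_tensor)
  note [simp] = tensor_bilinears tensor_eps one_AB pure_AB A.star_assoc A.eps_star B.eps_star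
    A.one_star A.star_one B.one_star B.star_one A.prec_prec B.prec_prec
    A.succ_prec B.succ_prec A.succ_succ B.succ_succ
  note sm = T.smult_assoc1[symmetric] T.smult_r_distr T.smult_l_distr
  show ?thesis
  proof (intro augmented.intro augmented_axioms.intro)
    fix s t assume st: "s \<in> carrier T" "t \<in> carrier T"
    show "aeps AB (s \<lhd>\<^bsub>AB\<^esub> t) = \<zero>\<^bsub>K\<^esub>"
      using st by (induction rule: tensor_induct2) simp_all
    show "aeps AB (s \<rhd>\<^bsub>AB\<^esub> t) = \<zero>\<^bsub>K\<^esub>"
      using st by (induction rule: tensor_induct2) simp_all
    show "s \<star>\<^bsub>AB\<^esub> t = s \<lhd>\<^bsub>AB\<^esub> t \<oplus>\<^bsub>T\<^esub> s \<rhd>\<^bsub>AB\<^esub> t \<oplus>\<^bsub>T\<^esub>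
        (aeps AB s \<otimes>\<^bsub>K\<^esub> aeps AB t) \<odot>\<^bsub>T\<^esub> aone AB"
      using st
    proof (induction rule: tensor_induct2)
      case (pure x y x' y')
      then show ?case
        by (simp add: B.star_eq A.star_eq[of x x'] sm T.a_ac A.R.m_ac)
    qed (simp_all add: sm A.R.l_distr A.R.r_distr T.a_ac)
  next
    fix t assume t: "t \<in> carrier T"
    show "aone AB \<lhd>\<^bsub>AB\<^esub> t = \<zero>\<^bsub>T\<^esub>"
      using t by (induction rule: tensor_induct) simp_all
    show "t \<rhd>\<^bsub>AB\<^esub> aone AB = \<zero>\<^bsub>T\<^esub>"
      using t by (induction rule: tensor_induct) simp_all
    have el: "linear_map K T T (\<lambda>t. aeps AB t \<odot>\<^bsub>T\<^esub> aone AB)"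
      by (rule linear_mapI) (simp_all add: sm)
    show "t \<lhd>\<^bsub>AB\<^esub> aone AB \<oplus>\<^bsub>T\<^esub> aeps AB t \<odot>\<^bsub>T\<^esub> aone AB = t"
    proof (rule linear_eqI[OF linear_map_plus[OF module_tensor
            bilinear_map_linear(2)[OF tensor_prec_bilinear] el] linear_map_id _ t])
      fix x y assume xy: "x \<in> carrier M" "y \<in> carrier N"
      \<comment> \<open>The unit is split off the right factor, and then off the left factor of the
        remaining x \<otimes> 1. The three resulting terms are the main term, the correction and the
        unit multiple.\<close>
      have "pure x y = pure x (y \<lhd>\<^bsub>B\<^esub> aone B) \<oplus>\<^bsub>T\<^esub> aeps B y \<odot>\<^bsub>T\<^esub> pure x (aone B)"
        using xy B.prec_one[of y] pure_simps(3,5) B.prec_simps(1) B.one_closed B.eps_closed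
        by (metis B.smult_closed)
      also have "pure x (aone B) = pure (x \<lhd>\<^bsub>A\<^esub> aone A \<oplus>\<^bsub>M\<^esub> aeps A x \<odot>\<^bsub>M\<^esub> aone A) (aone B)"
        using xy A.prec_one by (simp del: pure_simps(2,4))
      finally show "pure x y \<lhd>\<^bsub>AB\<^esub> aone AB \<oplus>\<^bsub>T\<^esub> aeps AB (pure x y) \<odot>\<^bsub>T\<^esub> aone AB = pure x y"
        using xy by (simp add: sm T.a_ac A.R.m_ac)
    qed simp
    show "aone AB \<rhd>\<^bsub>AB\<^esub> t \<oplus>\<^bsub>T\<^esub> aeps AB t \<odot>\<^bsub>T\<^esub> aone AB = t"
    proof (rule linear_eqI[OF linear_map_plus[OF module_tensor
            bilinear_map_linear(1)[OF tensor_succ_bilinear] el] linear_map_id _ t])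
      fix x y assume xy: "x \<in> carrier M" "y \<in> carrier N"
      have "pure x y = pure x (aone B \<rhd>\<^bsub>B\<^esub> y) \<oplus>\<^bsub>T\<^esub> aeps B y \<odot>\<^bsub>T\<^esub> pure x (aone B)"
        using xy B.one_succ[of y] pure_simps(3,5) B.succ_simps(1) B.one_closed B.eps_closed
        by (metis B.smult_closed)
      also have "pure x (aone B) = pure (aone A \<rhd>\<^bsub>A\<^esub> x \<oplus>\<^bsub>M\<^esub> aeps A x \<odot>\<^bsub>M\<^esub> aone A) (aone B)"
        using xy A.one_succ by (simp del: pure_simps(2,4))
      finally show "aone AB \<rhd>\<^bsub>AB\<^esub> pure x y \<oplus>\<^bsub>T\<^esub> aeps AB (pure x y) \<odot>\<^bsub>T\<^esub> aone AB = pure x y"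
        using xy by (simp add: sm T.a_ac A.R.m_ac)
    qed simp
  next
    fix r s t assume rst: "r \<in> carrier T" "s \<in> carrier T" "t \<in> carrier T"
    show "(r \<lhd>\<^bsub>AB\<^esub> s) \<lhd>\<^bsub>AB\<^esub> t = r \<lhd>\<^bsub>AB\<^esub> (s \<star>\<^bsub>AB\<^esub> t)"
      using rst by (induction rule: tensor_induct3) (simp_all add: sm A.R.m_ac)
    show "(r \<rhd>\<^bsub>AB\<^esub> s) \<lhd>\<^bsub>AB\<^esub> t = r \<rhd>\<^bsub>AB\<^esub> (s \<lhd>\<^bsub>AB\<^esub> t)"
      using rst by (induction rule: tensor_induct3) (simp_all add: sm A.R.m_ac)
    show "r \<rhd>\<^bsub>AB\<^esub> (s \<rhd>\<^bsub>AB\<^esub> t) = (r \<star>\<^bsub>AB\<^esub> s) \<rhd>\<^bsub>AB\<^esub> t"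
      using rst by (induction rule: tensor_induct3) (simp_all add: sm A.R.m_ac)
  qed (simp_all add: tensor_prec_bilinear tensor_succ_bilinear tensor_star_bilinear T.module_axioms)
qed

text \<open>The correction is what makes id \<otimes> \<epsilon> multiplicative: the main term dies
  because \<epsilon>(b \<prec> d) = 0, and the correction supplies \<epsilon>(b) \<epsilon>(d) (a
  \<prec> c).\<close>

lemma rho_hom: "aug_hom K T AB M A \<rho>"
proof -
  interpret T: module K T by (rule module_tensor)
  have "\<rho> (s \<lhd>\<^bsub>AB\<^esub> t) = \<rho> s \<lhd>\<^bsub>A\<^esub> \<rho> t" "\<rho> (s \<rhd>\<^bsub>AB\<^esub> t) = \<rho> s \<rhd>\<^bsub>A\<^esub> \<rho> t"
    if "s \<in> carrier T" "t \<in> carrier T" for s t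
    using that by (induction rule: tensor_induct2)
      (simp_all add: tensor_bilinears rho_simps pure_AB A.smult_assoc1[symmetric] A.R.m_ac)
  then show ?thesis
    by (simp add: aug_hom_def rho_linear one_AB rho_simps A.aug_simps B.aug_simps)
      (simp add: tensor_aug_def)
qed

text \<open>On this side the main term survives, as \<epsilon> is multiplicative for the star
  product, and the correction dies because \<epsilon>(a \<prec> c) = 0.\<close>

lemma lam_hom: "aug_hom K T AB N B lam"
proof -
  interpret T: module K T by (rule module_tensor)
  have "lam (s \<lhd>\<^bsub>AB\<^esub> t) = lam s \<lhd>\<^bsub>B\<^esub> lam t \<and> lam (s \<rhd>\<^bsub>AB\<^esub> t) = lam s \<rhd>\<^bsub>B\<^esub> lam t"
    if "s \<in> carrier T" "t \<in> carrier T" for s t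
    using that by (induction rule: tensor_induct2)
      (simp_all add: tensor_bilinears lam_simps pure_AB A.eps_star B.smult_assoc1[symmetric] A.R.m_ac)
  moreover have "aeps B (lam t) = aeps AB t" if "t \<in> carrier T" for t
    using that by (induction rule: tensor_induct)
      (simp_all add: tensor_eps lam_simps pure_AB)
  ultimately show ?thesis
    by (simp add: aug_hom_def lam_linear one_AB lam_simps A.aug_simps B.aug_simps)
qed

end

lemma bilinear_map_flip:
  "bilinear_map K M N P f \<Longrightarrow> bilinear_map K N M P (\<lambda>y x. f x y)"
  by (simp add: bilinear_map_def)

lemma (in tensor_product) tensor_map_linear:
  assumes "tensor_product K M' N'" "linear_map K M M' f" "linear_map K N N' g"
  shows "linear_map K T (tensor K M' N') (tensor_map K M' N' f g)"
    and "\<lbrakk>x \<in> carrier M; y \<in> carrier N\<rbrakk> \<Longrightarrow>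
      tensor_map K M' N' f g (pure x y) = pure_tensor K M' N' (f x) (g y)"
proof -
  interpret T': tensor_product K M' N' by fact
  have b: "bilinear_map K M N T'.T (\<lambda>x y. T'.pure (f x) (g y))"
    by (rule bilinear_mapI)
      (simp_all add: T'.pure_simps linear_mapD[OF assms(2)] linear_mapD[OF assms(3)])
  show "linear_map K T T'.T (tensor_map K M' N' f g)"
    using tensor_lift_linear[OF T'.module_tensor b] by (simp add: tensor_map_def)
  show "tensor_map K M' N' f g (pure x y) = T'.pure (f x) (g y)"
    if "x \<in> carrier M" "y \<in> carrier N"
    using tensor_lift_pure[OF T'.module_tensor b that] by (simp add: tensor_map_def)
qed

lemma (in augmented_pair) tensor_map_hom:
  assumes "augmented_pair K M' A' N' B'" "aug_hom K M A M' A' f" "aug_hom K N B N' B' g"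
  shows "aug_hom K T AB (tensor K M' N') (tensor_aug K M' A' N' B') (tensor_map K M' N' f g)"
proof -
  interpret T': augmented_pair K M' A' N' B' by fact
  interpret TT: augmented K T AB by (rule augmented_tensor)
  interpret TT': augmented K T'.T T'.AB by (rule T'.augmented_tensor)
  note f = aug_homD[OF assms(2)] linear_mapD[OF aug_homD(1)[OF assms(2)]]
    aug_hom_star[OF A.augmented_axioms T'.A.augmented_axioms assms(2)]
  note g = aug_homD[OF assms(3)] linear_mapD[OF aug_homD(1)[OF assms(3)]]
    aug_hom_star[OF B.augmented_axioms T'.B.augmented_axioms assms(3)]
  let ?h = "tensor_map K M' N' f g"
  note h = tensor_map_linear[OF T'.tensor_product_axioms f(1) g(1)]
  note [simp] = f g h(2) linear_mapD[OF h(1)] tensor_bilinears tensor_eps one_AB pure_AB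
    T'.tensor_bilinears T'.tensor_eps T'.one_AB T'.pure_AB
  have "?h (s \<lhd>\<^bsub>AB\<^esub> t) = ?h s \<lhd>\<^bsub>T'.AB\<^esub> ?h t \<and> ?h (s \<rhd>\<^bsub>AB\<^esub> t) = ?h s \<rhd>\<^bsub>T'.AB\<^esub> ?h t"
    if "s \<in> carrier T" "t \<in> carrier T" for s t
    using that by (induction rule: tensor_induct2) simp_all
  moreover have "aeps T'.AB (?h t) = aeps AB t" if "t \<in> carrier T" for t
    using that by (induction rule: tensor_induct) simp_all
  ultimately show ?thesis
    by (simp add: aug_hom_def h(1))
qed

subsection \<open>Associativity\<close>

context augmented
begin

context
begin

interpretation S: augmented_pair K M A M A
  by (intro augmented_pair.intro augmented_axioms)
interpretation L: augmented_pair K S.T S.AB M A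
  by (intro augmented_pair.intro augmented_axioms S.augmented_tensor)
interpretation R: augmented_pair K M A S.T S.AB
  by (intro augmented_pair.intro augmented_axioms S.augmented_tensor)

private abbreviation "inner z x y \<equiv> R.pure x (S.pure y z)"

private lemma inner_bilinear: "z \<in> carrier M \<Longrightarrow> bilinear_map K M M R.T (inner z)"
  by (rule bilinear_mapI) (simp_all add: R.pure_simps S.pure_simps)

private lemma outer_bilinear: "bilinear_map K S.T M R.T (\<lambda>t z. tensor_lift K R.T (inner z) t)"
  by (rule bilinear_map_flip,
      rule bilinear_tensor_lift[OF S.tensor_product_axioms R.module_tensor module_axioms inner_bilinear])
    (simp_all add: R.pure_simps S.pure_simps)

lemma assoc_linear: "linear_map K L.T R.T (tensor_assoc K M)"
  using L.tensor_lift_linear[OF R.module_tensor outer_bilinear]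
  by (simp add: tensor_assoc_def Let_def)

lemma assoc_pure:
  "\<lbrakk>x \<in> carrier M; y \<in> carrier M; z \<in> carrier M\<rbrakk> \<Longrightarrow>
    tensor_assoc K M (L.pure (S.pure x y) z) = R.pure x (S.pure y z)"
  by (simp add: tensor_assoc_def Let_def L.tensor_lift_pure[OF R.module_tensor outer_bilinear] S.pure_simps
      S.tensor_lift_pure[OF R.module_tensor inner_bilinear])

text \<open>Up to rebracketing, both iterated structures multiply x \<otimes> y \<otimes> z and x'
  \<otimes> y' \<otimes> z' to the same three terms: (x * x') \<otimes> (y * y') \<otimes> (z
  \<prec> z'), then \<epsilon>(z) \<epsilon>(z') (x * x') \<otimes> (y \<prec> y') \<otimes> 1, then
  \<epsilon>(y) \<epsilon>(y') \<epsilon>(z) \<epsilon>(z') (x \<prec> x') \<otimes> 1 \<otimes> 1;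
  likewise for \<succ>.\<close>

lemma assoc_hom: "aug_hom K L.T L.AB R.T R.AB (tensor_assoc K M)"
proof -
  interpret ST: augmented K S.T S.AB by (rule S.augmented_tensor)
  interpret LT: augmented K L.T L.AB by (rule L.augmented_tensor)
  interpret RT: augmented K R.T R.AB by (rule R.augmented_tensor)
  let ?h = "tensor_assoc K M"
  note lin = linear_mapD[OF assoc_linear]
  note [simp] = lin assoc_pure S.one_AB S.pure_AB L.one_AB L.pure_AB R.one_AB R.pure_AB
    S.tensor_eps L.tensor_eps R.tensor_eps
    S.tensor_bilinears L.tensor_bilinears R.tensor_bilinears
  have hom_pure: "?h (L.pure u z \<lhd>\<^bsub>L.AB\<^esub> L.pure u' z') = ?h (L.pure u z) \<lhd>\<^bsub>R.AB\<^esub> ?h (L.pure u' z') \<and>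
      ?h (L.pure u z \<rhd>\<^bsub>L.AB\<^esub> L.pure u' z') = ?h (L.pure u z) \<rhd>\<^bsub>R.AB\<^esub> ?h (L.pure u' z')"
    if z: "z \<in> carrier M" "z' \<in> carrier M" and u: "u \<in> carrier S.T" "u' \<in> carrier S.T" for u u' z z'
    using u
  proof (induction rule: S.tensor_induct2)
    case (pure x y x' y')
    then show ?case using z
      by (simp add: LT.smult_assoc1[symmetric] RT.smult_assoc1[symmetric] RT.smult_r_distr
          LT.smult_r_distr R.m_ac RT.a_ac)
  \<comment> \<open>In the sum cases the induction hypotheses speak of unexpanded products of pure
    tensors, so the expansion rules are switched off.\<close>
  qed (use z in \<open>simp_all del: L.prec_pure L.succ_pure\<close>)
  have "?h (s \<lhd>\<^bsub>L.AB\<^esub> t) = ?h s \<lhd>\<^bsub>R.AB\<^esub> ?h t \<and> ?h (s \<rhd>\<^bsub>L.AB\<^esub> t) = ?h s \<rhd>\<^bsub>R.AB\<^esub> ?h t"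
    if "s \<in> carrier L.T" "t \<in> carrier L.T" for s t
    using that
  proof (induction rule: L.tensor_induct2)
    case (pure u z u' z')
    then show ?case by (intro hom_pure)
  qed simp_all
  moreover have eps_hom_pure: "aeps R.AB (?h (L.pure u z)) = aeps L.AB (L.pure u z)"
    if "z \<in> carrier M" "u \<in> carrier S.T" for u z
    using that(2)
    by (induction rule: S.tensor_induct) (use that(1) in \<open>simp_all add: R.l_distr R.m_ac\<close>)
  moreover have "aeps R.AB (?h t) = aeps L.AB t" if "t \<in> carrier L.T" for t
    using that by (induction rule: L.tensor_induct) (simp_all add: eps_hom_pure del: L.eps_pure)
  ultimately show ?thesis
    by (simp add: aug_hom_def assoc_linear)
qed

end

end

section \<open>Braces of primitive elements\<close>

context abelian_monoid
begin

lemma finsum_swap: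
  assumes "finite A" "finite B" "\<And>i j. \<lbrakk>i \<in> A; j \<in> B\<rbrakk> \<Longrightarrow> f i j \<in> carrier G"
  shows "(\<Oplus>i\<in>A. \<Oplus>j\<in>B. f i j) = (\<Oplus>j\<in>B. \<Oplus>i\<in>A. f i j)"
  using assms(1,3)
proof (induction A rule: finite_induct)
  case (insert x A)
  have "(\<Oplus>j\<in>B. \<Oplus>i\<in>insert x A. f i j) = (\<Oplus>j\<in>B. f x j \<oplus> (\<Oplus>i\<in>A. f i j))"
    by (rule finsum_cong') (use insert in \<open>auto simp: Pi_def\<close>)
  also have "\<dots> = (\<Oplus>j\<in>B. f x j) \<oplus> (\<Oplus>j\<in>B. \<Oplus>i\<in>A. f i j)"
    by (rule finsum_addf) (use insert.prems in \<open>auto simp: Pi_def\<close>)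
  also have "\<dots> = (\<Oplus>i\<in>insert x A. \<Oplus>j\<in>B. f i j)"
    using insert by (simp add: Pi_def)
  finally show ?case by simp
qed simp

text \<open>With \<open>finsum_atMost_shift\<close>, pads sums with zeros to a range independent of
  the other indices, so that sums can be interchanged.\<close>

lemma finsum_atMost_restrict:
  fixes n :: nat
  assumes "i \<le> n" "\<And>j. j \<le> i \<Longrightarrow> f j \<in> carrier G"
  shows "(\<Oplus>j\<in>{..i}. f j) = (\<Oplus>j\<in>{..n}. if j \<le> i then f j else \<zero>)"
  by (rule add.finprod_mono_neutral_cong_left) (use assms in auto)

lemma finsum_atMost_shift:
  fixes n :: nat
  assumes "i \<le> n" "\<And>m. \<lbrakk>i \<le> m; m \<le> n\<rbrakk> \<Longrightarrow> f m \<in> carrier G"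
  shows "(\<Oplus>k\<in>{..n - i}. f (i + k)) = (\<Oplus>m\<in>{..n}. if i \<le> m then f m else \<zero>)"
proof -
  have im: "(+) i ` {..n - i} = {i..n}"
    using assms(1) by (simp add: atMost_atLeast0)
  have "(\<Oplus>k\<in>{..n - i}. f (i + k)) = (\<Oplus>m\<in>(+) i ` {..n - i}. f m)"
    by (rule finsum_reindex[symmetric]) (use assms in auto)
  also have "\<dots> = (\<Oplus>m\<in>{..n}. if i \<le> m then f m else \<zero>)"
    unfolding im by (rule add.finprod_mono_neutral_cong_left) (use assms in auto)
  finally show ?thesis .
qed

end

text \<open>The comb \<open>nearrow\<close> started from the unit, so that the empty list gives 1.
  On elements with \<epsilon> = 0 both agree for nonempty lists, since x \<prec> 1 = x;
  \<open>right_comb\<close> relates to \<open>searrow\<close> in the same way through 1 \<succ> x =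
  x. Absent factors in a brace term then need no case distinction.\<close>

definition left_comb :: "('k, 'a) aug_ops \<Rightarrow> 'a list \<Rightarrow> 'a"
  where "left_comb A ys = foldr (aprec A) ys (aone A)"

definition right_comb :: "('k, 'a) aug_ops \<Rightarrow> 'a list \<Rightarrow> 'a"
  where "right_comb A ys = foldl (asucc A) (aone A) ys"

definition aug_arrow :: "('k, 'a) aug_ops \<Rightarrow> 'a list \<Rightarrow> 'a \<Rightarrow> 'a list \<Rightarrow> 'a"
  where "aug_arrow A us x vs = (left_comb A us \<rhd>\<^bsub>A\<^esub> x) \<lhd>\<^bsub>A\<^esub> right_comb A vs"

abbreviation alt_sign :: "('k, 'r) ring_scheme \<Rightarrow> nat \<Rightarrow> 'k"
  where "alt_sign K i \<equiv> (\<ominus>\<^bsub>K\<^esub> \<one>\<^bsub>K\<^esub>) [^]\<^bsub>K\<^esub> i"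

definition aug_brace ::
  "('k, 'r) ring_scheme \<Rightarrow> ('k, 'a, 'm) module_scheme \<Rightarrow> ('k, 'a) aug_ops \<Rightarrow> 'a \<Rightarrow> 'a list \<Rightarrow> 'a"
  where "aug_brace K M A x ys =
    (\<Oplus>\<^bsub>M\<^esub>i\<in>{..length ys}. alt_sign K i \<odot>\<^bsub>M\<^esub> aug_arrow A (take i ys) x (drop i ys))"

lemma left_comb_simps [simp]:
  "left_comb A [] = aone A"
  "left_comb A (y # ys) = y \<lhd>\<^bsub>A\<^esub> left_comb A ys"
  by (simp_all add: left_comb_def)

lemma right_comb_simps [simp]:
  "right_comb A [] = aone A"
  "right_comb A (ys @ [y]) = right_comb A ys \<rhd>\<^bsub>A\<^esub> y"
  by (simp_all add: right_comb_def)

lemma set_take_drop_subset: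
  "set xs \<subseteq> S \<Longrightarrow> set (take i xs) \<subseteq> S" "set xs \<subseteq> S \<Longrightarrow> set (drop i xs) \<subseteq> S"
  using set_take_subset[of i xs] set_drop_subset[of i xs] by auto

section \<open>The antipode identity for combs\<close>

context augmented
begin

definition aug_ker :: "'a set"
  where "aug_ker = {x \<in> carrier M. aeps A x = \<zero>\<^bsub>K\<^esub>}"

lemma aug_kerD: "x \<in> aug_ker \<Longrightarrow> x \<in> carrier M" "x \<in> aug_ker \<Longrightarrow> aeps A x = \<zero>\<^bsub>K\<^esub>"
  by (simp_all add: aug_ker_def)

lemma aug_ker_subset: "set ys \<subseteq> aug_ker \<Longrightarrow> set ys \<subseteq> carrier M"
  by (auto simp: aug_ker_def)

lemma left_comb_closed: "set ys \<subseteq> carrier M \<Longrightarrow> left_comb A ys \<in> carrier M"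
  by (induction ys) (simp_all add: aug_simps)

lemma right_comb_closed: "set ys \<subseteq> carrier M \<Longrightarrow> right_comb A ys \<in> carrier M"
  by (induction ys rule: rev_induct) (simp_all add: aug_simps)

lemma eps_left_comb: "\<lbrakk>set ys \<subseteq> carrier M; ys \<noteq> []\<rbrakk> \<Longrightarrow> aeps A (left_comb A ys) = \<zero>\<^bsub>K\<^esub>"
  by (cases ys) (simp_all add: aug_simps left_comb_closed)

lemma eps_right_comb: "\<lbrakk>set ys \<subseteq> carrier M; ys \<noteq> []\<rbrakk> \<Longrightarrow> aeps A (right_comb A ys) = \<zero>\<^bsub>K\<^esub>"
  by (cases ys rule: rev_cases) (simp_all add: aug_simps right_comb_closed)

lemma aug_arrow_closed:
  "\<lbrakk>set us \<subseteq> carrier M; x \<in> carrier M; set vs \<subseteq> carrier M\<rbrakk> \<Longrightarrow> aug_arrow A us x vs \<in> carrier M"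
  by (simp add: aug_arrow_def aug_simps left_comb_closed right_comb_closed)

lemmas comb_closed = left_comb_closed right_comb_closed aug_arrow_closed

lemma alt_sign_closed: "alt_sign K i \<in> carrier K"
  by simp

text \<open>Signed left combs are convolution inverse to right combs with respect to
  deconcatenation. The star product is split into \<prec> and \<succ>: in the first half the first
  letter y factors out on the left, in the second half the last letter y' factors out on the right,
  each leaving the same sum for a list shorter by one. Hence the induction on the length.\<close>

lemma antipode:
  assumes "set zs \<subseteq> aug_ker"
  shows "(\<Oplus>\<^bsub>M\<^esub>i\<in>{..length zs}. alt_sign K i \<odot>\<^bsub>M\<^esub> (left_comb A (take i zs) \<star>\<^bsub>A\<^esub> right_comb A (drop i zs)))
    = (if zs = [] then aone A else \<zero>\<^bsub>M\<^esub>)"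
    (is "?S zs = _")
  using assms
proof (induction zs rule: length_induct)
  case (1 zs)
  show ?case
  proof (cases "zs = []")
    case True
    then show ?thesis by (simp add: one_star aug_simps)
  next
    case False
    then obtain y ys where y: "zs = y # ys" by (cases zs) auto
    from False obtain ys' y' where y': "zs = ys' @ [y']" by (cases zs rule: rev_cases) auto
    define m where "m = length ys"
    have len: "length zs = Suc m" "length ys = m" "length ys' = m"
      using y y' by (simp_all add: m_def) (metis length_append_singleton length_Cons Suc_inject)
    have zs: "set zs \<subseteq> carrier M" using 1 aug_ker_subset by blast
    have ys: "y \<in> carrier M" "y' \<in> carrier M" "set ys \<subseteq> carrier M" "set ys' \<subseteq> carrier M"
      using zs[unfolded y] zs[unfolded y'] by simp_all
    note cl = comb_closed set_take_drop_subset[OF zs] set_take_drop_subset[OF ys(3)]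
      set_take_drop_subset[OF ys(4)] ys zs star_simps(1) prec_simps(1) succ_simps(1)
    let ?p = "\<lambda>i. alt_sign K i \<odot>\<^bsub>M\<^esub> (left_comb A (take i zs) \<lhd>\<^bsub>A\<^esub> right_comb A (drop i zs))"
    let ?q = "\<lambda>i. alt_sign K i \<odot>\<^bsub>M\<^esub> (left_comb A (take i zs) \<rhd>\<^bsub>A\<^esub> right_comb A (drop i zs))"
    let ?t = "\<lambda>ys i. alt_sign K i \<odot>\<^bsub>M\<^esub> (left_comb A (take i ys) \<star>\<^bsub>A\<^esub> right_comb A (drop i ys))"
    have "?S zs = (\<Oplus>\<^bsub>M\<^esub>i\<in>{..Suc m}. ?p i \<oplus>\<^bsub>M\<^esub> ?q i)"
      unfolding len
    proof (rule M.finsum_cong'[OF refl])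
      fix i assume i: "i \<in> {..Suc m}"
      \<comment> \<open>At least one comb is nonempty and so has \<epsilon> = 0; the unit multiple
        in \<open>star_eq\<close> drops out.\<close>
      have "take i zs \<noteq> [] \<or> drop i zs \<noteq> []" using y by (cases i) auto
      then have "aeps A (left_comb A (take i zs)) \<otimes>\<^bsub>K\<^esub> aeps A (right_comb A (drop i zs)) = \<zero>\<^bsub>K\<^esub>"
        by (auto simp: eps_left_comb eps_right_comb cl eps_closed)
      then show "?t zs i = ?p i \<oplus>\<^bsub>M\<^esub> ?q i"
        by (simp add: star_eq cl one_closed smult_r_distr)
    qed (simp add: cl)
    also have "\<dots> = (\<Oplus>\<^bsub>M\<^esub>i\<in>{..Suc m}. ?p i) \<oplus>\<^bsub>M\<^esub> (\<Oplus>\<^bsub>M\<^esub>i\<in>{..Suc m}. ?q i)"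
      by (rule M.finsum_addf) (simp_all add: cl)
    also have "(\<Oplus>\<^bsub>M\<^esub>i\<in>{..Suc m}. ?p i) = \<ominus>\<^bsub>M\<^esub> (y \<lhd>\<^bsub>A\<^esub> ?S ys)"
    proof -
      have "(\<Oplus>\<^bsub>M\<^esub>i\<in>{..Suc m}. ?p i) = (\<Oplus>\<^bsub>M\<^esub>i\<in>{..m}. ?p (Suc i)) \<oplus>\<^bsub>M\<^esub> ?p 0"
        by (rule M.finsum_Suc2) (simp add: cl)
      \<comment> \<open>The left comb is 1 here, and 1 \<prec> _ = 0. In the other summands y comes
        out by (y \<prec> L) \<prec> R = y \<prec> (L * R), and the index shift produces the minus
        sign.\<close>
      also have "?p 0 = \<zero>\<^bsub>M\<^esub>" by (simp add: cl one_prec)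
      also have "(\<Oplus>\<^bsub>M\<^esub>i\<in>{..m}. ?p (Suc i)) = (\<Oplus>\<^bsub>M\<^esub>i\<in>{..m}. (\<ominus>\<^bsub>K\<^esub> \<one>\<^bsub>K\<^esub>) \<odot>\<^bsub>M\<^esub> (y \<lhd>\<^bsub>A\<^esub> ?t ys i))"
        by (rule M.finsum_cong')
          (simp_all add: cl y prec_prec prec_simps smult_assoc1[symmetric] R.m_comm)
      also have "\<dots> = (\<ominus>\<^bsub>K\<^esub> \<one>\<^bsub>K\<^esub>) \<odot>\<^bsub>M\<^esub> (\<Oplus>\<^bsub>M\<^esub>i\<in>{..m}. y \<lhd>\<^bsub>A\<^esub> ?t ys i)"
        by (rule finsum_smult_ldistr[symmetric]) (simp_all add: cl)
      also have "(\<Oplus>\<^bsub>M\<^esub>i\<in>{..m}. y \<lhd>\<^bsub>A\<^esub> ?t ys i) = y \<lhd>\<^bsub>A\<^esub> ?S ys"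
        unfolding len
        by (rule linear_map_finsum[symmetric, OF module_axioms module_axioms
            bilinear_map_linear(1)[OF prec_bilinear ys(1)]]) (simp add: cl)
      finally show ?thesis by (simp add: cl smult_l_minus)
    qed
    also have "(\<Oplus>\<^bsub>M\<^esub>i\<in>{..Suc m}. ?q i) = ?S ys' \<rhd>\<^bsub>A\<^esub> y'"
    proof -
      have "(\<Oplus>\<^bsub>M\<^esub>i\<in>{..Suc m}. ?q i) = ?q (Suc m) \<oplus>\<^bsub>M\<^esub> (\<Oplus>\<^bsub>M\<^esub>i\<in>{..m}. ?q i)"
        by (rule M.finsum_Suc) (simp add: cl)
      \<comment> \<open>The right comb is 1 here, and _ \<succ> 1 = 0. In the other summands y'
        comes out by L \<succ> (R \<succ> y') = (L * R) \<succ> y'.\<close>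
      also have "?q (Suc m) = \<zero>\<^bsub>M\<^esub>" using len by (simp add: cl succ_one)
      also have "(\<Oplus>\<^bsub>M\<^esub>i\<in>{..m}. ?q i) = (\<Oplus>\<^bsub>M\<^esub>i\<in>{..m}. ?t ys' i \<rhd>\<^bsub>A\<^esub> y')"
        by (rule M.finsum_cong')
          (simp_all add: cl y' len succ_succ succ_simps)
      also have "\<dots> = ?S ys' \<rhd>\<^bsub>A\<^esub> y'"
        unfolding len
        by (rule linear_map_finsum[symmetric, OF module_axioms module_axioms
            bilinear_map_linear(2)[OF succ_bilinear ys(2)]]) (simp add: cl)
      finally show ?thesis by (simp add: cl)
    qed
    also have "\<ominus>\<^bsub>M\<^esub> (y \<lhd>\<^bsub>A\<^esub> ?S ys) \<oplus>\<^bsub>M\<^esub> ?S ys' \<rhd>\<^bsub>A\<^esub> y' = \<zero>\<^bsub>M\<^esub>"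
    proof -
      have "?S ys = (if ys = [] then aone A else \<zero>\<^bsub>M\<^esub>)" "?S ys' = (if ys' = [] then aone A else \<zero>\<^bsub>M\<^esub>)"
        proof -
        have "length ys < length zs" "length ys' < length zs" using len by simp_all
        moreover have "set ys \<subseteq> aug_ker" using 1(2) unfolding y by simp
        moreover have "set ys' \<subseteq> aug_ker" using 1(2) unfolding y' by simp
        ultimately show "?S ys = (if ys = [] then aone A else \<zero>\<^bsub>M\<^esub>)"
          "?S ys' = (if ys' = [] then aone A else \<zero>\<^bsub>M\<^esub>)"
          using 1(1) by blast+
      qed
      moreover have "ys = [] \<longleftrightarrow> ys' = []" using len by auto
      \<comment> \<open>For a single letter both shorter sums are 1 rather than 0, and the two
        halves cancel: y \<prec> 1 = y = 1 \<succ> y.\<close>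
      moreover have "y = y'" if "ys = []" using that y y' by auto
      moreover have "y \<in> aug_ker" using 1(2) y by simp
      ultimately show ?thesis
        by (auto simp: ys succ_simps prec_simps prec_one_ker one_succ_ker aug_kerD M.l_neg)
    qed
    finally show ?thesis using False by simp
  qed
qed

end

section \<open>Homomorphisms preserve combs and braces\<close>

lemma aug_hom_comb:
  assumes "augmented K M A" "aug_hom K M A N B f" "set ys \<subseteq> carrier M"
  shows "f (left_comb A ys) = left_comb B (map f ys)"
    and "f (right_comb A ys) = right_comb B (map f ys)"
proof -
  interpret augmented K M A by fact
  note f = aug_homD[OF assms(2)]
  show "f (left_comb A ys) = left_comb B (map f ys)"
    using assms(3) by (induction ys) (simp_all add: f left_comb_closed)
  show "f (right_comb A ys) = right_comb B (map f ys)"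
    using assms(3) by (induction ys rule: rev_induct) (simp_all add: f right_comb_closed)
qed

text \<open>Applied twice later on: to the projection onto the enveloping algebra and to the map
  that becomes its coproduct.\<close>

lemma aug_hom_brace:
  assumes "augmented K M A" "module K N" "aug_hom K M A N B f" "set ys \<subseteq> carrier M" "x \<in> carrier M"
  shows "f (aug_brace K M A x ys) = aug_brace K N B (f x) (map f ys)"
proof -
  interpret augmented K M A by fact
  interpret N: module K N by fact
  note f = aug_homD[OF assms(3)] linear_mapD[OF aug_homD(1)[OF assms(3)]]
    and s = set_take_drop_subset[OF assms(4)]
  have "f (aug_brace K M A x ys) =
      (\<Oplus>\<^bsub>N\<^esub>i\<in>{..length ys}. f (alt_sign K i \<odot>\<^bsub>M\<^esub> aug_arrow A (take i ys) x (drop i ys)))"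
    unfolding aug_brace_def
    by (rule linear_map_finsum[OF module_axioms assms(2) f(1)]) (simp add: comb_closed s assms(5))
  also have "\<dots> = aug_brace K N B (f x) (map f ys)"
    unfolding aug_brace_def length_map
  proof (rule N.finsum_cong'[OF refl])
    have arrow: "f (aug_arrow A (take i ys) x (drop i ys)) =
        aug_arrow B (take i (map f ys)) (f x) (drop i (map f ys))" for i
      using aug_hom_comb[OF assms(1,3)] assms(5) s
      by (simp add: aug_arrow_def f comb_closed succ_simps take_map drop_map)
    have "aug_arrow B (take i (map f ys)) (f x) (drop i (map f ys)) \<in> carrier N" for i
      unfolding arrow[symmetric] by (simp add: f comb_closed s assms(5))
    then show "(\<lambda>i. alt_sign K i \<odot>\<^bsub>N\<^esub> aug_arrow B (take i (map f ys)) (f x) (drop i (map f ys)))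
        \<in> {..length ys} \<rightarrow> carrier N"
      by simp
    show "f (alt_sign K i \<odot>\<^bsub>M\<^esub> aug_arrow A (take i ys) x (drop i ys)) =
        alt_sign K i \<odot>\<^bsub>N\<^esub> aug_arrow B (take i (map f ys)) (f x) (drop i (map f ys))" for i
      by (simp add: f comb_closed s assms(5) arrow)
  qed
  finally show ?thesis .
qed


section \<open>Combs and braces of primitive elements in the tensor square\<close>

context augmented
begin

context
begin

interpretation S: augmented_pair K M A M A
  by (intro augmented_pair.intro augmented_axioms)
interpretation SA: augmented K S.T S.AB
  by (rule S.augmented_tensor)

abbreviation (input) prim :: "'a \<Rightarrow> ('a \<times> 'a \<Rightarrow> 'k) set"
  where "prim x \<equiv> pure_tensor K M M x (aone A) \<oplus>\<^bsub>tensor K M M\<^esub> pure_tensor K M M (aone A) x"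

lemma prim_closed: "x \<in> carrier M \<Longrightarrow> prim x \<in> carrier S.T"
  by (simp add: S.pure_simps one_closed)

lemma prim_linear: "linear_map K M S.T prim"
  by (rule linear_mapI) (simp_all add: S.pure_simps one_closed SA.a_ac SA.smult_r_distr)

lemma eps_prim: "x \<in> aug_ker \<Longrightarrow> aeps S.AB (prim x) = \<zero>\<^bsub>K\<^esub>"
  by (simp add: S.tensor_eps S.pure_AB aug_kerD)

lemma rho_prim: "x \<in> aug_ker \<Longrightarrow> S.\<rho> (prim x) = x"
  by (simp add: S.rho_simps S.pure_AB aug_kerD)

lemma map_rho_prim: "set ys \<subseteq> aug_ker \<Longrightarrow> map S.\<rho> (map prim ys) = ys"
  by (induction ys) (simp_all add: rho_prim)

lemma map_prim_closed: "set ys \<subseteq> carrier M \<Longrightarrow> set (map prim ys) \<subseteq> carrier S.T"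
  using prim_closed by auto

abbreviation (input) "op_prec \<equiv> tensor_op2 K M M (astar A) (aprec A)"
abbreviation (input) "op_succ \<equiv> tensor_op2 K M M (astar A) (asucc A)"

lemmas op_prec_bilinear = S.tensor_op2_bilinear[OF star_bilinear prec_bilinear]
lemmas op_succ_bilinear = S.tensor_op2_bilinear[OF star_bilinear succ_bilinear]

text \<open>Of the four terms two contain 1 \<prec> _ and vanish: the main term of x \<otimes> 1 and
  the correction of 1 \<otimes> x. The mirror image \<open>succ_prim\<close> uses _ \<succ> 1 =
  0.\<close>

lemma prim_prec:
  assumes "x \<in> carrier M" "t \<in> carrier S.T"
  shows "prim x \<lhd>\<^bsub>S.AB\<^esub> t = op_prec (S.pure (aone A) x) t \<oplus>\<^bsub>S.T\<^esub> S.pure (x \<lhd>\<^bsub>A\<^esub> S.\<rho> t) (aone A)"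
  using assms(2)
proof (induction rule: S.tensor_induct)
  case (pure a b)
  then show ?case
    using assms(1)
    by (simp add: S.tensor_bilinears S.pure_AB S.op_simps S.rho_simps SA.a_ac)
qed (use assms(1) in \<open>simp_all add: S.tensor_bilinears S.op_simps S.rho_simps S.pure_simps aug_simps SA.a_ac\<close>)

lemma succ_prim:
  assumes "x \<in> carrier M" "t \<in> carrier S.T"
  shows "t \<rhd>\<^bsub>S.AB\<^esub> prim x = op_succ t (S.pure (aone A) x) \<oplus>\<^bsub>S.T\<^esub> S.pure (S.\<rho> t \<rhd>\<^bsub>A\<^esub> x) (aone A)"
  using assms(2)
proof (induction rule: S.tensor_induct)
  case (pure a b)
  then show ?case
    using assms(1)
    by (simp add: S.tensor_bilinears S.pure_AB S.op_simps S.rho_simps SA.a_ac)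
next
  case (add s t)
  have "(s \<oplus>\<^bsub>S.T\<^esub> t) \<rhd>\<^bsub>S.AB\<^esub> prim x = s \<rhd>\<^bsub>S.AB\<^esub> prim x \<oplus>\<^bsub>S.T\<^esub> t \<rhd>\<^bsub>S.AB\<^esub> prim x"
    by (rule bilinear_mapD(2)[OF S.tensor_succ_bilinear add.hyps prim_closed[OF assms(1)]])
  then show ?case
    using add.hyps assms(1) unfolding add.IH
    by (simp add: S.op_simps S.rho_simps S.pure_simps aug_simps SA.a_ac)
qed

lemma pure_one_prec:
  assumes "w \<in> carrier M" "t \<in> carrier S.T"
  shows "op_prec (S.pure w (aone A)) t = \<zero>\<^bsub>S.T\<^esub>"
  using assms(2)
  by (induction rule: S.tensor_induct) (use assms(1) in \<open>simp_all add: S.op_simps S.pure_AB\<close>)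

text \<open>By \<open>prim_prec\<close>, a new first letter y is put in front of every right factor,
  and one new term with the whole comb on the left appears. So the coproduct is deconcatenation with
  the tail in the left factor.\<close>

lemma left_comb_prim:
  assumes "set ys \<subseteq> aug_ker"
  shows "left_comb S.AB (map prim ys) =
    (\<Oplus>\<^bsub>S.T\<^esub>k\<in>{..length ys}. S.pure (left_comb A (drop k ys)) (left_comb A (take k ys)))"
  using assms
proof (induction ys)
  case Nil
  then show ?case by (simp add: S.one_AB S.pure_simps one_closed)
next
  case (Cons y ys)
  then have y: "y \<in> carrier M" "aeps A y = \<zero>\<^bsub>K\<^esub>" and ys: "set ys \<subseteq> aug_ker" "set ys \<subseteq> carrier M"
    by (auto dest: aug_kerD)
  note s = comb_closed set_take_drop_subset[OF ys(2)] ys y S.pure_simps(1) one_closed prec_simps(1)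
  let ?n = "length ys"
  let ?f = "\<lambda>k. S.pure (left_comb A (drop k (y # ys))) (left_comb A (take k (y # ys)))"
  have fcl: "?f k \<in> carrier S.T" for k by (cases k) (simp_all add: s)
  have IH: "left_comb S.AB (map prim ys) =
      (\<Oplus>\<^bsub>S.T\<^esub>k\<in>{..?n}. S.pure (left_comb A (drop k ys)) (left_comb A (take k ys)))"
    using Cons ys by simp
  have L: "left_comb S.AB (map prim ys) \<in> carrier S.T"
    using SA.left_comb_closed map_prim_closed ys(2) by blast
  \<comment> \<open>Since id \<otimes> \<epsilon> is a homomorphism and undoes \<open>prim\<close>,
    it recovers the comb itself; this evaluates the correction term.\<close>
  have rho: "S.\<rho> (left_comb S.AB (map prim ys)) = left_comb A ys"
    using aug_hom_comb(1)[OF SA.augmented_axioms S.rho_hom map_prim_closed[OF ys(2)]]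
      map_rho_prim[OF ys(1)] by simp
  have "left_comb S.AB (map prim (y # ys)) = op_prec (S.pure (aone A) y) (left_comb S.AB (map prim ys))
      \<oplus>\<^bsub>S.T\<^esub> S.pure (y \<lhd>\<^bsub>A\<^esub> left_comb A ys) (aone A)"
    using prim_prec[OF y(1) L] by (simp add: rho)
  also have "op_prec (S.pure (aone A) y) (left_comb S.AB (map prim ys)) =
      (\<Oplus>\<^bsub>S.T\<^esub>k\<in>{..?n}. op_prec (S.pure (aone A) y)
        (S.pure (left_comb A (drop k ys)) (left_comb A (take k ys))))"
    unfolding IH
    by (rule linear_map_finsum[OF S.module_tensor S.module_tensor
          bilinear_map_linear(1)[OF op_prec_bilinear]]) (simp_all add: s)
  also have "\<dots> = (\<Oplus>\<^bsub>S.T\<^esub>k\<in>{..?n}. ?f (Suc k))"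
    by (rule SA.finsum_cong') (simp_all add: s S.op_simps one_star)
  also have "S.pure (y \<lhd>\<^bsub>A\<^esub> left_comb A ys) (aone A) = ?f 0" by simp
  also have "(\<Oplus>\<^bsub>S.T\<^esub>k\<in>{..?n}. ?f (Suc k)) \<oplus>\<^bsub>S.T\<^esub> ?f 0 = (\<Oplus>\<^bsub>S.T\<^esub>k\<in>{..Suc ?n}. ?f k)"
    by (rule SA.finsum_Suc2[symmetric]) (use fcl in simp)
  finally show ?case by simp
qed

text \<open>Deconcatenation as for left combs, but now the initial segment lands in the left factor,
  because the last letter y is appended to the right factors.\<close>

lemma right_comb_prim:
  assumes "set ys \<subseteq> aug_ker"
  shows "right_comb S.AB (map prim ys) =
    (\<Oplus>\<^bsub>S.T\<^esub>k\<in>{..length ys}. S.pure (right_comb A (take k ys)) (right_comb A (drop k ys)))"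
  using assms
proof (induction ys rule: rev_induct)
  case Nil
  then show ?case by (simp add: S.one_AB S.pure_simps one_closed)
next
  case (snoc y ys)
  then have y: "y \<in> carrier M" "aeps A y = \<zero>\<^bsub>K\<^esub>" "y \<in> aug_ker"
    and ys: "set ys \<subseteq> aug_ker" "set ys \<subseteq> carrier M"
    by (auto dest: aug_kerD)
  note s = comb_closed set_take_drop_subset[OF ys(2)] ys y S.pure_simps(1) one_closed succ_simps(1)
  let ?n = "length ys"
  let ?f = "\<lambda>k. S.pure (right_comb A (take k (ys @ [y]))) (right_comb A (drop k (ys @ [y])))"
  have fcl: "?f k \<in> carrier S.T" if "k \<le> Suc ?n" for k
    using that by (cases "k = Suc ?n") (simp_all add: s)
  have IH: "right_comb S.AB (map prim ys) =
      (\<Oplus>\<^bsub>S.T\<^esub>k\<in>{..?n}. S.pure (right_comb A (take k ys)) (right_comb A (drop k ys)))"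
    using snoc ys by simp
  have L: "right_comb S.AB (map prim ys) \<in> carrier S.T"
    using SA.right_comb_closed map_prim_closed ys(2) by blast
  have rho: "S.\<rho> (right_comb S.AB (map prim ys)) = right_comb A ys"
    using aug_hom_comb(2)[OF SA.augmented_axioms S.rho_hom map_prim_closed[OF ys(2)]]
      map_rho_prim[OF ys(1)] by simp
  have "right_comb S.AB (map prim (ys @ [y])) = op_succ (right_comb S.AB (map prim ys)) (S.pure (aone A) y)
      \<oplus>\<^bsub>S.T\<^esub> S.pure (right_comb A ys \<rhd>\<^bsub>A\<^esub> y) (aone A)"
    using succ_prim[OF y(1) L] by (simp add: rho)
  also have "op_succ (right_comb S.AB (map prim ys)) (S.pure (aone A) y) =
      (\<Oplus>\<^bsub>S.T\<^esub>k\<in>{..?n}. op_succ (S.pure (right_comb A (take k ys)) (right_comb A (drop k ys)))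
        (S.pure (aone A) y))"
    unfolding IH
    by (rule linear_map_finsum[OF S.module_tensor S.module_tensor
          bilinear_map_linear(2)[OF op_succ_bilinear]]) (simp_all add: s)
  also have "\<dots> = (\<Oplus>\<^bsub>S.T\<^esub>k\<in>{..?n}. ?f k)"
    by (rule SA.finsum_cong') (simp_all add: s S.op_simps star_one)
  also have "S.pure (right_comb A ys \<rhd>\<^bsub>A\<^esub> y) (aone A) = ?f (Suc ?n)" by simp
  also have "(\<Oplus>\<^bsub>S.T\<^esub>k\<in>{..?n}. ?f k) \<oplus>\<^bsub>S.T\<^esub> ?f (Suc ?n) = ?f (Suc ?n) \<oplus>\<^bsub>S.T\<^esub> (\<Oplus>\<^bsub>S.T\<^esub>k\<in>{..?n}. ?f k)"
    by (intro SA.a_comm SA.finsum_closed Pi_I fcl) simp_all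
  also have "\<dots> = (\<Oplus>\<^bsub>S.T\<^esub>k\<in>{..Suc ?n}. ?f k)"
    by (rule SA.finsum_Suc[symmetric]) (use fcl in simp)
  finally show ?case by simp
qed

text \<open>Apart from the last summand, x stays in the right factor with the outermost arguments,
  while those adjacent to x move to the left factor, where the two combs are multiplied.\<close>

lemma arrow_prim:
  assumes us: "set us \<subseteq> aug_ker" and x: "x \<in> aug_ker" and vs: "set vs \<subseteq> aug_ker"
  shows "aug_arrow S.AB (map prim us) (prim x) (map prim vs) =
    (\<Oplus>\<^bsub>S.T\<^esub>j\<in>{..length us}. \<Oplus>\<^bsub>S.T\<^esub>k\<in>{..length vs}.
      S.pure (left_comb A (drop j us) \<star>\<^bsub>A\<^esub> right_comb A (take k vs))
        (aug_arrow A (take j us) x (drop k vs))) \<oplus>\<^bsub>S.T\<^esub> S.pure (aug_arrow A us x vs) (aone A)"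
proof -
  note c = aug_ker_subset[OF us] aug_kerD(1)[OF x] aug_ker_subset[OF vs]
  note s = comb_closed set_take_drop_subset[OF c(1)] set_take_drop_subset[OF c(3)] c
    S.pure_simps(1) one_closed succ_simps(1) prec_simps(1) star_simps(1)
  let ?L = "left_comb S.AB (map prim us)" and ?R = "right_comb S.AB (map prim vs)"
  have L: "?L \<in> carrier S.T" and R: "?R \<in> carrier S.T"
    using SA.left_comb_closed SA.right_comb_closed map_prim_closed c by blast+
  have rhoL: "S.\<rho> ?L = left_comb A us" and rhoR: "S.\<rho> ?R = right_comb A vs"
    using aug_hom_comb[OF SA.augmented_axioms S.rho_hom map_prim_closed] c
      map_rho_prim us vs by simp_all
  let ?w = "left_comb A us \<rhd>\<^bsub>A\<^esub> x"
  let ?u = "\<lambda>j. S.pure (left_comb A (drop j us)) (left_comb A (take j us) \<rhd>\<^bsub>A\<^esub> x)"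
  let ?v = "\<lambda>k. S.pure (right_comb A (take k vs)) (right_comb A (drop k vs))"
  have u: "?L \<rhd>\<^bsub>S.AB\<^esub> prim x = (\<Oplus>\<^bsub>S.T\<^esub>j\<in>{..length us}. ?u j) \<oplus>\<^bsub>S.T\<^esub> S.pure ?w (aone A)"
  proof -
    have "op_succ ?L (S.pure (aone A) x) =
        (\<Oplus>\<^bsub>S.T\<^esub>j\<in>{..length us}. op_succ (S.pure (left_comb A (drop j us)) (left_comb A (take j us)))
          (S.pure (aone A) x))"
      unfolding left_comb_prim[OF us]
      by (rule linear_map_finsum[OF S.module_tensor S.module_tensor
            bilinear_map_linear(2)[OF op_succ_bilinear]]) (simp_all add: s)
    also have "\<dots> = (\<Oplus>\<^bsub>S.T\<^esub>j\<in>{..length us}. ?u j)"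
      by (rule SA.finsum_cong') (simp_all add: s S.op_simps star_one)
    finally show ?thesis using succ_prim[OF c(2) L] by (simp add: rhoL)
  qed
  have rhou: "S.\<rho> (?L \<rhd>\<^bsub>S.AB\<^esub> prim x) = ?w"
    using aug_homD(5)[OF S.rho_hom L prim_closed[OF c(2)]] rhoL rho_prim x by simp
  have ucl: "(\<Oplus>\<^bsub>S.T\<^esub>j\<in>{..length us}. ?u j) \<in> carrier S.T"
    by (rule SA.finsum_closed) (simp add: s)
  \<comment> \<open>The summand \<open>S.pure ?w (aone A)\<close> contributes nothing to the main
    term because 1 \<prec> _ = 0; it reappears through the correction as the term with everything on
    the left.\<close>
  have "op_prec (?L \<rhd>\<^bsub>S.AB\<^esub> prim x) ?R = op_prec (\<Oplus>\<^bsub>S.T\<^esub>j\<in>{..length us}. ?u j) ?R"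
    using ucl R by (simp add: u S.op_simps s pure_one_prec)
  also have "\<dots> = (\<Oplus>\<^bsub>S.T\<^esub>j\<in>{..length us}. op_prec (?u j) ?R)"
    by (rule linear_map_finsum[OF S.module_tensor S.module_tensor
          bilinear_map_linear(2)[OF op_prec_bilinear]]) (simp_all add: s R)
  also have "\<dots> = (\<Oplus>\<^bsub>S.T\<^esub>j\<in>{..length us}. \<Oplus>\<^bsub>S.T\<^esub>k\<in>{..length vs}. op_prec (?u j) (?v k))"
  proof (rule SA.finsum_cong'[OF refl])
    show "op_prec (?u j) ?R = (\<Oplus>\<^bsub>S.T\<^esub>k\<in>{..length vs}. op_prec (?u j) (?v k))" for j
      unfolding right_comb_prim[OF vs]
      by (rule linear_map_finsum[OF S.module_tensor S.module_tensor
            bilinear_map_linear(1)[OF op_prec_bilinear]]) (simp_all add: s)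
  qed (simp add: s S.op_simps)
  also have "\<dots> = (\<Oplus>\<^bsub>S.T\<^esub>j\<in>{..length us}. \<Oplus>\<^bsub>S.T\<^esub>k\<in>{..length vs}.
      S.pure (left_comb A (drop j us) \<star>\<^bsub>A\<^esub> right_comb A (take k vs))
        (aug_arrow A (take j us) x (drop k vs)))"
    by (intro SA.finsum_cong'[OF refl]) (simp_all add: s S.op_simps aug_arrow_def)
  finally have "op_prec (?L \<rhd>\<^bsub>S.AB\<^esub> prim x) ?R = \<dots>" .
  moreover have "aug_arrow S.AB (map prim us) (prim x) (map prim vs) =
      op_prec (?L \<rhd>\<^bsub>S.AB\<^esub> prim x) ?R \<oplus>\<^bsub>S.T\<^esub> S.pure (?w \<lhd>\<^bsub>A\<^esub> right_comb A vs) (aone A)"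
    unfolding aug_arrow_def rhou[symmetric] rhoR[symmetric] by (simp add: tensor_aug_def)
  ultimately show ?thesis by (simp add: aug_arrow_def)
qed

text \<open>
  The contribution of \<open>y\<^sub>j\<^sub>+\<^sub>1, \<dots>, y\<^sub>m\<close> to the left tensor factor, in the summand in which the
  first \<open>i\<close> arguments stand to the left of \<open>x\<close>.
\<close>

private abbreviation "coeff ys i j m \<equiv>
  if j \<le> i \<and> i \<le> m then left_comb A (drop j (take i ys)) \<star>\<^bsub>A\<^esub> right_comb A (take (m - i) (drop i ys))
  else \<zero>\<^bsub>M\<^esub>"

private lemma coeff_closed: "set ys \<subseteq> carrier M \<Longrightarrow> coeff ys i j m \<in> carrier M"
  by (auto intro!: star_simps(1) comb_closed set_take_drop_subset)

text \<open>For fixed j and m the index i runs over the cut positions of the interval y_(j+1), ...,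
  y_m. Up to the sign of j this is the sum in \<open>antipode\<close>, which vanishes unless the
  interval is empty.\<close>

private lemma alternating_coeff_sum:
  assumes ys: "set ys \<subseteq> aug_ker" and jm: "j \<le> length ys" "m \<le> length ys"
  shows "(\<Oplus>\<^bsub>M\<^esub>i\<in>{..length ys}. alt_sign K i \<odot>\<^bsub>M\<^esub> coeff ys i j m) =
    (if j = m then alt_sign K j \<odot>\<^bsub>M\<^esub> aone A else \<zero>\<^bsub>M\<^esub>)"
proof (cases "j \<le> m")
  case False
  then have "(\<Oplus>\<^bsub>M\<^esub>i\<in>{..length ys}. alt_sign K i \<odot>\<^bsub>M\<^esub> coeff ys i j m) = (\<Oplus>\<^bsub>M\<^esub>i\<in>{..length ys}. \<zero>\<^bsub>M\<^esub>)"
    by (intro M.finsum_cong') auto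
  with False show ?thesis by simp
next
  case True
  note c = aug_ker_subset[OF ys]
  define zs where "zs = take (m - j) (drop j ys)"
  have len: "length zs = m - j" using True jm by (simp add: zs_def)
  have zs: "set zs \<subseteq> aug_ker" unfolding zs_def by (intro set_take_drop_subset ys)
  note cz = aug_ker_subset[OF zs]
  let ?g = "\<lambda>i. alt_sign K i \<odot>\<^bsub>M\<^esub>
    (left_comb A (drop j (take i ys)) \<star>\<^bsub>A\<^esub> right_comb A (take (m - i) (drop i ys)))"
  let ?t = "\<lambda>k. alt_sign K k \<odot>\<^bsub>M\<^esub> (left_comb A (take k zs) \<star>\<^bsub>A\<^esub> right_comb A (drop k zs))"
  have gcl: "?g i \<in> carrier M" for i
    by (intro smult_closed alt_sign_closed star_simps(1) comb_closed set_take_drop_subset c)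
  have tcl: "?t i \<in> carrier M" for i
    by (intro smult_closed alt_sign_closed star_simps(1) comb_closed set_take_drop_subset cz)
  have "(\<Oplus>\<^bsub>M\<^esub>i\<in>{..length ys}. alt_sign K i \<odot>\<^bsub>M\<^esub> coeff ys i j m) =
      (\<Oplus>\<^bsub>M\<^esub>i\<in>{..length ys}. if i \<le> m then (if j \<le> i then ?g i else \<zero>\<^bsub>M\<^esub>) else \<zero>\<^bsub>M\<^esub>)"
    by (rule M.finsum_cong'[OF refl]) (use gcl in auto)
  also have "\<dots> = (\<Oplus>\<^bsub>M\<^esub>i\<in>{..m}. if j \<le> i then ?g i else \<zero>\<^bsub>M\<^esub>)"
    by (rule M.finsum_atMost_restrict[symmetric, OF jm(2)]) (use gcl in simp)
  also have "\<dots> = (\<Oplus>\<^bsub>M\<^esub>k\<in>{..m - j}. ?g (j + k))"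
    by (rule M.finsum_atMost_shift[symmetric, OF True gcl])
  also have "\<dots> = (\<Oplus>\<^bsub>M\<^esub>k\<in>{..m - j}. alt_sign K j \<odot>\<^bsub>M\<^esub> ?t k)"
  proof (rule M.finsum_cong'[OF refl])
    fix k assume k: "k \<in> {..m - j}"
    have "drop j (take (j + k) ys) = take k zs"
      using k by (simp add: zs_def drop_take min_def)
    moreover have "take (m - (j + k)) (drop (j + k) ys) = drop k zs"
      by (simp add: zs_def drop_take add.commute)
    moreover have "left_comb A (take k zs) \<star>\<^bsub>A\<^esub> right_comb A (drop k zs) \<in> carrier M"
      by (intro star_simps(1) comb_closed set_take_drop_subset cz)
    ultimately show "?g (j + k) = alt_sign K j \<odot>\<^bsub>M\<^esub> ?t k"
      by (simp add: smult_assoc1[symmetric] R.nat_pow_mult)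
  qed (use tcl in simp)
  also have "\<dots> = alt_sign K j \<odot>\<^bsub>M\<^esub> (\<Oplus>\<^bsub>M\<^esub>k\<in>{..m - j}. ?t k)"
    by (rule finsum_smult_ldistr[symmetric]) (use tcl in simp_all)
  also have "(\<Oplus>\<^bsub>M\<^esub>k\<in>{..m - j}. ?t k) = (if zs = [] then aone A else \<zero>\<^bsub>M\<^esub>)"
    using antipode[OF zs] len by simp
  also have "zs = [] \<longleftrightarrow> j = m" using len True by auto
  finally show ?thesis by auto
qed

text \<open>The summands with everything on the left add up to the brace tensor 1. The others are
  regrouped by the interval (j, m) moved to the left; \<open>alternating_coeff_sum\<close> kills all
  with j < m, and those with j = m add up to 1 tensor the brace.\<close>

theorem brace_prim:
  assumes ys: "set ys \<subseteq> aug_ker" and x: "x \<in> aug_ker"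
  shows "aug_brace K (tensor K M M) (tensor_aug K M A M A) (prim x) (map prim ys) =
    prim (aug_brace K M A x ys)"
proof -
  note c = aug_ker_subset[OF ys] aug_kerD(1)[OF x]
  note s = comb_closed set_take_drop_subset[OF c(1)] c one_closed
  let ?n = "length ys"
  let ?w = "\<lambda>j m. aug_arrow A (take j ys) x (drop m ys)"
  let ?a = "\<lambda>i. S.pure (?w i i) (aone A)"
  let ?sg = "alt_sign K"
  let ?E = "\<lambda>i j m. S.pure (coeff ys i j m) (?w j m)"
  let ?E1 = "\<lambda>i j. \<Oplus>\<^bsub>S.T\<^esub>m\<in>{..?n}. ?E i j m" and ?EE = "\<lambda>i. \<Oplus>\<^bsub>S.T\<^esub>j\<in>{..?n}. \<Oplus>\<^bsub>S.T\<^esub>m\<in>{..?n}. ?E i j m"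
  let ?X = "\<lambda>i j m. S.pure (?sg i \<odot>\<^bsub>M\<^esub> coeff ys i j m) (?w j m)"
  let ?XX = "\<lambda>i. \<Oplus>\<^bsub>S.T\<^esub>j\<in>{..?n}. \<Oplus>\<^bsub>S.T\<^esub>m\<in>{..?n}. ?X i j m"
  let ?b = "\<lambda>i. S.pure (?sg i \<odot>\<^bsub>M\<^esub> ?w i i) (aone A)"
  let ?ar = "\<lambda>i. aug_arrow S.AB (take i (map prim ys)) (prim x) (drop i (map prim ys))"
  have wcl: "?w j m \<in> carrier M" for j m by (simp add: s)
  note cl = coeff_closed[OF c(1)] wcl S.pure_simps(1) one_closed
  have Ecl: "?E i j m \<in> carrier S.T" for i j m by (intro cl)
  have arrow: "?ar i =
      ?EE i \<oplus>\<^bsub>S.T\<^esub> ?a i" if i: "i \<le> ?n" for i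
  proof -
    let ?us = "take i ys" and ?vs = "drop i ys"
    let ?N = "\<lambda>j. left_comb A (drop j ?us)" and ?R = "\<lambda>k. right_comb A (take k ?vs)"
    have Ncl: "?N j \<in> carrier M" and Rcl: "?R k \<in> carrier M" for j k
      by (intro comb_closed set_take_drop_subset c)+
    have NR: "S.pure (?N j \<star>\<^bsub>A\<^esub> ?R k) (?w j m) \<in> carrier S.T" for j k m
      by (intro cl star_simps(1) Ncl Rcl)
    have "?ar i =
        (\<Oplus>\<^bsub>S.T\<^esub>j\<in>{..length ?us}. \<Oplus>\<^bsub>S.T\<^esub>k\<in>{..length ?vs}.
          S.pure (?N j \<star>\<^bsub>A\<^esub> ?R k) (aug_arrow A (take j ?us) x (drop k ?vs))) \<oplus>\<^bsub>S.T\<^esub> ?a i"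
      unfolding take_map drop_map
      by (rule arrow_prim[OF set_take_drop_subset(1)[OF ys] x set_take_drop_subset(2)[OF ys]])
    also have "(\<Oplus>\<^bsub>S.T\<^esub>j\<in>{..length ?us}. \<Oplus>\<^bsub>S.T\<^esub>k\<in>{..length ?vs}.
          S.pure (?N j \<star>\<^bsub>A\<^esub> ?R k) (aug_arrow A (take j ?us) x (drop k ?vs))) =
        (\<Oplus>\<^bsub>S.T\<^esub>j\<in>{..i}. \<Oplus>\<^bsub>S.T\<^esub>k\<in>{..?n - i}. S.pure (?N j \<star>\<^bsub>A\<^esub> ?R k) (?w j (i + k)))"
    proof (rule SA.finsum_cong')
      fix j assume j: "j \<in> {..i}"
      then have "take j ?us = take j ys" by (simp add: min_def)
      moreover have "drop k ?vs = drop (i + k) ys" for k by (simp add: add.commute)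
      ultimately show "(\<Oplus>\<^bsub>S.T\<^esub>k\<in>{..length ?vs}.
            S.pure (?N j \<star>\<^bsub>A\<^esub> ?R k) (aug_arrow A (take j ?us) x (drop k ?vs))) =
          (\<Oplus>\<^bsub>S.T\<^esub>k\<in>{..?n - i}. S.pure (?N j \<star>\<^bsub>A\<^esub> ?R k) (?w j (i + k)))"
        by simp
    qed (use i NR in auto)
    \<comment> \<open>The relative position k is replaced by the absolute position m = i + k. The
      zeros in \<open>coeff\<close> then extend both sums to {..n}, so that the ranges no longer
      depend on i.\<close>
    also have "\<dots> = (\<Oplus>\<^bsub>S.T\<^esub>j\<in>{..i}. ?E1 i j)"
    proof (rule SA.finsum_cong'[OF refl])
      fix j assume j: "j \<in> {..i}"
      have "(\<Oplus>\<^bsub>S.T\<^esub>k\<in>{..?n - i}. S.pure (?N j \<star>\<^bsub>A\<^esub> ?R k) (?w j (i + k))) =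
          (\<Oplus>\<^bsub>S.T\<^esub>k\<in>{..?n - i}. S.pure (?N j \<star>\<^bsub>A\<^esub> ?R (i + k - i)) (?w j (i + k)))"
        by simp
      also have "\<dots> = (\<Oplus>\<^bsub>S.T\<^esub>m\<in>{..?n}. if i \<le> m then S.pure (?N j \<star>\<^bsub>A\<^esub> ?R (m - i)) (?w j m) else \<zero>\<^bsub>S.T\<^esub>)"
        by (rule SA.finsum_atMost_shift[where f = "\<lambda>m. S.pure (?N j \<star>\<^bsub>A\<^esub> ?R (m - i)) (?w j m)", OF i NR])
      also have "\<dots> = ?E1 i j"
        by (rule SA.finsum_cong'[OF refl]) (use j NR wcl in \<open>auto simp: S.pure_zero\<close>)
      finally show "(\<Oplus>\<^bsub>S.T\<^esub>k\<in>{..?n - i}. S.pure (?N j \<star>\<^bsub>A\<^esub> ?R k) (?w j (i + k))) =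
        ?E1 i j" .
    qed (use Ecl in \<open>auto intro!: SA.finsum_closed\<close>)
    also have "\<dots> = (\<Oplus>\<^bsub>S.T\<^esub>j\<in>{..?n}. if j \<le> i then ?E1 i j else \<zero>\<^bsub>S.T\<^esub>)"
      by (rule SA.finsum_atMost_restrict[OF i]) (intro SA.finsum_closed Pi_I Ecl)
    also have "\<dots> = ?EE i"
    proof (rule SA.finsum_cong'[OF refl])
      show "(if j \<le> i then ?E1 i j else \<zero>\<^bsub>S.T\<^esub>) = ?E1 i j" for j
        by (simp add: S.pure_zero wcl)
    qed (intro Pi_I SA.finsum_closed Ecl)
    finally show ?thesis .
  qed
  have sE: "?sg i \<odot>\<^bsub>S.T\<^esub> ?EE i =
      ?XX i" for i
  proof -
    have "?sg i \<odot>\<^bsub>S.T\<^esub> ?EE i =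
        (\<Oplus>\<^bsub>S.T\<^esub>j\<in>{..?n}. ?sg i \<odot>\<^bsub>S.T\<^esub> ?E1 i j)"
      by (rule SA.finsum_smult_ldistr) (simp, simp, intro Pi_I SA.finsum_closed Ecl)
    also have "\<dots> = (\<Oplus>\<^bsub>S.T\<^esub>j\<in>{..?n}. \<Oplus>\<^bsub>S.T\<^esub>m\<in>{..?n}. ?sg i \<odot>\<^bsub>S.T\<^esub> ?E i j m)"
    proof (rule SA.finsum_cong'[OF refl])
      show "?sg i \<odot>\<^bsub>S.T\<^esub> ?E1 i j = (\<Oplus>\<^bsub>S.T\<^esub>m\<in>{..?n}. ?sg i \<odot>\<^bsub>S.T\<^esub> ?E i j m)" for j
        by (rule SA.finsum_smult_ldistr) (simp, simp, intro Pi_I Ecl)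
    qed (intro Pi_I SA.finsum_closed SA.smult_closed alt_sign_closed Ecl)
    \<comment> \<open>The sign is moved into the left factor, where the coefficients are later
      summed over i.\<close>
    also have "(\<lambda>j m. ?sg i \<odot>\<^bsub>S.T\<^esub> ?E i j m) = (\<lambda>j m. ?X i j m)"
      using S.pure_simps(4)[OF alt_sign_closed coeff_closed[OF c(1)] wcl] by (intro ext) metis
    finally show ?thesis .
  qed
  have pcl: "?X i j m \<in> carrier S.T" for i j m
    by (intro cl smult_closed alt_sign_closed)
  have acl: "?a i \<in> carrier S.T" for i by (intro cl)
  have "aug_brace K S.T S.AB (prim x) (map prim ys) =
      (\<Oplus>\<^bsub>S.T\<^esub>i\<in>{..?n}. ?XX i
        \<oplus>\<^bsub>S.T\<^esub> ?b i)"
    unfolding aug_brace_def length_map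
  proof (rule SA.finsum_cong'[OF refl])
    fix i assume "i \<in> {..?n}"
    then have "?sg i \<odot>\<^bsub>S.T\<^esub> ?ar i =
        ?sg i \<odot>\<^bsub>S.T\<^esub> ?EE i \<oplus>\<^bsub>S.T\<^esub> ?sg i \<odot>\<^bsub>S.T\<^esub> ?a i"
      unfolding arrow[OF \<open>i \<in> {..?n}\<close>[unfolded atMost_iff]]
      by (intro SA.smult_r_distr alt_sign_closed acl SA.finsum_closed Pi_I Ecl)
    also have "?sg i \<odot>\<^bsub>S.T\<^esub> ?a i = ?b i"
      by (rule S.pure_simps(4)[symmetric]) (intro alt_sign_closed wcl one_closed)+
    finally show "?sg i \<odot>\<^bsub>S.T\<^esub> ?ar i =
        ?XX i
        \<oplus>\<^bsub>S.T\<^esub> ?b i"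
      unfolding sE .
  qed (intro Pi_I SA.a_closed SA.finsum_closed pcl cl smult_closed alt_sign_closed)
  also have "\<dots> = (\<Oplus>\<^bsub>S.T\<^esub>i\<in>{..?n}. ?XX i)
      \<oplus>\<^bsub>S.T\<^esub> (\<Oplus>\<^bsub>S.T\<^esub>i\<in>{..?n}. ?b i)"
    by (intro SA.finsum_addf Pi_I SA.finsum_closed pcl cl smult_closed alt_sign_closed)
  also have "(\<Oplus>\<^bsub>S.T\<^esub>i\<in>{..?n}. ?b i) = S.pure (aug_brace K M A x ys) (aone A)"
    unfolding aug_brace_def
    by (rule linear_map_finsum[symmetric, OF module_axioms S.module_tensor
          bilinear_map_linear(2)[OF S.pure_bilinear one_closed]])
      (intro Pi_I smult_closed alt_sign_closed wcl)
  \<comment> \<open>The sum over i is moved inside, since the right factor depends on j and m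
    only.\<close>
  also have "(\<Oplus>\<^bsub>S.T\<^esub>i\<in>{..?n}. ?XX i) =
      (\<Oplus>\<^bsub>S.T\<^esub>j\<in>{..?n}. \<Oplus>\<^bsub>S.T\<^esub>i\<in>{..?n}. \<Oplus>\<^bsub>S.T\<^esub>m\<in>{..?n}. ?X i j m)"
    by (rule SA.finsum_swap) (simp, simp, intro SA.finsum_closed Pi_I pcl)
  also have "\<dots> = (\<Oplus>\<^bsub>S.T\<^esub>j\<in>{..?n}. S.pure (aone A) (?sg j \<odot>\<^bsub>M\<^esub> ?w j j))"
  proof (rule SA.finsum_cong'[OF refl])
    fix j assume j: "j \<in> {..?n}"
    have "(\<Oplus>\<^bsub>S.T\<^esub>i\<in>{..?n}. \<Oplus>\<^bsub>S.T\<^esub>m\<in>{..?n}. ?X i j m) =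
        (\<Oplus>\<^bsub>S.T\<^esub>m\<in>{..?n}. \<Oplus>\<^bsub>S.T\<^esub>i\<in>{..?n}. ?X i j m)"
      by (rule SA.finsum_swap) (simp, simp, intro pcl)
    also have "\<dots> = (\<Oplus>\<^bsub>S.T\<^esub>m\<in>{..?n}. if j = m then S.pure (?sg m \<odot>\<^bsub>M\<^esub> aone A) (?w m m) else \<zero>\<^bsub>S.T\<^esub>)"
    proof (rule SA.finsum_cong'[OF refl])
      fix m assume m: "m \<in> {..?n}"
      have "(\<Oplus>\<^bsub>S.T\<^esub>i\<in>{..?n}. ?X i j m) =
          S.pure (\<Oplus>\<^bsub>M\<^esub>i\<in>{..?n}. ?sg i \<odot>\<^bsub>M\<^esub> coeff ys i j m) (?w j m)"
        by (rule linear_map_finsum[symmetric, OF module_axioms S.module_tensor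
              bilinear_map_linear(2)[OF S.pure_bilinear wcl]])
          (intro Pi_I smult_closed alt_sign_closed cl)
      also have "\<dots> = S.pure (if j = m then ?sg j \<odot>\<^bsub>M\<^esub> aone A else \<zero>\<^bsub>M\<^esub>) (?w j m)"
        using alternating_coeff_sum[OF ys] j m by simp
      finally show "(\<Oplus>\<^bsub>S.T\<^esub>i\<in>{..?n}. ?X i j m) =
          (if j = m then S.pure (?sg m \<odot>\<^bsub>M\<^esub> aone A) (?w m m) else \<zero>\<^bsub>S.T\<^esub>)"
        by (simp add: S.pure_zero wcl)
    qed (simp add: S.pure_simps wcl one_closed)
    also have "\<dots> = S.pure (?sg j \<odot>\<^bsub>M\<^esub> aone A) (?w j j)"
      by (rule SA.finsum_singleton[OF j]) (simp_all add: S.pure_simps wcl one_closed)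
    also have "\<dots> = S.pure (aone A) (?sg j \<odot>\<^bsub>M\<^esub> ?w j j)"
      by (simp add: S.pure_simps wcl one_closed)
    finally show "(\<Oplus>\<^bsub>S.T\<^esub>i\<in>{..?n}. \<Oplus>\<^bsub>S.T\<^esub>m\<in>{..?n}. ?X i j m) =
        S.pure (aone A) (?sg j \<odot>\<^bsub>M\<^esub> ?w j j)" .
  qed (simp add: S.pure_simps wcl one_closed)
  also have "\<dots> = S.pure (aone A) (aug_brace K M A x ys)"
    unfolding aug_brace_def
    by (rule linear_map_finsum[symmetric, OF module_axioms S.module_tensor
          bilinear_map_linear(1)[OF S.pure_bilinear one_closed]])
      (intro Pi_I smult_closed alt_sign_closed wcl)
  also have "\<dots> \<oplus>\<^bsub>S.T\<^esub> S.pure (aug_brace K M A x ys) (aone A) = prim (aug_brace K M A x ys)"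
  proof -
    have "aug_brace K M A x ys \<in> carrier M"
      unfolding aug_brace_def by (intro M.finsum_closed Pi_I smult_closed alt_sign_closed wcl)
    then show ?thesis by (intro SA.a_comm S.pure_simps(1) one_closed)
  qed
  finally show ?thesis .
qed

end

end



section \<open>Dendriform quotients and the free dendriform algebra\<close>

text \<open>Transfers the module axioms from \<open>free_module\<close> to the record
  \<open>free_two_ops\<close>, which adds the two operations.\<close>

lemma module_cong:
  assumes "module K M" "carrier N = carrier M" "add N = add M" "zero N = zero M" "smult N = smult M"
  shows "module K N"
proof -
  interpret M: module K M by fact
  show ?thesis
  proof (rule moduleI)
    show "abelian_group N"
    proof (rule abelian_groupI)
      show "\<exists>y\<in>carrier N. y \<oplus>\<^bsub>N\<^esub> x = \<zero>\<^bsub>N\<^esub>" if "x \<in> carrier N" for x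
        by (rule bexI[of _ "\<ominus>\<^bsub>M\<^esub> x"]) (use that in \<open>simp_all add: assms(2-) M.l_neg\<close>)
    qed (auto simp: assms(2-) M.a_ac)
  qed (auto simp: assms(2-) M.R.is_cring M.smult_l_distr M.smult_r_distr M.smult_assoc1)
qed

text \<open>The source has no unit, so the image is required to lie in the augmentation ideal of the
  target; this is what allows the extension to the unitization in
  \<open>unit_extension\<close>.\<close>

definition dend_hom ::
  "('k, 'r) ring_scheme \<Rightarrow> ('k, 'a, 'm) dendriform_scheme \<Rightarrow> ('k, 'b, 'n) module_scheme \<Rightarrow>
    ('k, 'b) aug_ops \<Rightarrow> ('a \<Rightarrow> 'b) \<Rightarrow> bool"
  where "dend_hom K D N B f \<longleftrightarrow> linear_map K D N f \<and> (\<forall>x\<in>carrier D. aeps B (f x) = \<zero>\<^bsub>K\<^esub>) \<and>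
    (\<forall>x\<in>carrier D. \<forall>y\<in>carrier D.
      f (x \<prec>\<^bsub>D\<^esub> y) = f x \<lhd>\<^bsub>B\<^esub> f y \<and> f (x \<succ>\<^bsub>D\<^esub> y) = f x \<rhd>\<^bsub>B\<^esub> f y)"

lemma dend_homD:
  assumes "dend_hom K D N B f"
  shows "linear_map K D N f"
    "x \<in> carrier D \<Longrightarrow> aeps B (f x) = \<zero>\<^bsub>K\<^esub>"
    "\<lbrakk>x \<in> carrier D; y \<in> carrier D\<rbrakk> \<Longrightarrow> f (x \<prec>\<^bsub>D\<^esub> y) = f x \<lhd>\<^bsub>B\<^esub> f y"
    "\<lbrakk>x \<in> carrier D; y \<in> carrier D\<rbrakk> \<Longrightarrow> f (x \<succ>\<^bsub>D\<^esub> y) = f x \<rhd>\<^bsub>B\<^esub> f y"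
  using assms by (auto simp: dend_hom_def)

text \<open>Stated without dendriform axioms, so that ideals and quotients are treated once for the
  free algebra with two operations and for dendriform algebras.\<close>

locale two_ops = module K D
  for K :: "('k, 'r) ring_scheme" and D :: "('k, 'a, 'm) dendriform_scheme" +
  assumes dprec_bilin: "bilinear_map K D D D (dprec D)"
    and dsucc_bilin: "bilinear_map K D D D (dsucc D)"
begin

lemmas dop_simps = bilinear_mapD[OF dprec_bilin] bilinear_mapD[OF dsucc_bilin]

lemma carrier_ideal: "dendriform_ideal K D (carrier D)"
  by (simp add: dendriform_ideal_def carrier_is_submodule dop_simps)

lemma ideal_generated:
  assumes "S \<subseteq> carrier D"
  shows "dendriform_ideal K D (dendriform_ideal_generated K D S)"
proof -
  let ?I = "dendriform_ideal_generated K D S"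
  have z: "\<zero>\<^bsub>D\<^esub> \<in> N" if "submodule N K D" for N
    using that subgroup.one_closed[of N "add_monoid D"] by (simp add: submodule_def)
  have "submodule ?I K D"
    unfolding dendriform_ideal_generated_def
  proof (rule submoduleI)
    show "\<Inter>{I. dendriform_ideal K D I \<and> S \<subseteq> I} \<subseteq> carrier D" using carrier_ideal assms by blast
  qed (auto simp: dendriform_ideal_def dest: submoduleE(3,4,5) intro: z)
  then show ?thesis
    unfolding dendriform_ideal_def by (auto simp: dendriform_ideal_generated_def dendriform_ideal_def)
qed

lemma dend_hom_kernel_ideal:
  assumes "augmented K N B" "dend_hom K D N B f"
  shows "dendriform_ideal K D {x \<in> carrier D. f x = \<zero>\<^bsub>N\<^esub>}"
proof -
  interpret B: augmented K N B by fact
  note f = dend_homD[OF assms(2)] linear_mapD[OF dend_homD(1)[OF assms(2)]]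
  show ?thesis
    unfolding dendriform_ideal_def
    using submodule_kernel[OF module_axioms B.module_axioms f(1)]
    by (auto simp: f dop_simps B.aug_simps)
qed

end

lemma ideal_generated_least:
  "\<lbrakk>dendriform_ideal K D I; S \<subseteq> I\<rbrakk> \<Longrightarrow> dendriform_ideal_generated K D S \<subseteq> I"
  by (auto simp: dendriform_ideal_generated_def)

lemma ideal_generated_base: "S \<subseteq> dendriform_ideal_generated K D S"
  by (auto simp: dendriform_ideal_generated_def)

locale quotient_two_ops = two_ops K D
  for K :: "('k, 'r) ring_scheme" and D :: "('k, 'a, 'm) dendriform_scheme" +
  fixes I :: "'a set"
  assumes ideal: "dendriform_ideal K D I"
begin

abbreviation "Q \<equiv> dendriform_quot D I"

sublocale Q: quotient_module K D I Q
  using ideal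
  by (intro quotient_module.intro quotient_module_axioms.intro module_axioms)
    (simp_all add: dendriform_quot_def dendriform_ideal_def)

lemma idealD:
  "\<lbrakk>x \<in> carrier D; i \<in> I\<rbrakk> \<Longrightarrow> x \<prec>\<^bsub>D\<^esub> i \<in> I" "\<lbrakk>x \<in> carrier D; i \<in> I\<rbrakk> \<Longrightarrow> i \<prec>\<^bsub>D\<^esub> x \<in> I"
  "\<lbrakk>x \<in> carrier D; i \<in> I\<rbrakk> \<Longrightarrow> x \<succ>\<^bsub>D\<^esub> i \<in> I" "\<lbrakk>x \<in> carrier D; i \<in> I\<rbrakk> \<Longrightarrow> i \<succ>\<^bsub>D\<^esub> x \<in> I"
  using ideal by (auto simp: dendriform_ideal_def)

lemma coset_op:
  assumes b: "bilinear_map K D D D b"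
    and l: "\<And>x i. \<lbrakk>x \<in> carrier D; i \<in> I\<rbrakk> \<Longrightarrow> b x i \<in> I"
    and r: "\<And>x i. \<lbrakk>x \<in> carrier D; i \<in> I\<rbrakk> \<Longrightarrow> b i x \<in> I"
    and x: "x \<in> carrier D" and y: "y \<in> carrier D"
  shows "(\<Union>x'\<in>I +>\<^bsub>D\<^esub> x. \<Union>y'\<in>I +>\<^bsub>D\<^esub> y. I +>\<^bsub>D\<^esub> b x' y') = I +>\<^bsub>D\<^esub> b x y"
proof -
  note bl = bilinear_mapD[OF b]
  have "I +>\<^bsub>D\<^esub> b x' y' = I +>\<^bsub>D\<^esub> b x y" if "x' \<in> I +>\<^bsub>D\<^esub> x" "y' \<in> I +>\<^bsub>D\<^esub> y" for x' y'
  proof -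
    have x': "x' \<in> carrier D" "x' \<ominus>\<^bsub>D\<^esub> x \<in> I" and y': "y' \<in> carrier D" "y' \<ominus>\<^bsub>D\<^esub> y \<in> I"
      using that Q.coset_mem x y by auto
    have "b (x' \<ominus>\<^bsub>D\<^esub> x) y' \<oplus>\<^bsub>D\<^esub> b x (y' \<ominus>\<^bsub>D\<^esub> y) \<in> I"
      by (intro Q.sub_closed(5) l r x x' y y')
    also have "b (x' \<ominus>\<^bsub>D\<^esub> x) y' = b x' y' \<ominus>\<^bsub>D\<^esub> b x y'"
      using linear_map_minus[OF module_axioms module_axioms bilinear_map_linear(2)[OF b y'(1)]] x x'
      by simp
    also have "b x (y' \<ominus>\<^bsub>D\<^esub> y) = b x y' \<ominus>\<^bsub>D\<^esub> b x y"
      using linear_map_minus[OF module_axioms module_axioms bilinear_map_linear(1)[OF b x]] y y'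
      by simp
    also have "(b x' y' \<ominus>\<^bsub>D\<^esub> b x y') \<oplus>\<^bsub>D\<^esub> (b x y' \<ominus>\<^bsub>D\<^esub> b x y) = b x' y' \<ominus>\<^bsub>D\<^esub> b x y"
      using x x' y y' by (simp add: a_minus_def M.a_assoc bl M.r_neg1)
    finally show ?thesis
      using Q.coset_eq_iff bl(1) x x' y y' by simp
  qed
  then show ?thesis
    using Q.coset_self[OF x] Q.coset_self[OF y] by blast
qed

lemma coset_prec: "\<lbrakk>x \<in> carrier D; y \<in> carrier D\<rbrakk> \<Longrightarrow> (I +>\<^bsub>D\<^esub> x) \<prec>\<^bsub>Q\<^esub> (I +>\<^bsub>D\<^esub> y) = I +>\<^bsub>D\<^esub> (x \<prec>\<^bsub>D\<^esub> y)"
  and coset_succ: "\<lbrakk>x \<in> carrier D; y \<in> carrier D\<rbrakk> \<Longrightarrow> (I +>\<^bsub>D\<^esub> x) \<succ>\<^bsub>Q\<^esub> (I +>\<^bsub>D\<^esub> y) = I +>\<^bsub>D\<^esub> (x \<succ>\<^bsub>D\<^esub> y)"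
  using coset_op[OF dprec_bilin idealD(1,2)] coset_op[OF dsucc_bilin idealD(3,4)]
  by (simp_all add: dendriform_quot_def)

lemma two_ops_Q: "two_ops K Q"
proof (intro two_ops.intro two_ops_axioms.intro Q.module_Q)
  show "bilinear_map K Q Q Q (dprec Q)"
    "bilinear_map K Q Q Q (dsucc Q)"
    by (rule bilinear_mapI; auto dest!: Q.coset_rep
        simp: coset_prec coset_succ dop_simps Q.coset_add Q.coset_smult Q.coset_closed)+
qed

lemma dend_hom_quot:
  assumes "module K N" "dend_hom K D N B f" "\<And>x. x \<in> I \<Longrightarrow> f x = \<zero>\<^bsub>N\<^esub>"
  shows "dend_hom K Q N B (\<lambda>X. the_elem (f ` X))"
    and "x \<in> carrier D \<Longrightarrow> the_elem (f ` (I +>\<^bsub>D\<^esub> x)) = f x"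
proof -
  note f = dend_homD[OF assms(2)] linear_mapD[OF dend_homD(1)[OF assms(2)]]
  note l = Q.lift_coset[OF assms(1) f(1) assms(3)]
  show "dend_hom K Q N B (\<lambda>X. the_elem (f ` X))"
    unfolding dend_hom_def
    using Q.linear_lift[OF assms(1) f(1) assms(3)]
    by (auto dest!: Q.coset_rep simp: l f coset_prec coset_succ dop_simps)
  show "x \<in> carrier D \<Longrightarrow> the_elem (f ` (I +>\<^bsub>D\<^esub> x)) = f x" by (rule l)
qed

text \<open>The axioms are assumed modulo I: for the free algebra they hold there because the
  relations lie in the kernel, for quotients of dendriform algebras because the differences are
  0.\<close>

lemma dendriform_algebra_Q:
  assumes "field K"
    and "\<And>x y z. \<lbrakk>x \<in> carrier D; y \<in> carrier D; z \<in> carrier D\<rbrakk> \<Longrightarrow>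
      ((x \<prec>\<^bsub>D\<^esub> y) \<prec>\<^bsub>D\<^esub> z) \<ominus>\<^bsub>D\<^esub> (x \<prec>\<^bsub>D\<^esub> (y \<prec>\<^bsub>D\<^esub> z) \<oplus>\<^bsub>D\<^esub> x \<prec>\<^bsub>D\<^esub> (y \<succ>\<^bsub>D\<^esub> z)) \<in> I"
    and "\<And>x y z. \<lbrakk>x \<in> carrier D; y \<in> carrier D; z \<in> carrier D\<rbrakk> \<Longrightarrow>
      ((x \<succ>\<^bsub>D\<^esub> y) \<prec>\<^bsub>D\<^esub> z) \<ominus>\<^bsub>D\<^esub> (x \<succ>\<^bsub>D\<^esub> (y \<prec>\<^bsub>D\<^esub> z)) \<in> I"
    and "\<And>x y z. \<lbrakk>x \<in> carrier D; y \<in> carrier D; z \<in> carrier D\<rbrakk> \<Longrightarrow>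
      (x \<succ>\<^bsub>D\<^esub> (y \<succ>\<^bsub>D\<^esub> z)) \<ominus>\<^bsub>D\<^esub> ((x \<succ>\<^bsub>D\<^esub> y) \<succ>\<^bsub>D\<^esub> z \<oplus>\<^bsub>D\<^esub> (x \<prec>\<^bsub>D\<^esub> y) \<succ>\<^bsub>D\<^esub> z) \<in> I"
  shows "dendriform_algebra K Q"
proof -
  interpret Q2: two_ops K Q by (rule two_ops_Q)
  show ?thesis
  proof (intro dendriform_algebra.intro dendriform_algebra_axioms.intro assms(1) Q.module_Q
      Q2.dprec_bilin Q2.dsucc_bilin)
    fix X Y Z assume "X \<in> carrier Q" "Y \<in> carrier Q" "Z \<in> carrier Q"
    then obtain x y z where x: "x \<in> carrier D" "y \<in> carrier D" "z \<in> carrier D"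
      and X: "X = I +>\<^bsub>D\<^esub> x" "Y = I +>\<^bsub>D\<^esub> y" "Z = I +>\<^bsub>D\<^esub> z"
      using Q.coset_rep by metis
    show "(X \<prec>\<^bsub>Q\<^esub> Y) \<prec>\<^bsub>Q\<^esub> Z = X \<prec>\<^bsub>Q\<^esub> (Y \<prec>\<^bsub>Q\<^esub> Z) \<oplus>\<^bsub>Q\<^esub> X \<prec>\<^bsub>Q\<^esub> (Y \<succ>\<^bsub>Q\<^esub> Z)"
      and "(X \<succ>\<^bsub>Q\<^esub> Y) \<prec>\<^bsub>Q\<^esub> Z = X \<succ>\<^bsub>Q\<^esub> (Y \<prec>\<^bsub>Q\<^esub> Z)"
      and "X \<succ>\<^bsub>Q\<^esub> (Y \<succ>\<^bsub>Q\<^esub> Z) = (X \<succ>\<^bsub>Q\<^esub> Y) \<succ>\<^bsub>Q\<^esub> Z \<oplus>\<^bsub>Q\<^esub> (X \<prec>\<^bsub>Q\<^esub> Y) \<succ>\<^bsub>Q\<^esub> Z"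
      using assms(2,3,4)[OF x] x
      by (simp_all add: X coset_prec coset_succ dop_simps Q.coset_add Q.coset_eq_iff)
  qed
qed

end

lemma dendriform_algebra_two_ops:
  assumes "dendriform_algebra K D"
  shows "two_ops K D"
proof -
  interpret dendriform_algebra K D by fact
  show ?thesis by unfold_locales (rule dprec_bilinear dsucc_bilinear)+
qed

lemma dendriform_algebra_quot:
  assumes "dendriform_algebra K D" "dendriform_ideal K D I"
  shows "dendriform_algebra K (dendriform_quot D I)"
proof -
  interpret D: dendriform_algebra K D by fact
  interpret quotient_two_ops K D I
    by (intro quotient_two_ops.intro quotient_two_ops_axioms.intro dendriform_algebra_two_ops assms)
  have z: "x \<ominus>\<^bsub>D\<^esub> x \<in> I" if "x \<in> carrier D" for x
    using that Q.zero_in_N by (simp add: a_minus_def D.M.r_neg)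
  show ?thesis
    by (rule dendriform_algebra_Q[OF D.field_axioms])
      (simp_all add: D.prec_prec D.succ_prec D.succ_succ dop_simps z)
qed

subsection \<open>The free algebra\<close>

locale free_dend = module K V
  for K :: "('k, 'r) ring_scheme" and V :: "('k, 'v, 'm) module_scheme"
begin

abbreviation "F \<equiv> free_two_ops K V"
abbreviation "Tm \<equiv> {t. set_dterm t \<subseteq> carrier V}"
abbreviation "FM \<equiv> free_module K Tm"
abbreviation "be \<equiv> basis_elem K"

lemma F_simps:
  "carrier F = carrier FM" "add F = add FM" "zero F = zero FM" "smult F = smult FM"
  "dprec F = (\<lambda>f g t. case t of Prec t1 t2 \<Rightarrow> f t1 \<otimes>\<^bsub>K\<^esub> g t2 | _ \<Rightarrow> \<zero>\<^bsub>K\<^esub>)"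
  "dsucc F = (\<lambda>f g t. case t of Succ t1 t2 \<Rightarrow> f t1 \<otimes>\<^bsub>K\<^esub> g t2 | _ \<Rightarrow> \<zero>\<^bsub>K\<^esub>)"
  by (simp_all add: free_two_ops_def Let_def)

lemma module_F: "module K F"
  by (rule module_cong[OF R.module_free[of Tm]]) (simp_all add: F_simps)

lemma be_closed: "t \<in> Tm \<Longrightarrow> be t \<in> carrier F"
  unfolding F_simps by (rule R.basis_elem_closed)

text \<open>With C a constructor, \<open>Prec\<close> or \<open>Succ\<close>, the support of the
  product lies in the image under C of the product of two finite supports.\<close>

lemma op_closed:
  assumes op: "\<And>t. h t \<noteq> \<zero>\<^bsub>K\<^esub> \<Longrightarrow> \<exists>u w. t = C u w \<and> h t = f u \<otimes>\<^bsub>K\<^esub> g w"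
    and C: "\<And>u w. set_dterm (C u w) = set_dterm u \<union> set_dterm w"
    and "f \<in> carrier F" "g \<in> carrier F"
  shows "h \<in> carrier F"
proof -
  have f: "\<And>t. f t \<in> carrier K" "finite {t. f t \<noteq> \<zero>\<^bsub>K\<^esub>}" "\<And>t. t \<notin> Tm \<Longrightarrow> f t = \<zero>\<^bsub>K\<^esub>"
    and g: "\<And>t. g t \<in> carrier K" "finite {t. g t \<noteq> \<zero>\<^bsub>K\<^esub>}" "\<And>t. t \<notin> Tm \<Longrightarrow> g t = \<zero>\<^bsub>K\<^esub>"
    using assms(3,4) by (simp_all add: F_simps(1) free_module_carrier)
  have nz: "\<exists>u w. t = C u w \<and> f u \<noteq> \<zero>\<^bsub>K\<^esub> \<and> g w \<noteq> \<zero>\<^bsub>K\<^esub>" if "h t \<noteq> \<zero>\<^bsub>K\<^esub>" for t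
    using op[OF that] that f(1) g(1) by fastforce
  then have "{t. h t \<noteq> \<zero>\<^bsub>K\<^esub>} \<subseteq> case_prod C ` ({t. f t \<noteq> \<zero>\<^bsub>K\<^esub>} \<times> {t. g t \<noteq> \<zero>\<^bsub>K\<^esub>})"
    by force
  then have "finite {t. h t \<noteq> \<zero>\<^bsub>K\<^esub>}"
    using f(2) g(2) finite_subset by blast
  moreover have "h t \<in> carrier K" for t
    using op[of t] f(1) g(1) by (cases "h t = \<zero>\<^bsub>K\<^esub>") auto
  moreover have "h t = \<zero>\<^bsub>K\<^esub>" if "t \<notin> Tm" for t
  proof (rule ccontr)
    assume "h t \<noteq> \<zero>\<^bsub>K\<^esub>"
    then obtain u w where t: "t = C u w" and "f u \<noteq> \<zero>\<^bsub>K\<^esub>" "g w \<noteq> \<zero>\<^bsub>K\<^esub>" using nz by blast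
    then have "u \<in> Tm" "w \<in> Tm" using f(3) g(3) by blast+
    then show False using that t C by simp
  qed
  ultimately show ?thesis
    unfolding F_simps(1) free_module_carrier by blast
qed

lemma prec_bilin: "bilinear_map K F F F (dprec F)"
proof (rule bilinear_mapI)
  show "f \<prec>\<^bsub>F\<^esub> g \<in> carrier F" if "f \<in> carrier F" "g \<in> carrier F" for f g
    by (rule op_closed[OF _ _ that, of _ Prec]) (auto simp: F_simps split: dterm.splits)
qed (auto simp: F_simps free_module_simps free_module_carrier fun_eq_iff R.l_distr R.r_distr R.m_ac
    split: dterm.splits)

lemma succ_bilin: "bilinear_map K F F F (dsucc F)"
proof (rule bilinear_mapI)
  show "f \<succ>\<^bsub>F\<^esub> g \<in> carrier F" if "f \<in> carrier F" "g \<in> carrier F" for f g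
    by (rule op_closed[OF _ _ that, of _ Succ]) (auto simp: F_simps split: dterm.splits)
qed (auto simp: F_simps free_module_simps free_module_carrier fun_eq_iff R.l_distr R.r_distr R.m_ac
    split: dterm.splits)

sublocale F: two_ops K F
  by (intro two_ops.intro two_ops_axioms.intro module_F prec_bilin succ_bilin)

lemma be_prec: "be s \<prec>\<^bsub>F\<^esub> be t = be (Prec s t)" and be_succ: "be s \<succ>\<^bsub>F\<^esub> be t = be (Succ s t)"
  by (auto simp: F_simps basis_elem_def fun_eq_iff split: dterm.splits)

lemma F_induct [consumes 1, case_names basis zero add smult]:
  assumes "f \<in> carrier F"
    and "\<And>t. t \<in> Tm \<Longrightarrow> P (be t)" and "P \<zero>\<^bsub>F\<^esub>"
    and "\<And>f g. \<lbrakk>f \<in> carrier F; g \<in> carrier F; P f; P g\<rbrakk> \<Longrightarrow> P (f \<oplus>\<^bsub>F\<^esub> g)"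
    and "\<And>a f. \<lbrakk>a \<in> carrier K; f \<in> carrier F; P f\<rbrakk> \<Longrightarrow> P (a \<odot>\<^bsub>F\<^esub> f)"
  shows "P f"
  using assms(1)[unfolded F_simps]
  by (induction rule: R.free_module_induct) (use assms(2-) in \<open>simp_all add: F_simps free_module_simps\<close>)

lemma relations_closed: "free_dendriform_relations K V \<subseteq> carrier F"
  unfolding free_dendriform_relations_def Let_def
  by (intro Un_least subsetI; elim CollectE exE conjE) (simp_all add: be_closed F.dop_simps)

abbreviation "J \<equiv> free_dendriform_kernel K V"

sublocale Q: quotient_two_ops K F "J"
  rewrites "dendriform_quot F (J) = free_dendriform K V"
proof -
  show "quotient_two_ops K F (J)"
    by (intro quotient_two_ops.intro quotient_two_ops_axioms.intro F.two_ops_axioms)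
      (simp add: free_dendriform_kernel_def F.ideal_generated relations_closed)
qed (simp add: free_dendriform_def)

abbreviation "FD \<equiv> free_dendriform K V"

lemma relation_in_kernel: "free_dendriform_relations K V \<subseteq> J"
  unfolding free_dendriform_kernel_def by (rule ideal_generated_base)

lemma dendriform_algebra_FD: "field K \<Longrightarrow> dendriform_algebra K FD"
  by (rule Q.dendriform_algebra_Q, assumption; rule subsetD[OF relation_in_kernel],
      unfold free_dendriform_relations_def Let_def, blast)

lemma gen_closed: "v \<in> carrier V \<Longrightarrow> free_gen K V v \<in> carrier FD"
  unfolding free_gen_def by (intro Q.Q.coset_closed be_closed) simp

lemma be_Gen_closed: "v \<in> carrier V \<Longrightarrow> be (Gen v) \<in> carrier F"
  by (intro be_closed) simp

lemma gen_linear: "linear_map K V FD (free_gen K V)"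
proof (rule linear_mapI)
  fix v w assume v: "v \<in> carrier V" "w \<in> carrier V"
  have "be (Gen (v \<oplus>\<^bsub>V\<^esub> w)) \<ominus>\<^bsub>F\<^esub> (be (Gen v) \<oplus>\<^bsub>F\<^esub> be (Gen w)) \<in> J"
    by (rule subsetD[OF relation_in_kernel])
      (unfold free_dendriform_relations_def Let_def, use v in blast)
  then show "free_gen K V (v \<oplus>\<^bsub>V\<^esub> w) = free_gen K V v \<oplus>\<^bsub>FD\<^esub> free_gen K V w"
    using v by (simp add: free_gen_def Q.Q.coset_add Q.Q.coset_eq_iff be_Gen_closed)
next
  fix a v assume v: "a \<in> carrier K" "v \<in> carrier V"
  have "be (Gen (a \<odot>\<^bsub>V\<^esub> v)) \<ominus>\<^bsub>F\<^esub> (a \<odot>\<^bsub>F\<^esub> be (Gen v)) \<in> J"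
    by (rule subsetD[OF relation_in_kernel])
      (unfold free_dendriform_relations_def Let_def, use v in blast)
  then show "free_gen K V (a \<odot>\<^bsub>V\<^esub> v) = a \<odot>\<^bsub>FD\<^esub> free_gen K V v"
    using v by (simp add: free_gen_def Q.Q.coset_smult Q.Q.coset_eq_iff be_Gen_closed)
qed (rule gen_closed)

lemma FD_induct [consumes 1, case_names gen add smult prec succ]:
  assumes X: "X \<in> carrier FD"
    and gen: "\<And>v. v \<in> carrier V \<Longrightarrow> P (free_gen K V v)"
    and add: "\<And>x y. \<lbrakk>x \<in> carrier FD; y \<in> carrier FD; P x; P y\<rbrakk> \<Longrightarrow> P (x \<oplus>\<^bsub>FD\<^esub> y)"
    and smult: "\<And>a x. \<lbrakk>a \<in> carrier K; x \<in> carrier FD; P x\<rbrakk> \<Longrightarrow> P (a \<odot>\<^bsub>FD\<^esub> x)"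
    and prec: "\<And>x y. \<lbrakk>x \<in> carrier FD; y \<in> carrier FD; P x; P y\<rbrakk> \<Longrightarrow> P (x \<prec>\<^bsub>FD\<^esub> y)"
    and succ: "\<And>x y. \<lbrakk>x \<in> carrier FD; y \<in> carrier FD; P x; P y\<rbrakk> \<Longrightarrow> P (x \<succ>\<^bsub>FD\<^esub> y)"
  shows "P X"
proof -
  let ?c = "\<lambda>f. J +>\<^bsub>F\<^esub> f"
  note c = linear_mapD[OF Q.Q.linear_coset]
  interpret FD: module K FD by (rule Q.Q.module_Q)
  have basis_case: "set_dterm t \<subseteq> carrier V \<Longrightarrow> P (?c (be t))" for t
  proof (induction t)
    case (Gen v)
    then show ?case using gen[of v] by (simp add: free_gen_def)
  next
    case (Prec s t)
    then have "?c (be s) \<prec>\<^bsub>FD\<^esub> ?c (be t) = ?c (be (Prec s t))"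
      by (simp add: Q.coset_prec be_closed be_prec)
    with Prec show ?case using prec[of "?c (be s)" "?c (be t)"] by (simp add: c be_closed)
  next
    case (Succ s t)
    then have "?c (be s) \<succ>\<^bsub>FD\<^esub> ?c (be t) = ?c (be (Succ s t))"
      by (simp add: Q.coset_succ be_closed be_succ)
    with Succ show ?case using succ[of "?c (be s)" "?c (be t)"] by (simp add: c be_closed)
  qed
  \<comment> \<open>Zero is the zero multiple of a generator, so the induction rule gets by without
    a case for it.\<close>
  have P_zero: "P \<zero>\<^bsub>FD\<^esub>"
    using smult[OF R.zero_closed gen_closed gen] gen_closed M.zero_closed by fastforce
  obtain f where f: "f \<in> carrier F" "X = ?c f" using Q.Q.coset_rep X by blast
  have "P (?c f)"
    using f(1)
  proof (induction rule: F_induct)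
    case (basis t)
    then show ?case using basis_case by simp
  next
    case zero
    show ?case using P_zero by (simp add: Q.Q.zero_coset)
  next
    case (add f g)
    then show ?case using assms(3) c by simp
  next
    case (smult a f)
    then show ?case using assms(4) c by simp
  qed
  then show ?thesis using f by simp
qed

section \<open>The universal property of the free dendriform algebra\<close>

context
  fixes N :: "('k, 'b, 'n) module_scheme" and B :: "('k, 'b) aug_ops" and g :: "'v \<Rightarrow> 'b"
  assumes B: "augmented K N B" and g: "linear_map K V N g"
    and g_ker: "\<And>v. v \<in> carrier V \<Longrightarrow> aeps B (g v) = \<zero>\<^bsub>K\<^esub>"
begin

interpretation B: augmented K N B by (rule B)

private primrec ev :: "'v dterm \<Rightarrow> 'b" where
  "ev (Gen v) = g v"
| "ev (Prec s t) = ev s \<lhd>\<^bsub>B\<^esub> ev t"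
| "ev (Succ s t) = ev s \<rhd>\<^bsub>B\<^esub> ev t"

private lemma ev_closed: "set_dterm t \<subseteq> carrier V \<Longrightarrow> ev t \<in> carrier N"
  by (induction t) (simp_all add: B.aug_simps linear_mapD[OF g])

private lemma eps_ev: "set_dterm t \<subseteq> carrier V \<Longrightarrow> aeps B (ev t) = \<zero>\<^bsub>K\<^esub>"
  by (cases t) (simp_all add: B.aug_simps g_ker ev_closed)

private abbreviation "\<phi> \<equiv> free_lift K N ev"

private lemma phi_linear: "linear_map K F N \<phi>"
proof -
  have "linear_map K FM N \<phi>"
    by (rule R.linear_free_lift[OF B.module_axioms]) (use ev_closed in auto)
  then show ?thesis by (simp add: linear_map_def F_simps)
qed

private lemmas phi = linear_mapD[OF phi_linear]
  linear_map_zero[OF F.module_axioms B.module_axioms phi_linear]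
  linear_map_minus[OF F.module_axioms B.module_axioms phi_linear]

private lemma phi_basis: "set_dterm t \<subseteq> carrier V \<Longrightarrow> \<phi> (be t) = ev t"
  by (rule R.free_lift_basis[OF B.module_axioms, of _ Tm]) (use ev_closed in auto)

private lemma phi_hom: "dend_hom K F N B \<phi>"
proof -
  note [simp] = phi phi_basis be_closed eps_ev ev_closed B.aug_simps F.dop_simps
    bilinear_map_zero[OF F.module_axioms F.module_axioms F.module_axioms F.dprec_bilin]
    bilinear_map_zero[OF F.module_axioms F.module_axioms F.module_axioms F.dsucc_bilin]
  have "aeps B (\<phi> x) = \<zero>\<^bsub>K\<^esub>" if "x \<in> carrier F" for x
    using that by (induction rule: F_induct) simp_all
  moreover have "\<phi> (x \<prec>\<^bsub>F\<^esub> y) = \<phi> x \<lhd>\<^bsub>B\<^esub> \<phi> y \<and> \<phi> (x \<succ>\<^bsub>F\<^esub> y) = \<phi> x \<rhd>\<^bsub>B\<^esub> \<phi> y"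
    if x: "x \<in> carrier F" and y: "y \<in> carrier F" for x y
    using x
  proof (induction rule: F_induct)
    case (basis s)
    show ?case
      using y by (induction rule: F_induct) (use basis in \<open>simp_all add: be_prec be_succ\<close>)
  qed (use y in simp_all)
  ultimately show ?thesis
    by (simp add: dend_hom_def phi_linear)
qed

text \<open>The values of \<phi> have augmentation 0, so \<open>star_eq\<close> loses its unit term
  on them and the axioms of B become the ordinary dendriform relations.\<close>

private lemma phi_kernel:
  assumes "x \<in> J"
  shows "\<phi> x = \<zero>\<^bsub>N\<^esub>"
proof -
  have r: "z \<ominus>\<^bsub>N\<^esub> z = \<zero>\<^bsub>N\<^esub>" if "z \<in> carrier N" for z
    using that by (simp add: a_minus_def B.M.r_neg)
  note [simp] = phi phi_basis be_closed ev_closed dend_homD[OF phi_hom] B.aug_simps F.dop_simps r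
    linear_mapD[OF g] B.star_eq B.prec_prec B.succ_prec B.succ_succ
  have "\<phi> x = \<zero>\<^bsub>N\<^esub>" if "x \<in> free_dendriform_relations K V" for x
    using that unfolding free_dendriform_relations_def Let_def
    by (elim UnE CollectE exE conjE) (simp_all add: B.M.a_comm)
  then have "free_dendriform_relations K V \<subseteq> {x \<in> carrier F. \<phi> x = \<zero>\<^bsub>N\<^esub>}"
    using relations_closed by blast
  from ideal_generated_least[OF F.dend_hom_kernel_ideal[OF B phi_hom] this] assms
  show ?thesis by (auto simp: free_dendriform_kernel_def)
qed

theorem free_dendriform_universal:
  "\<exists>f. dend_hom K FD N B f \<and> (\<forall>v\<in>carrier V. f (free_gen K V v) = g v)"
proof (intro exI conjI ballI)
  show "dend_hom K FD N B (\<lambda>X. the_elem (\<phi> ` X))"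
    by (rule Q.dend_hom_quot(1)[OF B.module_axioms phi_hom phi_kernel])
  show "the_elem (\<phi> ` free_gen K V v) = g v" if "v \<in> carrier V" for v
    using Q.dend_hom_quot(2)[OF B.module_axioms phi_hom phi_kernel be_closed] that
    by (simp add: free_gen_def phi_basis)
qed

end

end

section \<open>Unitization\<close>

lemma unitization_simps:
  "carrier (unitization K D) = carrier K \<times> carrier D"
  "zero (unitization K D) = (\<zero>\<^bsub>K\<^esub>, \<zero>\<^bsub>D\<^esub>)"
  "one (unitization K D) = (\<one>\<^bsub>K\<^esub>, \<zero>\<^bsub>D\<^esub>)"
  "vpart (unitization K D) = {\<zero>\<^bsub>K\<^esub>} \<times> carrier D"
  "(a, x) \<oplus>\<^bsub>unitization K D\<^esub> (b, y) = (a \<oplus>\<^bsub>K\<^esub> b, x \<oplus>\<^bsub>D\<^esub> y)"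
  "c \<odot>\<^bsub>unitization K D\<^esub> (a, x) = (c \<otimes>\<^bsub>K\<^esub> a, c \<odot>\<^bsub>D\<^esub> x)"
  "(a, x) \<otimes>\<^bsub>unitization K D\<^esub> (b, y) =
    (a \<otimes>\<^bsub>K\<^esub> b, (a \<odot>\<^bsub>D\<^esub> y \<oplus>\<^bsub>D\<^esub> b \<odot>\<^bsub>D\<^esub> x) \<oplus>\<^bsub>D\<^esub> (x \<prec>\<^bsub>D\<^esub> y \<oplus>\<^bsub>D\<^esub> x \<succ>\<^bsub>D\<^esub> y))"
  "(a, x) \<prec>\<^bsub>unitization K D\<^esub> (b, y) = (\<zero>\<^bsub>K\<^esub>, b \<odot>\<^bsub>D\<^esub> x \<oplus>\<^bsub>D\<^esub> x \<prec>\<^bsub>D\<^esub> y)"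
  "(a, x) \<succ>\<^bsub>unitization K D\<^esub> (b, y) = (\<zero>\<^bsub>K\<^esub>, a \<odot>\<^bsub>D\<^esub> y \<oplus>\<^bsub>D\<^esub> x \<succ>\<^bsub>D\<^esub> y)"
  by (simp_all add: unitization_def)

definition unit_ops ::
  "('k, 'r) ring_scheme \<Rightarrow> ('k, 'a, 'm) dendriform_scheme \<Rightarrow> ('k, 'k \<times> 'a) aug_ops"
  where "unit_ops K D = (let W = unitization K D in
    \<lparr>aone = one W, astar = mult W, aprec = dprec W, asucc = dsucc W, aeps = fst\<rparr>)"

lemma unit_ops_simps:
  "aone (unit_ops K D) = one (unitization K D)" "astar (unit_ops K D) = mult (unitization K D)"
  "aprec (unit_ops K D) = dprec (unitization K D)" "asucc (unit_ops K D) = dsucc (unitization K D)"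
  "aeps (unit_ops K D) = fst"
  by (simp_all add: unit_ops_def Let_def)

locale unitized = D: dendriform_algebra K D
  for K :: "('k, 'r) ring_scheme" and D :: "('k, 'a, 'm) dendriform_scheme"
begin

abbreviation "W \<equiv> unitization K D"
abbreviation "A \<equiv> unit_ops K D"

lemmas dops = bilinear_mapD[OF D.dprec_bilinear] bilinear_mapD[OF D.dsucc_bilinear]
  bilinear_map_zero[OF D.module_axioms D.module_axioms D.module_axioms D.dprec_bilinear]
  bilinear_map_zero[OF D.module_axioms D.module_axioms D.module_axioms D.dsucc_bilinear]

lemmas sm = D.smult_r_distr D.smult_l_distr D.smult_assoc1[symmetric]

lemma K_l_neg: "a \<in> carrier K \<Longrightarrow> \<ominus>\<^bsub>K\<^esub> a \<oplus>\<^bsub>K\<^esub> a = \<zero>\<^bsub>K\<^esub>"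
  by (rule abelian_group.l_neg[OF ring.is_abelian_group[OF D.is_ring]])

lemmas K_a_ac = abelian_monoid.a_ac[OF abelian_group.axioms(1)[OF ring.is_abelian_group[OF D.is_ring]]]

lemma module_W: "module K W"
proof (rule moduleI)
  show "cring K" by (rule D.is_cring)
  show "abelian_group W"
  proof (rule abelian_groupI)
    show "\<exists>y\<in>carrier W. y \<oplus>\<^bsub>W\<^esub> x = \<zero>\<^bsub>W\<^esub>" if "x \<in> carrier W" for x
      by (rule bexI[of _ "(\<ominus>\<^bsub>K\<^esub> fst x, \<ominus>\<^bsub>D\<^esub> snd x)"])
        (use that in \<open>auto simp: unitization_simps K_l_neg D.M.l_neg\<close>)
  qed (auto simp: unitization_simps K_a_ac D.M.a_ac)
qed (auto simp: unitization_simps sm D.l_distr D.r_distr D.m_assoc)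

lemma W_bilinear:
  "bilinear_map K W W W (dprec W)" "bilinear_map K W W W (dsucc W)" "bilinear_map K W W W (mult W)"
  by (rule bilinear_mapI;
      auto simp: unitization_simps dops sm D.l_distr D.r_distr K_a_ac D.m_ac D.M.a_ac)+

lemma augmented_W: "augmented K W A"
  by (intro augmented.intro augmented_axioms.intro module_W)
    (auto simp: unit_ops_simps W_bilinear unitization_simps dops sm K_a_ac D.m_ac D.M.a_ac
      D.l_distr D.r_distr D.prec_prec D.succ_prec D.succ_succ)

lemma unital_W: "unital_dendriform_algebra K W"
proof -
  interpret A: augmented K W A by (rule augmented_W)
  let ?V = "W\<lparr>carrier := vpart W\<rparr>"
  have sub: "submodule (vpart W) K W"
  proof -
    have uminus: "\<ominus>\<^bsub>W\<^esub> (a, x) = (\<ominus>\<^bsub>K\<^esub> a, \<ominus>\<^bsub>D\<^esub> x)" if "a \<in> carrier K" "x \<in> carrier D" for a x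
      by (rule A.M.minus_equality) (use that in \<open>simp_all add: unitization_simps K_l_neg D.M.l_neg\<close>)
    show ?thesis
      by (rule A.submoduleI) (auto simp: unitization_simps uminus)
  qed
  have V: "carrier ?V = {\<zero>\<^bsub>K\<^esub>} \<times> carrier D" by (simp add: unitization_simps)
  have dV: "dendriform_algebra K ?V"
  proof (intro dendriform_algebra.intro dendriform_algebra_axioms.intro)
    show "module K ?V" by (rule submodule.submodule_is_module[OF sub module_W])
    show "bilinear_map K ?V ?V ?V (dprec ?V)" "bilinear_map K ?V ?V ?V (dsucc ?V)"
      by (rule bilinear_mapI; auto simp: unitization_simps dops sm D.M.a_ac)+
  qed (auto simp: unitization_simps dops D.field_axioms D.prec_prec D.succ_prec D.succ_succ D.M.a_ac)
  have ex1: "\<exists>!p. p \<in> carrier K \<times> vpart W \<and> w = fst p \<odot>\<^bsub>W\<^esub> \<one>\<^bsub>W\<^esub> \<oplus>\<^bsub>W\<^esub> snd p" if "w \<in> carrier W" for w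
  proof (rule ex1I[of _ "(fst w, (\<zero>\<^bsub>K\<^esub>, snd w))"])
    fix p assume "p \<in> carrier K \<times> vpart W \<and> w = fst p \<odot>\<^bsub>W\<^esub> \<one>\<^bsub>W\<^esub> \<oplus>\<^bsub>W\<^esub> snd p"
    then show "p = (fst w, (\<zero>\<^bsub>K\<^esub>, snd w))" by (cases p) (auto simp: unitization_simps)
  qed (use that in \<open>auto simp: unitization_simps\<close>)
  show ?thesis
    using sub dV ex1
    by (intro unital_dendriform_algebra.intro unital_dendriform_algebra_axioms.intro
        module_W D.field_axioms W_bilinear)
      (auto simp: unitization_simps dops sm K_a_ac D.m_ac D.M.a_ac D.l_distr D.r_distr
        intro!: bilinear_mapI)
qed

lemma counit_proj_W: "w \<in> carrier W \<Longrightarrow> counit_proj K W w = fst w"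
  unfolding counit_proj_def
  by (rule the_equality) (auto simp: unitization_simps)

sublocale aug: augmented K W A
  by (rule augmented_W)

lemma aug_ker_W: "aug.aug_ker = {\<zero>\<^bsub>K\<^esub>} \<times> carrier D"
  by (auto simp: aug.aug_ker_def unitization_simps unit_ops_simps)

lemma incl_linear: "linear_map K D W (Pair \<zero>\<^bsub>K\<^esub>)"
  by (rule linear_mapI) (auto simp: unitization_simps)

section \<open>Comparison with the brace of the underlying dendriform algebra\<close>

abbreviation "incls \<equiv> map (Pair \<zero>\<^bsub>K\<^esub>)"

lemma incl_ops:
  "\<lbrakk>x \<in> carrier D; y \<in> carrier D\<rbrakk> \<Longrightarrow> (\<zero>\<^bsub>K\<^esub>, x) \<lhd>\<^bsub>A\<^esub> (\<zero>\<^bsub>K\<^esub>, y) = (\<zero>\<^bsub>K\<^esub>, x \<prec>\<^bsub>D\<^esub> y)"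
  "\<lbrakk>x \<in> carrier D; y \<in> carrier D\<rbrakk> \<Longrightarrow> (\<zero>\<^bsub>K\<^esub>, x) \<rhd>\<^bsub>A\<^esub> (\<zero>\<^bsub>K\<^esub>, y) = (\<zero>\<^bsub>K\<^esub>, x \<succ>\<^bsub>D\<^esub> y)"
  by (simp_all add: unit_ops_simps unitization_simps dops)

lemma incl_ker: "x \<in> carrier D \<Longrightarrow> (\<zero>\<^bsub>K\<^esub>, x) \<in> aug.aug_ker"
  by (simp add: aug_ker_W)

lemma incl_unit:
  "x \<in> carrier D \<Longrightarrow> (\<zero>\<^bsub>K\<^esub>, x) \<lhd>\<^bsub>A\<^esub> aone A = (\<zero>\<^bsub>K\<^esub>, x)"
  "x \<in> carrier D \<Longrightarrow> aone A \<rhd>\<^bsub>A\<^esub> (\<zero>\<^bsub>K\<^esub>, x) = (\<zero>\<^bsub>K\<^esub>, x)"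
  using aug.prec_one_ker aug.one_succ_ker aug.aug_kerD[OF incl_ker] by simp_all

text \<open>The innermost step x \<prec> 1 = x absorbs the unit at the end of the left comb.\<close>

lemma nearrow_incl:
  "\<lbrakk>us \<noteq> []; set us \<subseteq> carrier D\<rbrakk> \<Longrightarrow>
    nearrow D us \<in> carrier D \<and> left_comb A (incls us) = (\<zero>\<^bsub>K\<^esub>, nearrow D us)"
proof (induction us)
  case (Cons x us)
  then show ?case by (cases us) (simp_all add: incl_unit incl_ops dops)
qed simp

lemma searrow_incl:
  assumes "vs \<noteq> []" "set vs \<subseteq> carrier D"
  shows "searrow D vs \<in> carrier D \<and> right_comb A (incls vs) = (\<zero>\<^bsub>K\<^esub>, searrow D vs)"
proof -
  \<comment> \<open>The start value is generalized: after the first step 1 \<succ> x = x, the right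
    comb folds from x instead of from the unit.\<close>
  have fold: "\<lbrakk>z \<in> carrier D; set xs \<subseteq> carrier D\<rbrakk> \<Longrightarrow> foldl (dsucc D) z xs \<in> carrier D \<and>
      foldl (asucc A) (\<zero>\<^bsub>K\<^esub>, z) (incls xs) = (\<zero>\<^bsub>K\<^esub>, foldl (dsucc D) z xs)" for z xs
    by (induction xs arbitrary: z) (simp_all add: incl_ops dops)
  obtain x xs where "vs = x # xs" using assms(1) by (cases vs) auto
  then show ?thesis
    using assms(2) fold[of x xs] by (simp add: right_comb_def incl_unit)
qed

lemma arrow_incl:
  assumes "set us \<subseteq> carrier D" "x \<in> carrier D" "set vs \<subseteq> carrier D"
  shows "arrow_term D us x vs \<in> carrier D"
    and "aug_arrow A (incls us) (\<zero>\<^bsub>K\<^esub>, x) (incls vs) = (\<zero>\<^bsub>K\<^esub>, arrow_term D us x vs)"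
proof -
  define l where "l = (if us = [] then x else nearrow D us \<succ>\<^bsub>D\<^esub> x)"
  have l: "l \<in> carrier D" "left_comb A (incls us) \<rhd>\<^bsub>A\<^esub> (\<zero>\<^bsub>K\<^esub>, x) = (\<zero>\<^bsub>K\<^esub>, l)"
    using nearrow_incl[of us] assms by (auto simp: l_def incl_unit incl_ops dops)
  have eq: "arrow_term D us x vs = (if vs = [] then l else l \<prec>\<^bsub>D\<^esub> searrow D vs)"
    by (simp add: arrow_term_def l_def)
  show "arrow_term D us x vs \<in> carrier D"
    and "aug_arrow A (incls us) (\<zero>\<^bsub>K\<^esub>, x) (incls vs) = (\<zero>\<^bsub>K\<^esub>, arrow_term D us x vs)"
    using searrow_incl[of vs] assms(3) l unfolding eq aug_arrow_def
    by (auto simp: incl_unit incl_ops dops)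
qed

lemma dendriform_brace_closed:
  assumes "x \<in> carrier D" "set ys \<subseteq> carrier D"
  shows "dendriform_brace K D x ys \<in> carrier D"
  unfolding dendriform_brace_def
  by (intro D.M.finsum_closed Pi_I D.smult_closed aug.alt_sign_closed arrow_incl(1)
      set_take_drop_subset assms)

lemma brace_incl:
  assumes "x \<in> carrier D" "set ys \<subseteq> carrier D"
  shows "aug_brace K W A (\<zero>\<^bsub>K\<^esub>, x) (incls ys) = (\<zero>\<^bsub>K\<^esub>, dendriform_brace K D x ys)"
proof -
  have cl: "alt_sign K i \<odot>\<^bsub>D\<^esub> arrow_term D (take i ys) x (drop i ys) \<in> carrier D" for i
    by (intro D.smult_closed aug.alt_sign_closed arrow_incl(1) set_take_drop_subset assms)
  have "(\<zero>\<^bsub>K\<^esub>, dendriform_brace K D x ys) = (\<Oplus>\<^bsub>W\<^esub>i\<in>{..length ys}.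
      (\<zero>\<^bsub>K\<^esub>, alt_sign K i \<odot>\<^bsub>D\<^esub> arrow_term D (take i ys) x (drop i ys)))"
    unfolding dendriform_brace_def
    by (rule linear_map_finsum[OF D.module_axioms module_W incl_linear]) (use cl in simp)
  also have "\<dots> = aug_brace K W A (\<zero>\<^bsub>K\<^esub>, x) (incls ys)"
    unfolding aug_brace_def length_map
  proof (rule aug.M.finsum_cong'[OF refl, symmetric])
    fix i
    show "alt_sign K i \<odot>\<^bsub>W\<^esub> aug_arrow A (take i (incls ys)) (\<zero>\<^bsub>K\<^esub>, x) (drop i (incls ys)) =
        (\<zero>\<^bsub>K\<^esub>, alt_sign K i \<odot>\<^bsub>D\<^esub> arrow_term D (take i ys) x (drop i ys))"
      unfolding take_map drop_map
      using arrow_incl(2)[OF set_take_drop_subset(1)[OF assms(2), of i] assms(1)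
          set_take_drop_subset(2)[OF assms(2), of i]]
      by (simp add: unitization_simps)
  qed (use cl in \<open>auto simp: unitization_simps\<close>)
  finally show ?thesis by simp
qed

text \<open>Multiplicativity in products with 1 rests on f x having augmentation 0, which gives f x
  \<prec> 1 = f x and 1 \<succ> f x = f x.\<close>

lemma unit_extension:
  assumes "augmented K N B" "dend_hom K D N B f"
  shows "aug_hom K W A N B (\<lambda>(a, x). a \<odot>\<^bsub>N\<^esub> aone B \<oplus>\<^bsub>N\<^esub> f x)"
    and "x \<in> carrier D \<Longrightarrow> (\<lambda>(a, x). a \<odot>\<^bsub>N\<^esub> aone B \<oplus>\<^bsub>N\<^esub> f x) (\<zero>\<^bsub>K\<^esub>, x) = f x"
proof -
  interpret B: augmented K N B by fact
  note f = dend_homD[OF assms(2)] linear_mapD[OF dend_homD(1)[OF assms(2)]]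
    linear_map_zero[OF D.module_axioms B.module_axioms dend_homD(1)[OF assms(2)]]
  let ?h = "\<lambda>(a, x). a \<odot>\<^bsub>N\<^esub> aone B \<oplus>\<^bsub>N\<^esub> f x"
  have "linear_map K W N ?h"
    by (rule linear_mapI)
      (auto simp: unitization_simps f B.one_closed B.smult_l_distr B.smult_r_distr
        B.smult_assoc1[symmetric] B.M.a_ac)
  moreover have "f x \<lhd>\<^bsub>B\<^esub> aone B = f x" "aone B \<rhd>\<^bsub>B\<^esub> f x = f x" if "x \<in> carrier D" for x
    using that by (simp_all add: f B.prec_one_ker B.one_succ_ker)
  ultimately show "aug_hom K W A N B ?h"
    by (auto simp: aug_hom_def unitization_simps unit_ops_simps f B.aug_simps dops B.M.a_ac)
  show "?h (\<zero>\<^bsub>K\<^esub>, x) = f x" if "x \<in> carrier D"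
    using that by (simp add: f B.one_closed)
qed

lemma W_split:
  assumes "w \<in> carrier W"
  shows "w = fst w \<odot>\<^bsub>W\<^esub> aone A \<oplus>\<^bsub>W\<^esub> (\<zero>\<^bsub>K\<^esub>, snd w)" "fst w \<in> carrier K" "snd w \<in> carrier D"
  using assms by (auto simp: unit_ops_simps unitization_simps)

lemma aug_hom_eq_on_W:
  assumes "aug_hom K W A N B f" "aug_hom K W A N B g"
    and "\<And>x. x \<in> carrier D \<Longrightarrow> f (\<zero>\<^bsub>K\<^esub>, x) = g (\<zero>\<^bsub>K\<^esub>, x)" and w: "w \<in> carrier W"
  shows "f w = g w"
proof -
  note f = aug_homD(2)[OF assms(1)] linear_mapD[OF aug_homD(1)[OF assms(1)]]
  note g = aug_homD(2)[OF assms(2)] linear_mapD[OF aug_homD(1)[OF assms(2)]]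
  have i: "(\<zero>\<^bsub>K\<^esub>, snd w) \<in> carrier W" using W_split(3)[OF w] by (simp add: unitization_simps)
  have "f (fst w \<odot>\<^bsub>W\<^esub> aone A \<oplus>\<^bsub>W\<^esub> (\<zero>\<^bsub>K\<^esub>, snd w)) = g (fst w \<odot>\<^bsub>W\<^esub> aone A \<oplus>\<^bsub>W\<^esub> (\<zero>\<^bsub>K\<^esub>, snd w))"
    using W_split(2,3)[OF w] i by (simp add: f g assms(3) aug.one_closed)
  then show ?thesis by (simp only: W_split(1)[OF w, symmetric])
qed

end

section \<open>Coproducts\<close>

context augmented
begin

lemma vee_bilinear:
  "p \<in> carrier M \<Longrightarrow> bilinear_map K M M M (\<lambda>x y. (x \<rhd>\<^bsub>A\<^esub> p) \<lhd>\<^bsub>A\<^esub> y)"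
  by (rule bilinear_mapI) (simp_all add: aug_simps)

context
begin

interpretation S: augmented_pair K M A M A
  by (intro augmented_pair.intro augmented_axioms)
interpretation SA: augmented K S.T S.AB
  by (rule S.augmented_tensor)

text \<open>With s = \<Delta> x and t = \<Delta> y this is the recursion for the coproduct of x
  \<succ> p \<prec> y. In s \<succ> (p \<otimes> 1) only the correction survives and gives the term
  ending in \<otimes> 1; in s \<succ> (1 \<otimes> p) only the main term survives.\<close>

lemma vee_prim:
  assumes p: "p \<in> aug_ker" and st: "s \<in> carrier S.T" "t \<in> carrier S.T"
  shows "(s \<rhd>\<^bsub>S.AB\<^esub> prim p) \<lhd>\<^bsub>S.AB\<^esub> t =
    S.pure ((S.\<rho> s \<rhd>\<^bsub>A\<^esub> p) \<lhd>\<^bsub>A\<^esub> S.\<rho> t) (aone A) \<oplus>\<^bsub>S.T\<^esub>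
    tensor_op2 K M M (astar A) (\<lambda>x y. (x \<rhd>\<^bsub>A\<^esub> p) \<lhd>\<^bsub>A\<^esub> y) s t"
proof -
  note p = aug_kerD[OF p] prim_closed[OF aug_kerD(1)[OF p]]
  note b = bilinear_mapD[OF S.tensor_op2_bilinear[OF star_bilinear vee_bilinear[OF p(1)]]]
  note d = bilinear_mapD[OF SA.vee_bilinear[OF p(3)]]
  show ?thesis
    using st
  proof (induction rule: S.tensor_induct2)
    case (pure x y x' y')
    then show ?case
      using p(1,2)
      by (simp add: S.tensor_bilinears S.pure_AB S.rho_simps SA.a_ac SA.smult_assoc1[symmetric]
          S.tensor_op2_pure[OF star_bilinear vee_bilinear[OF p(1)]] one_star star_one R.m_comm)
  next
    case (addl s s' t)
    show ?case
      unfolding d(2)[OF addl.hyps] addl.IH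
      using addl.hyps p(1) by (simp add: b S.rho_simps S.pure_simps aug_simps SA.a_ac)
  next
    case (addr s t t')
    show ?case
      unfolding d(3)[OF addr.hyps] addr.IH
      using addr.hyps p(1) by (simp add: b S.rho_simps S.pure_simps aug_simps SA.a_ac)
  qed
qed

end

end

context unitized
begin

context
begin

interpretation S: augmented_pair K W A W A
  by (intro augmented_pair.intro augmented_W)

text \<open>Multiplicativity of \<Delta> into \<open>tensor_aug\<close> has the correction where the
  bialgebra axioms have (x \<prec> y) \<otimes> 1 and (x \<succ> y) \<otimes> 1; the right counit
  law identifies the two.\<close>

lemma dendriform_bialgebraI:
  assumes hom: "aug_hom K W A S.T S.AB \<Delta>"
    and coassoc: "\<And>w. w \<in> carrier W \<Longrightarrow>
      tensor_assoc K W (tensor_map K S.T W \<Delta> (\<lambda>x. x) (\<Delta> w)) =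
      tensor_map K W S.T (\<lambda>x. x) \<Delta> (\<Delta> w)"
    and left: "\<And>w. w \<in> carrier W \<Longrightarrow> eps_left K A W (\<Delta> w) = w"
    and right: "\<And>w. w \<in> carrier W \<Longrightarrow> eps_right K W A (\<Delta> w) = w"
  shows "dendriform_bialgebra K W \<Delta>"
proof (intro dendriform_bialgebra.intro dendriform_bialgebra_axioms.intro)
  note h = aug_homD[OF hom] linear_mapD[OF aug_homD(1)[OF hom]]
  have cl: "\<And>x. x \<in> carrier W \<Longrightarrow> fst x \<in> carrier K"
    "\<And>x y. \<lbrakk>x \<in> carrier W; y \<in> carrier W\<rbrakk> \<Longrightarrow> fst (x \<oplus>\<^bsub>W\<^esub> y) = fst x \<oplus>\<^bsub>K\<^esub> fst y"
    "\<And>a x. \<lbrakk>a \<in> carrier K; x \<in> carrier W\<rbrakk> \<Longrightarrow> fst (a \<odot>\<^bsub>W\<^esub> x) = a \<otimes>\<^bsub>K\<^esub> fst x"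
    using aug.eps_closed aug.eps_add aug.eps_smult by (simp_all add: unit_ops_simps)
  show "unital_dendriform_algebra K W" by (rule unital_W)
  show "linear_map K W S.T \<Delta>" by (rule h(1))
  show "\<Delta> \<one>\<^bsub>W\<^esub> = S.pure \<one>\<^bsub>W\<^esub> \<one>\<^bsub>W\<^esub>"
    using h(2) by (simp add: S.one_AB unit_ops_simps)
  fix w assume w: "w \<in> carrier W"
  have l: "bilinear_map K W W W (\<lambda>x y. counit_proj K W x \<odot>\<^bsub>W\<^esub> y)"
    by (rule bilinear_mapI)
      (simp_all add: counit_proj_W cl aug.smult_l_distr aug.smult_r_distr
        aug.smult_assoc1[symmetric] D.m_comm)
  have r: "bilinear_map K W W W (\<lambda>x y. counit_proj K W y \<odot>\<^bsub>W\<^esub> x)"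
    by (rule bilinear_map_flip[OF l])
  \<comment> \<open>\<open>counit_proj\<close>, a definite description, is known to agree with
    \<open>fst\<close> on the carrier, so the two lifts are compared on pure tensors.\<close>
  have "tensor_lift K W (\<lambda>x y. counit_proj K W x \<odot>\<^bsub>W\<^esub> y) (\<Delta> w) = eps_left K A W (\<Delta> w)"
    by (rule S.linear_eqI[OF S.tensor_lift_linear[OF module_W l] S.lam_linear])
      (simp_all add: S.tensor_lift_pure[OF module_W l] S.lam_pure counit_proj_W unit_ops_simps h w)
  then show "tensor_lift K W (\<lambda>x y. counit_proj K W x \<odot>\<^bsub>W\<^esub> y) (\<Delta> w) = w"
    using left[OF w] by simp
  have "tensor_lift K W (\<lambda>x y. counit_proj K W y \<odot>\<^bsub>W\<^esub> x) (\<Delta> w) = eps_right K W A (\<Delta> w)"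
    by (rule S.linear_eqI[OF S.tensor_lift_linear[OF module_W r] S.rho_linear])
      (simp_all add: S.tensor_lift_pure[OF module_W r] S.rho_pure counit_proj_W unit_ops_simps h w)
  then show "tensor_lift K W (\<lambda>x y. counit_proj K W y \<odot>\<^bsub>W\<^esub> x) (\<Delta> w) = w"
    using right[OF w] by simp
next
  note h = aug_homD[OF hom]
  fix x y assume "x \<in> vpart W" "y \<in> vpart W"
  then have x: "x \<in> carrier W" "y \<in> carrier W" by (auto simp: unitization_simps)
  show "\<Delta> (x \<succ>\<^bsub>W\<^esub> y) = tensor_op K W (mult W) (dsucc W) (\<Delta> x) (\<Delta> y)
      \<oplus>\<^bsub>S.T\<^esub> S.pure (x \<succ>\<^bsub>W\<^esub> y) \<one>\<^bsub>W\<^esub>"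
    and "\<Delta> (x \<prec>\<^bsub>W\<^esub> y) = tensor_op K W (mult W) (dprec W) (\<Delta> x) (\<Delta> y)
      \<oplus>\<^bsub>S.T\<^esub> S.pure (x \<prec>\<^bsub>W\<^esub> y) \<one>\<^bsub>W\<^esub>"
    using h(4,5)[OF x] right x
    by (simp_all add: tensor_aug_def unit_ops_simps tensor_op_eq)
qed (rule coassoc)

text \<open>Both sides of coassociativity are homomorphisms into the same augmented structure, so
  they can be compared on generators.\<close>

lemma coassoc_homs:
  assumes hom: "aug_hom K W A S.T S.AB \<Delta>"
  shows "aug_hom K W A (tensor K W S.T) (tensor_aug K W A S.T S.AB)
      (\<lambda>w. tensor_assoc K W (tensor_map K S.T W \<Delta> (\<lambda>x. x) (\<Delta> w)))"
    and "aug_hom K W A (tensor K W S.T) (tensor_aug K W A S.T S.AB)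
      (\<lambda>w. tensor_map K W S.T (\<lambda>x. x) \<Delta> (\<Delta> w))"
proof -
  have L: "augmented_pair K S.T S.AB W A"
    and R: "augmented_pair K W A S.T S.AB"
    by (intro augmented_pair.intro S.augmented_tensor augmented_W)+
  show "aug_hom K W A (tensor K W S.T) (tensor_aug K W A S.T S.AB)
      (\<lambda>w. tensor_assoc K W (tensor_map K S.T W \<Delta> (\<lambda>x. x) (\<Delta> w)))"
    by (rule aug_hom_comp[OF aug_hom_comp[OF hom S.tensor_map_hom[OF L hom aug_hom_id]] aug.assoc_hom])
  show "aug_hom K W A (tensor K W S.T) (tensor_aug K W A S.T S.AB)
      (\<lambda>w. tensor_map K W S.T (\<lambda>x. x) \<Delta> (\<Delta> w))"
    by (rule aug_hom_comp[OF hom S.tensor_map_hom[OF R aug_hom_id hom]])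
qed

text \<open>Both sides equal x \<otimes> 1 \<otimes> 1 + 1 \<otimes> x \<otimes> 1 + 1 \<otimes> 1
  \<otimes> x.\<close>

lemma coassoc_prim:
  assumes hom: "aug_hom K W A S.T S.AB \<Delta>"
    and x: "x \<in> carrier W" and prim: "\<Delta> x = aug.prim x"
  shows "tensor_assoc K W (tensor_map K S.T W \<Delta> (\<lambda>x. x) (\<Delta> x)) =
      tensor_map K W S.T (\<lambda>x. x) \<Delta> (\<Delta> x)"
proof -
  interpret L: augmented_pair K S.T S.AB W A
    by (intro augmented_pair.intro S.augmented_tensor augmented_W)
  interpret R: augmented_pair K W A S.T S.AB
    by (intro augmented_pair.intro S.augmented_tensor augmented_W)
  interpret LT: augmented K L.T L.AB by (rule L.augmented_tensor)
  interpret RT: augmented K R.T R.AB by (rule R.augmented_tensor)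
  note h = aug_homD[OF hom]
  note l = S.tensor_map_linear[OF L.tensor_product_axioms h(1) linear_map_id]
    and r = S.tensor_map_linear[OF R.tensor_product_axioms linear_map_id h(1)]
  show ?thesis
    using x aug.one_closed
    by (simp add: prim h(2) S.one_AB linear_mapD[OF l(1)] linear_mapD[OF r(1)] l(2) r(2)
        S.pure_simps L.pure_simps R.pure_simps linear_mapD[OF aug.assoc_linear] aug.assoc_pure RT.a_ac)
qed

end

end

subsection \<open>The coproduct on the free algebra\<close>

text \<open>This span is everything, which makes the coproduct described in \<^const>\<open>free_coproduct\<close> unique.\<close>

inductive_set vee_span ::
  "('k, 'r) ring_scheme \<Rightarrow> ('k, 'v, 'm) module_scheme \<Rightarrow> ('k \<times> ('v dterm \<Rightarrow> 'k) set) set"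
  for K V where
  one: "\<one>\<^bsub>unitization K (free_dendriform K V)\<^esub> \<in> vee_span K V"
| vee: "\<lbrakk>v \<in> carrier V; x \<in> vee_span K V; y \<in> vee_span K V\<rbrakk> \<Longrightarrow> vee K V v x y \<in> vee_span K V"
| add: "\<lbrakk>x \<in> vee_span K V; y \<in> vee_span K V\<rbrakk> \<Longrightarrow>
    x \<oplus>\<^bsub>unitization K (free_dendriform K V)\<^esub> y \<in> vee_span K V"
| smult: "\<lbrakk>a \<in> carrier K; x \<in> vee_span K V\<rbrakk> \<Longrightarrow>
    a \<odot>\<^bsub>unitization K (free_dendriform K V)\<^esub> x \<in> vee_span K V"

lemmas (in free_dend) K_zero_closed = R.zero_closed
lemmas (in free_dend) K_uminus_closed = R.a_inv_closed

locale free_unital = field K + free_dend K V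
  for K :: "('k, 'r) ring_scheme" and V :: "('k, 'v, 'm) module_scheme"
begin

sublocale U: unitized K FD
  by (intro unitized.intro dendriform_algebra_FD field_axioms)

abbreviation "gen v \<equiv> (\<zero>\<^bsub>K\<^esub>, free_gen K V v)"

lemma gen_in_ker: "v \<in> carrier V \<Longrightarrow> gen v \<in> U.aug.aug_ker"
  by (simp add: U.incl_ker gen_closed)

lemmas gen_in_W = U.aug.aug_kerD(1)[OF gen_in_ker]

lemma vee_eq: "vee K V v x y = (x \<rhd>\<^bsub>U.A\<^esub> gen v) \<lhd>\<^bsub>U.A\<^esub> y"
  by (simp add: vee_def unit_ops_simps Let_def)

lemma vee_closed:
  "\<lbrakk>v \<in> carrier V; x \<in> carrier U.W; y \<in> carrier U.W\<rbrakk> \<Longrightarrow> vee K V v x y \<in> carrier U.W"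
  by (simp add: vee_eq U.aug.aug_simps gen_in_W)

lemma aone_A: "aone U.A = \<one>\<^bsub>U.W\<^esub>"
  by (simp add: unit_ops_simps)

lemma vee_span_closed: "x \<in> vee_span K V \<Longrightarrow> x \<in> carrier U.W"
  by (induction rule: vee_span.induct)
    (simp_all add: vee_closed U.aug.one_closed[unfolded aone_A])

lemma vee_span_zero: "\<zero>\<^bsub>U.W\<^esub> \<in> vee_span K V"
  using vee_span.smult[OF K_zero_closed vee_span.one, of V] U.aug.one_closed by (simp add: aone_A)

lemma vee_span_star:
  assumes "x \<in> vee_span K V" "y \<in> vee_span K V"
    "x \<lhd>\<^bsub>U.A\<^esub> y \<in> vee_span K V" "x \<rhd>\<^bsub>U.A\<^esub> y \<in> vee_span K V"
  shows "x \<star>\<^bsub>U.A\<^esub> y \<in> vee_span K V"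
  unfolding U.aug.star_eq[OF vee_span_closed[OF assms(1)] vee_span_closed[OF assms(2)]]
  using assms by (intro vee_span.add vee_span.smult m_closed U.aug.eps_closed vee_span_closed)
    (simp_all add: aone_A vee_span.one)

text \<open>A product is pushed into a branch of a grafting: (x \<succ> v \<prec> y) \<prec> c = x
  \<succ> v \<prec> (y * c), and b \<succ> (x' \<succ> v' \<prec> y') = (b * x') \<succ> v' \<prec>
  y'. The first uses the induction on b, the second an inner induction on c.\<close>

lemma vee_span_ops:
  assumes "b \<in> vee_span K V" "c \<in> vee_span K V"
  shows "b \<lhd>\<^bsub>U.A\<^esub> c \<in> vee_span K V \<and> b \<rhd>\<^bsub>U.A\<^esub> c \<in> vee_span K V"
  using assms
proof (induction b arbitrary: c rule: vee_span.induct)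
  case one
  have c: "c \<in> carrier U.W" using one by (rule vee_span_closed)
  let ?e = "aeps U.A c"
  have e: "?e \<in> carrier K" using c by (rule U.aug.eps_closed)
  have "aone U.A \<rhd>\<^bsub>U.A\<^esub> c = c \<oplus>\<^bsub>U.W\<^esub> (\<ominus>\<^bsub>K\<^esub> ?e) \<odot>\<^bsub>U.W\<^esub> aone U.A"
    using U.aug.one_succ[OF c] c e
    by (metis U.aug.M.a_assoc U.aug.M.r_neg U.aug.M.r_zero U.aug.M.a_inv_closed U.aug.one_closed
        U.aug.smult_closed U.aug.smult_l_minus U.aug.succ_simps(1))
  then have "aone U.A \<rhd>\<^bsub>U.A\<^esub> c \<in> vee_span K V"
    using one vee_span.smult[OF K_uminus_closed[OF e] vee_span.one, of V] by (simp add: aone_A vee_span.add)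
  then show ?case
    using U.aug.one_prec[OF c] vee_span_zero by (simp add: aone_A)
next
  case (vee v x y)
  let ?b = "vee K V v x y"
  have W: "x \<in> carrier U.W" "y \<in> carrier U.W" "?b \<in> carrier U.W"
    using vee vee_span_closed vee_closed by auto
  have b: "?b \<in> vee_span K V" using vee by (intro vee_span.vee)
  \<comment> \<open>Proved for every c beforehand, because the inner induction for \<succ> needs it
    at x' to form b * x'.\<close>
  have prec: "?b \<lhd>\<^bsub>U.A\<^esub> c \<in> vee_span K V" if c: "c \<in> vee_span K V" for c
  proof -
    have "?b \<lhd>\<^bsub>U.A\<^esub> c = vee K V v x (y \<star>\<^bsub>U.A\<^esub> c)"
      using W vee.hyps(1) vee_span_closed[OF c]
      by (simp add: vee_eq U.aug.prec_prec U.aug.aug_simps gen_in_W)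
    moreover have "y \<star>\<^bsub>U.A\<^esub> c \<in> vee_span K V"
      using vee.IH(2)[OF c] vee.hyps(3) c by (intro vee_span_star) auto
    ultimately show ?thesis using vee.hyps by (simp add: vee_span.vee)
  qed
  moreover have "?b \<rhd>\<^bsub>U.A\<^esub> c \<in> vee_span K V"
    using vee.prems
  proof (induction c rule: vee_span.induct)
    case one
    then show ?case using U.aug.succ_one[OF W(3)] vee_span_zero by (simp add: aone_A)
  next
    case (vee v' x' y')
    have W': "x' \<in> carrier U.W" "y' \<in> carrier U.W"
      using vee.hyps vee_span_closed by auto
    have "?b \<rhd>\<^bsub>U.A\<^esub> vee K V v' x' y' = vee K V v' (?b \<star>\<^bsub>U.A\<^esub> x') y'"
      using W(3) W' vee.hyps(1) unfolding vee_eq[of v']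
      by (simp add: U.aug.succ_prec[symmetric] U.aug.succ_succ U.aug.aug_simps gen_in_W)
    moreover have "?b \<star>\<^bsub>U.A\<^esub> x' \<in> vee_span K V"
      using vee.IH vee.hyps b prec by (intro vee_span_star)
    ultimately show ?case using vee.hyps by (simp add: vee_span.vee)
  next
    case (add c c')
    then show ?case
      using W(3) by (simp add: U.aug.succ_simps vee_span_closed vee_span.add)
  next
    case (smult a c)
    then show ?case
      using W(3) by (simp add: U.aug.succ_simps vee_span_closed vee_span.smult)
  qed
  ultimately show ?case using vee.prems by blast
next
  case (add x y)
  then show ?case
    by (simp add: U.aug.succ_simps U.aug.prec_simps vee_span_closed vee_span.add)
next
  case (smult a x)
  then show ?case
    by (simp add: U.aug.succ_simps U.aug.prec_simps vee_span_closed vee_span.smult)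
qed

lemma carrier_vee_span: "w \<in> carrier U.W \<Longrightarrow> w \<in> vee_span K V"
proof -
  have D: "(\<zero>\<^bsub>K\<^esub>, x) \<in> vee_span K V" if "x \<in> carrier FD" for x
    using that
  proof (induction rule: FD_induct)
    case (gen v)
    have "vee K V v \<one>\<^bsub>U.W\<^esub> \<one>\<^bsub>U.W\<^esub> = gen v"
      using gen by (simp add: vee_eq aone_A[symmetric] U.incl_unit gen_closed)
    moreover have "vee K V v \<one>\<^bsub>U.W\<^esub> \<one>\<^bsub>U.W\<^esub> \<in> vee_span K V"
      by (intro vee_span.vee vee_span.one gen)
    ultimately show ?case by simp
  next
    case (add x y)
    then show ?case
      using vee_span.add[of "(\<zero>\<^bsub>K\<^esub>, x)" K V "(\<zero>\<^bsub>K\<^esub>, y)"] linear_mapD(2)[OF U.incl_linear] by simp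
  next
    case (smult a x)
    then show ?case
      using vee_span.smult[of a K "(\<zero>\<^bsub>K\<^esub>, x)" V] linear_mapD(3)[OF U.incl_linear] by simp
  next
    case (prec x y)
    then show ?case using vee_span_ops U.incl_ops(1) by metis
  next
    case (succ x y)
    then show ?case using vee_span_ops U.incl_ops(2) by metis
  qed
  assume w: "w \<in> carrier U.W"
  show ?thesis
    by (subst U.W_split(1)[OF w])
      (intro vee_span.add vee_span.smult U.W_split[OF w] D vee_span.one[of K V, folded aone_A])
qed

lemma aug_hom_eq:
  assumes "aug_hom K U.W U.A N B f" "aug_hom K U.W U.A N B g"
    and gen: "\<And>v. v \<in> carrier V \<Longrightarrow> f (gen v) = g (gen v)" and w: "w \<in> carrier U.W"
  shows "f w = g w"
proof (rule U.aug_hom_eq_on_W[OF assms(1,2) _ w])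
  note f = aug_homD[OF assms(1)] linear_mapD[OF aug_homD(1)[OF assms(1)]]
  note g = aug_homD[OF assms(2)] linear_mapD[OF aug_homD(1)[OF assms(2)]]
  note i = linear_mapD[OF U.incl_linear]
  fix x assume "x \<in> carrier FD"
  then show "f (\<zero>\<^bsub>K\<^esub>, x) = g (\<zero>\<^bsub>K\<^esub>, x)"
    by (induction rule: FD_induct) (simp_all add: gen i f g U.incl_ops[symmetric])
qed

text \<open>Both maps are kept: f, defined with the unit, is the one that transports braces; \<phi>,
  defined on the dendriform algebra, is the one that passes to a quotient.\<close>

lemma aug_hom_ex:
  assumes "augmented K N B" "linear_map K V N g" "\<And>v. v \<in> carrier V \<Longrightarrow> aeps B (g v) = \<zero>\<^bsub>K\<^esub>"
  shows "\<exists>\<phi> f. dend_hom K FD N B \<phi> \<and> aug_hom K U.W U.A N B f \<and>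
    (\<forall>x\<in>carrier FD. f (\<zero>\<^bsub>K\<^esub>, x) = \<phi> x) \<and> (\<forall>v\<in>carrier V. \<phi> (free_gen K V v) = g v)"
  using free_dendriform_universal[OF assms] U.unit_extension[OF assms(1)] by meson

context
begin

interpretation S: augmented_pair K U.W U.A U.W U.A
  by (intro augmented_pair.intro U.augmented_W)

lemma coproduct_ex:
  "\<exists>\<Delta>. aug_hom K U.W U.A S.T S.AB \<Delta> \<and>
    (\<forall>v\<in>carrier V. \<Delta> (gen v) = U.aug.prim (gen v))"
proof -
  have "linear_map K V S.T (\<lambda>v. U.aug.prim (gen v))"
    by (rule linear_map_comp[OF linear_map_comp[OF gen_linear U.incl_linear] U.aug.prim_linear])
  from aug_hom_ex[OF S.augmented_tensor this U.aug.eps_prim[OF gen_in_ker]]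
  show ?thesis using gen_closed by metis
qed

text \<open>The homomorphism satisfies the defining recursion by \<open>vee_prim\<close>, and the
  recursion has one solution because graftings span. The restriction accounts for the values outside
  the carrier.\<close>

lemma free_coproduct_eq:
  assumes hom: "aug_hom K U.W U.A S.T S.AB \<Delta>"
    and gen: "\<And>v. v \<in> carrier V \<Longrightarrow> \<Delta> (gen v) = U.aug.prim (gen v)"
  shows "free_coproduct K V = restrict \<Delta> (carrier U.W)"
proof -
  note h = aug_homD[OF hom] linear_mapD[OF aug_homD(1)[OF hom]]
  \<comment> \<open>The right counit law, checked on generators; it turns the leading term of
    \<open>vee_prim\<close> into the grafting of x and y themselves.\<close>
  have rho: "S.\<rho> (\<Delta> w) = w" if "w \<in> carrier U.W" for w
    by (rule aug_hom_eq[OF aug_hom_comp[OF hom S.rho_hom] aug_hom_id _ that])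
      (simp add: gen U.aug.rho_prim gen_in_ker)
  have one: "\<one>\<^bsub>U.W\<^esub> \<in> carrier U.W" using U.aug.one_closed by (simp add: aone_A)
  let ?G = "\<lambda>\<Delta> v x y. S.pure (vee K V v x y) \<one>\<^bsub>U.W\<^esub> \<oplus>\<^bsub>S.T\<^esub>
      tensor_op K U.W (mult U.W) (vee K V v) (\<Delta> x) (\<Delta> y)"
  have coproduct_vee: "\<Delta> (vee K V v x y) = ?G \<Delta> v x y"
    if v: "v \<in> carrier V" and x: "x \<in> carrier U.W" and y: "y \<in> carrier U.W" for v x y
  proof -
    have "\<Delta> (vee K V v x y) = (\<Delta> x \<rhd>\<^bsub>S.AB\<^esub> U.aug.prim (gen v)) \<lhd>\<^bsub>S.AB\<^esub> \<Delta> y"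
      using v x y by (simp add: vee_eq h(4,5) gen gen_in_W U.aug.succ_simps)
    also have "\<dots> = S.pure ((x \<rhd>\<^bsub>U.A\<^esub> gen v) \<lhd>\<^bsub>U.A\<^esub> y) (aone U.A) \<oplus>\<^bsub>S.T\<^esub>
        tensor_op2 K U.W U.W (astar U.A) (\<lambda>x y. (x \<rhd>\<^bsub>U.A\<^esub> gen v) \<lhd>\<^bsub>U.A\<^esub> y) (\<Delta> x) (\<Delta> y)"
      using U.aug.vee_prim[OF gen_in_ker[OF v] h(6)[OF x] h(6)[OF y]] by (simp add: rho x y)
    finally show ?thesis
      by (simp add: vee_eq[abs_def] tensor_op_eq aone_A) (simp add: unit_ops_simps)
  qed
  let ?P = "\<lambda>\<Delta>. \<Delta> \<in> extensional (carrier U.W) \<and> linear_map K U.W S.T \<Delta> \<and>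
       \<Delta> \<one>\<^bsub>U.W\<^esub> = S.pure \<one>\<^bsub>U.W\<^esub> \<one>\<^bsub>U.W\<^esub> \<and>
       (\<forall>v\<in>carrier V. \<forall>x\<in>carrier U.W. \<forall>y\<in>carrier U.W.
          \<Delta> (vee K V v x y) = ?G \<Delta> v x y)"
  have "(THE \<Delta>. ?P \<Delta>) = restrict \<Delta> (carrier U.W)"
  proof (rule the_equality)
    have "linear_map K U.W S.T (restrict \<Delta> (carrier U.W))"
      by (rule linear_mapI) (simp_all add: h)
    then show "?P (restrict \<Delta> (carrier U.W))"
      using h(2) by (simp add: one vee_closed coproduct_vee S.one_AB aone_A)
  next
    fix \<Delta>' assume P: "?P \<Delta>'"
    then have h': "linear_map K U.W S.T \<Delta>'" by blast
    have "\<Delta>' w = \<Delta> w" if "w \<in> vee_span K V" for w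
      using that
    proof (induction rule: vee_span.induct)
      case one
      then show ?case using P h(2) by (simp add: S.one_AB aone_A)
    next
      case (vee v x y)
      then have "x \<in> carrier U.W" "y \<in> carrier U.W" by (auto simp: vee_span_closed)
      then show ?case
        using P vee coproduct_vee by simp
    qed (simp_all add: h linear_mapD[OF h'] vee_span_closed)
    then show "\<Delta>' = restrict \<Delta> (carrier U.W)"
      using P carrier_vee_span by (intro extensionalityI[of _ "carrier U.W"]) simp_all
  qed
  then show ?thesis by (simp add: free_coproduct_def Let_def)
qed

end

end

subsection \<open>The coproduct on the enveloping algebra\<close>

locale envelope = brace_algebra K B
  for K :: "('k, 'r) ring_scheme" and B :: "('k, 'b, 'm) brace_alg_scheme"
begin

sublocale F: free_unital K B
  by (intro free_unital.intro free_dend.intro field_axioms module_axioms)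

abbreviation "I \<equiv> enveloping_ideal K B"
abbreviation "\<pi> \<equiv> enveloping_proj K B"

abbreviation "gen_brace x ys \<equiv>
  dendriform_brace K F.FD (free_gen K B x) (map (free_gen K B) ys)"

definition brace_relations :: "('b dterm \<Rightarrow> 'k) set set"
  where "brace_relations =
    {gen_brace x ys \<ominus>\<^bsub>F.FD\<^esub> free_gen K B (brace B x ys) | x ys.
      x \<in> carrier B \<and> set ys \<subseteq> carrier B \<and> ys \<noteq> []}"

lemma ideal_eq: "I = dendriform_ideal_generated K F.FD brace_relations"
  by (simp add: enveloping_ideal_def brace_relations_def Let_def)

lemma brace_closed: "\<lbrakk>x \<in> carrier B; set ys \<subseteq> carrier B; ys \<noteq> []\<rbrakk> \<Longrightarrow> brace B x ys \<in> carrier B"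
  using brace_linear_left linear_mapD(1) by metis

lemma gens_closed: "set ys \<subseteq> carrier B \<Longrightarrow> set (map (free_gen K B) ys) \<subseteq> carrier F.FD"
  using F.gen_closed by auto

lemma two_ops_FD: "two_ops K F.FD"
  by (rule dendriform_algebra_two_ops[OF F.U.D.dendriform_algebra_axioms])

lemma brace_relations_closed: "brace_relations \<subseteq> carrier F.FD"
  unfolding brace_relations_def
  using F.U.dendriform_brace_closed[OF F.gen_closed gens_closed] F.gen_closed[OF brace_closed]
  by auto

lemma ideal_I: "dendriform_ideal K F.FD I"
  unfolding ideal_eq by (rule two_ops.ideal_generated[OF two_ops_FD brace_relations_closed])

sublocale Q: quotient_two_ops K F.FD I
  rewrites "dendriform_quot F.FD I = enveloping K B"
  by (intro quotient_two_ops.intro quotient_two_ops_axioms.intro two_ops_FD ideal_I)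
    (simp add: enveloping_def)

sublocale E: unitized K "enveloping K B"
  rewrites "unitization K (enveloping K B) = unital_enveloping K B"
  using dendriform_algebra_quot[OF F.U.D.dendriform_algebra_axioms ideal_I]
  by (intro unitized.intro) (simp_all add: enveloping_def unital_enveloping_def)

abbreviation "WE \<equiv> unital_enveloping K B"

lemmas WE_simps = unitization_simps[of K "enveloping K B", folded unital_enveloping_def]
lemmas WE_ops_simps = unit_ops_simps[of K "enveloping K B", folded unital_enveloping_def]

lemma proj_pair: "\<pi> (a, x) = (a, I +>\<^bsub>F.FD\<^esub> x)"
  by (simp add: enveloping_proj_def)

lemma proj_hom: "aug_hom K F.U.W F.U.A WE E.A \<pi>"
  unfolding aug_hom_def
proof (intro conjI ballI)
  show "linear_map K F.U.W WE \<pi>"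
    by (rule linear_mapI)
      (auto simp: unitization_simps WE_simps proj_pair Q.Q.coset_closed Q.Q.coset_add Q.Q.coset_smult)
  show "\<pi> (aone F.U.A) = aone E.A"
    by (simp add: unit_ops_simps WE_ops_simps unitization_simps WE_simps proj_pair Q.Q.zero_coset)
  fix x assume x: "x \<in> carrier F.U.W"
  show "aeps E.A (\<pi> x) = aeps F.U.A x"
    by (cases x) (simp add: unit_ops_simps WE_ops_simps proj_pair)
  fix y assume y: "y \<in> carrier F.U.W"
  show "\<pi> (x \<lhd>\<^bsub>F.U.A\<^esub> y) = \<pi> x \<lhd>\<^bsub>E.A\<^esub> \<pi> y" "\<pi> (x \<rhd>\<^bsub>F.U.A\<^esub> y) = \<pi> x \<rhd>\<^bsub>E.A\<^esub> \<pi> y"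
    using x y
    by (auto simp: unit_ops_simps WE_ops_simps unitization_simps WE_simps proj_pair
        Q.coset_prec Q.coset_succ Q.Q.coset_add Q.Q.coset_smult F.U.dops)
qed

lemma proj_surj: "w \<in> carrier WE \<Longrightarrow> \<exists>w'\<in>carrier F.U.W. w = \<pi> w'"
  using Q.Q.coset_rep by (fastforce simp: WE_simps unitization_simps proj_pair)

lemmas proj_closed = linear_mapD(1)[OF aug_homD(1)[OF proj_hom]]

lemma aug_hom_eq:
  assumes "aug_hom K WE E.A N C f" "aug_hom K WE E.A N C g"
    and "\<And>v. v \<in> carrier B \<Longrightarrow> f (\<pi> (F.gen v)) = g (\<pi> (F.gen v))" and w: "w \<in> carrier WE"
  shows "f w = g w"
proof -
  obtain w' where w': "w' \<in> carrier F.U.W" "w = \<pi> w'" using proj_surj w by blast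
  show ?thesis
    unfolding w'(2)
    by (rule F.aug_hom_eq[OF aug_hom_comp[OF proj_hom assms(1)] aug_hom_comp[OF proj_hom assms(2)]])
      (use assms(3) w' in auto)
qed

lemma proj_gen_ker: "v \<in> carrier B \<Longrightarrow> \<pi> (F.gen v) \<in> E.aug.aug_ker"
  by (simp add: proj_pair E.incl_ker Q.Q.coset_closed F.gen_closed)

interpretation SF: augmented_pair K F.U.W F.U.A F.U.W F.U.A
  by (intro augmented_pair.intro F.U.augmented_W)
interpretation SE: augmented_pair K WE E.A WE E.A
  by (intro augmented_pair.intro E.augmented_W)
interpretation TE: augmented K SE.T SE.AB
  by (rule SE.augmented_tensor)

text \<open>Primitive elements are closed under braces, so the relations are sent to zero.\<close>

lemma coproduct_kills_relations:
  assumes f: "aug_hom K F.U.W F.U.A SE.T SE.AB f"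
    and gen: "\<And>v. v \<in> carrier B \<Longrightarrow> f (F.gen v) = E.aug.prim (\<pi> (F.gen v))"
    and x: "x \<in> carrier B" and ys: "set ys \<subseteq> carrier B" "ys \<noteq> []"
  shows "f (\<zero>\<^bsub>K\<^esub>, gen_brace x ys) =
    f (F.gen (brace B x ys))"
proof -
  let ?b = "gen_brace x ys"
  let ?ys = "map F.gen ys"
  have b: "?b \<in> carrier F.FD" by (intro F.U.dendriform_brace_closed F.gen_closed gens_closed x ys)
  have g: "F.gen x \<in> carrier F.U.W" "set ?ys \<subseteq> carrier F.U.W"
    using F.gen_in_W x ys by auto
  have brace: "(\<zero>\<^bsub>K\<^esub>, ?b) = aug_brace K F.U.W F.U.A (F.gen x) ?ys"
    using F.U.brace_incl[OF F.gen_closed[OF x] gens_closed[OF ys(1)]] by (simp add: comp_def)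
  have "?b \<ominus>\<^bsub>F.FD\<^esub> free_gen K B (brace B x ys) \<in> I"
    unfolding ideal_eq using ideal_generated_base brace_relations_def x ys by fast
  then have "I +>\<^bsub>F.FD\<^esub> ?b = I +>\<^bsub>F.FD\<^esub> free_gen K B (brace B x ys)"
    using Q.Q.coset_eq_iff b F.gen_closed[OF brace_closed] x ys by simp
  \<comment> \<open>Over the enveloping algebra the brace of generators is again the image of a
    generator, so its primitive tensor is a value of f given by \<open>gen\<close>.\<close>
  then have eq: "\<pi> (\<zero>\<^bsub>K\<^esub>, ?b) = \<pi> (F.gen (brace B x ys))" by (simp add: proj_pair)
  have "f (\<zero>\<^bsub>K\<^esub>, ?b) = aug_brace K SE.T SE.AB (f (F.gen x)) (map f ?ys)"
    unfolding brace by (rule aug_hom_brace[OF F.U.augmented_W SE.module_tensor f g(2,1)])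
  also have "map f ?ys = map E.aug.prim (map \<pi> ?ys)"
    using gen ys by auto
  also have "f (F.gen x) = E.aug.prim (\<pi> (F.gen x))" by (rule gen[OF x])
  also have "aug_brace K SE.T SE.AB (E.aug.prim (\<pi> (F.gen x))) (map E.aug.prim (map \<pi> ?ys)) =
      E.aug.prim (aug_brace K WE E.A (\<pi> (F.gen x)) (map \<pi> ?ys))"
    by (rule E.aug.brace_prim) (use proj_gen_ker x ys in auto)
  also have "aug_brace K WE E.A (\<pi> (F.gen x)) (map \<pi> ?ys) = \<pi> (\<zero>\<^bsub>K\<^esub>, ?b)"
    unfolding brace by (rule aug_hom_brace[symmetric, OF F.U.augmented_W E.module_W proj_hom g(2,1)])
  also have "E.aug.prim \<dots> = f (F.gen (brace B x ys))"
    unfolding eq using gen[OF brace_closed] x ys by simp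
  finally show ?thesis .
qed

text \<open>The map is built from the free algebra directly into the tensor square of the enveloping
  algebra, where the brace relations hold in each factor; it then kills the ideal and
  descends.\<close>

lemma coproduct_ex:
  "\<exists>\<Delta>. aug_hom K WE E.A SE.T SE.AB \<Delta> \<and>
    (\<forall>v\<in>carrier B. \<Delta> (\<pi> (F.gen v)) = E.aug.prim (\<pi> (F.gen v)))"
proof -
  have "linear_map K B SE.T (\<lambda>v. E.aug.prim (\<pi> (F.gen v)))"
    by (rule linear_map_comp[OF linear_map_comp[OF linear_map_comp[OF F.gen_linear F.U.incl_linear]
          aug_homD(1)[OF proj_hom]] E.aug.prim_linear])
  from F.aug_hom_ex[OF SE.augmented_tensor this E.aug.eps_prim[OF proj_gen_ker]]
  obtain \<phi> f where phi: "dend_hom K F.FD SE.T SE.AB \<phi>" and f: "aug_hom K F.U.W F.U.A SE.T SE.AB f"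
    and f_phi: "\<And>x. x \<in> carrier F.FD \<Longrightarrow> f (\<zero>\<^bsub>K\<^esub>, x) = \<phi> x"
    and gen: "\<And>v. v \<in> carrier B \<Longrightarrow> \<phi> (free_gen K B v) = E.aug.prim (\<pi> (F.gen v))"
    by blast
  have "\<phi> r = \<zero>\<^bsub>SE.T\<^esub>" if "r \<in> brace_relations" for r
  proof -
    obtain x ys where x: "x \<in> carrier B" "set ys \<subseteq> carrier B" "ys \<noteq> []"
      and r: "r = gen_brace x ys \<ominus>\<^bsub>F.FD\<^esub> free_gen K B (brace B x ys)" (is "_ = ?b \<ominus>\<^bsub>_\<^esub> ?c")
      using \<open>r \<in> brace_relations\<close> by (auto simp: brace_relations_def)
    have b: "?b \<in> carrier F.FD" by (intro F.U.dendriform_brace_closed F.gen_closed gens_closed x)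
    have c: "?c \<in> carrier F.FD" by (intro F.gen_closed brace_closed x)
    have "\<phi> ?b = \<phi> ?c"
      using coproduct_kills_relations[OF f _ x] f_phi b c gen F.gen_closed by simp
    moreover have "\<phi> r = \<phi> ?b \<ominus>\<^bsub>SE.T\<^esub> \<phi> ?c"
      unfolding r
      by (rule linear_map_minus[OF F.U.D.module_axioms SE.module_tensor dend_homD(1)[OF phi] b c])
    ultimately show ?thesis
      using linear_mapD(1)[OF dend_homD(1)[OF phi] c] by (simp add: a_minus_def TE.M.r_neg)
  qed
  then have "brace_relations \<subseteq> {x \<in> carrier F.FD. \<phi> x = \<zero>\<^bsub>SE.T\<^esub>}"
    using brace_relations_closed by blast
  from ideal_generated_least[OF two_ops.dend_hom_kernel_ideal[OF two_ops_FD SE.augmented_tensor phi] this]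
  have ker: "\<phi> x = \<zero>\<^bsub>SE.T\<^esub>" if "x \<in> I" for x
    using that by (auto simp: ideal_eq)
  note q = Q.dend_hom_quot[OF SE.module_tensor phi ker]
  note e = E.unit_extension[OF SE.augmented_tensor q(1)]
  show ?thesis
    using e(1)
  proof (intro exI conjI ballI)
    fix v assume v: "v \<in> carrier B"
    show "(\<lambda>(a, x). a \<odot>\<^bsub>SE.T\<^esub> aone SE.AB \<oplus>\<^bsub>SE.T\<^esub> the_elem (\<phi> ` x)) (\<pi> (F.gen v)) =
        E.aug.prim (\<pi> (F.gen v))"
      using e(2)[of "I +>\<^bsub>F.FD\<^esub> free_gen K B v"] v q(2) gen
      by (simp add: proj_pair Q.Q.coset_closed F.gen_closed)
  qed
qed

text \<open>Each required identity equates two homomorphisms of augmented structures, so it reduces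
  to the generators or their images, where the coproduct is primitive.\<close>

theorem enveloping_bialgebra:
  "\<exists>\<Delta>. (\<forall>w\<in>carrier F.U.W. \<Delta> (\<pi> w) = tensor_map K WE WE \<pi> \<pi> (free_coproduct K B w)) \<and>
    dendriform_bialgebra K WE \<Delta>"
proof -
  obtain \<Delta> where hom: "aug_hom K WE E.A SE.T SE.AB \<Delta>"
    and gen: "\<And>v. v \<in> carrier B \<Longrightarrow> \<Delta> (\<pi> (F.gen v)) = E.aug.prim (\<pi> (F.gen v))"
    using coproduct_ex by blast
  obtain \<Delta>F where homF: "aug_hom K F.U.W F.U.A SF.T SF.AB \<Delta>F"
    and genF: "\<And>v. v \<in> carrier B \<Longrightarrow> \<Delta>F (F.gen v) = F.U.aug.prim (F.gen v)"
    using F.coproduct_ex by blast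
  note tm = SF.tensor_map_linear[OF SE.tensor_product_axioms aug_homD(1)[OF proj_hom] aug_homD(1)[OF proj_hom]]
  note pi1 = aug_homD(2)[OF proj_hom]
  \<comment> \<open>Both sides are homomorphisms on the unital free algebra that send a generator v
    to \<pi> v \<otimes> 1 + 1 \<otimes> \<pi> v.\<close>
  have "\<Delta> (\<pi> w) = tensor_map K WE WE \<pi> \<pi> (\<Delta>F w)" if "w \<in> carrier F.U.W" for w
  proof (rule F.aug_hom_eq[OF aug_hom_comp[OF proj_hom hom] aug_hom_comp[OF homF
        SF.tensor_map_hom[OF SE.augmented_pair_axioms proj_hom proj_hom]] _ that])
    fix v assume v: "v \<in> carrier B"
    then show "\<Delta> (\<pi> (F.gen v)) = tensor_map K WE WE \<pi> \<pi> (\<Delta>F (F.gen v))"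
      by (simp add: gen genF linear_mapD[OF tm(1)] tm(2) F.gen_in_W F.U.aug.one_closed SF.pure_simps pi1)
  qed
  then have "\<forall>w\<in>carrier F.U.W. \<Delta> (\<pi> w) = tensor_map K WE WE \<pi> \<pi> (free_coproduct K B w)"
    using F.free_coproduct_eq[OF homF genF] by simp
  moreover have "dendriform_bialgebra K WE \<Delta>"
  proof (rule E.dendriform_bialgebraI[OF hom])
    fix w assume w: "w \<in> carrier WE"
    show "tensor_assoc K WE (tensor_map K SE.T WE \<Delta> (\<lambda>x. x) (\<Delta> w)) =
        tensor_map K WE SE.T (\<lambda>x. x) \<Delta> (\<Delta> w)"
      by (rule aug_hom_eq[OF E.coassoc_homs[OF hom] _ w])
        (intro E.coassoc_prim[OF hom] gen proj_closed F.gen_in_W)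
    show "SE.lam (\<Delta> w) = w"
      by (rule aug_hom_eq[OF aug_hom_comp[OF hom SE.lam_hom] aug_hom_id _ w])
        (use E.aug.aug_kerD[OF proj_gen_ker] in
          \<open>simp add: gen SE.lam_simps SE.pure_AB\<close>)
    show "SE.\<rho> (\<Delta> w) = w"
      by (rule aug_hom_eq[OF aug_hom_comp[OF hom SE.rho_hom] aug_hom_id _ w])
        (simp add: gen E.aug.rho_prim proj_gen_ker)
  qed
  ultimately show ?thesis by blast
qed

end

theorem proposition11:
  fixes K :: "('k, 'r) ring_scheme" and B :: "('k, 'b, 'm) brace_alg_scheme"
  assumes "field K" and "brace_algebra K B"
  shows "\<exists>\<Delta>.
    (\<forall>w\<in>carrier (unitization K (free_dendriform K B)).
      \<Delta> (enveloping_proj K B w) =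
        tensor_map K (unital_enveloping K B) (unital_enveloping K B)
          (enveloping_proj K B) (enveloping_proj K B) (free_coproduct K B w)) \<and>
    dendriform_bialgebra K (unital_enveloping K B) \<Delta>"
  by (rule envelope.enveloping_bialgebra[OF envelope.intro[OF assms(2)]])

end
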